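(* Let $N\ge1$ be an integer and let $0<m<1$, $\sigma>0$ and $1<p<p_L(\sigma)$. Consider the equation $u_t=\Delta u^m+|x|^{\sigma}u^p$ and its self-similar solutions (with finite time extinction) of the form $$u(x,t)=(T-t)^{\alpha}f(|x|(T-t)^{\beta}),\qquad T>0.$$ (1) Let $N\geq3$ and $m\in\left(\frac{N-2}{N+2+2\sigma},m_s\right)$. Then there exists $p_0(\sigma)\in(p_c(\sigma),p_s(\sigma))$ with $p_0(\sigma)>1$ such that for any $p\in(p_0(\sigma),p_s(\sigma))$ there exist self-similar solutions of this form whose profiles $f$ are decreasing and satisfy $$f(\xi)\sim\left[D+\frac{\alpha(1-m)}{2mN}\xi^2\right]^{-1/(1-m)}\ \text{as }\xi\to0,\qquad f(\xi)\sim C\xi^{-(N-2)/m}\ \text{as }\xi\to\infty,$$ for some constants $C,D>0$. Moreover, for such $p$ there are no self-similar solutions of this form with $f(\xi)\sim\left[D+\frac{\alpha(1-m)}{2mN}\xi^2\right]^{-1/(1-m)}$ as $\xi\to0$, $D>0$, and with $f(\xi)\sim C\xi^{-(\sigma+2)/(p-m)}$ as $\xi\to\infty$, $C>0$. (2) Let $N\geq3$ and $m\in(0,m_s)$. Then for any $p\in(\max\{p_s(\sigma),1\},p_L(\sigma))$ there exist self-similar solutions of this form whose profiles $f$ are decreasing and satisfy $$f(\xi)\sim\left[D+\frac{\alpha(1-m)}{2mN}\xi^2\right]^{-1/(1-m)}\ \text{as }\xi\to0,\qquad f(\xi)\sim C\xi^{-(\sigma+2)/(p-m)}\ \text{as }\xi\to\infty,$$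 for some constants $C,D>0$, and there are no profiles with $f(\xi)\sim C\xi^{-(N-2)/m}$ as $\xi\to\infty$, $C>0$. (3) If at least one of the conditions $N\in\{1,2\}$, $m\geq m_c$ is fulfilled, then there are no self-similar solutions of this form. Moreover, for $N\ge3$ and $m\in\left(\frac{N-2}{N+2+2\sigma},m_s\right)$, the exponent $p_0(\sigma)$ being as in (1), there exists $p_1(\sigma)\in(p_c(\sigma),p_0(\sigma)]$ such that for any $p\in(1,p_1(\sigma))$ there are no self-similar solutions of this form.
   Context: Notation: $p_L(\sigma)=1+\frac{\sigma(1-m)}{2}$; $m_c=\frac{N-2}{N}$, $m_s=\frac{N-2}{N+2}$; for $N\ge3$, $p_c(\sigma)=\frac{m(N+\sigma)}{N-2}$ and $p_s(\sigma)=\frac{m(N+2\sigma+2)}{N-2}$; $L=\sigma(m-1)+2(p-1)$, which is negative since $p<p_L(\sigma)$; $$\alpha=-\frac{\sigma+2}{L}>0,\qquad \beta=-\frac{p-m}{L}>0.$$ The exponents $p_0(\sigma),p_1(\sigma)$ may depend on $m,N,\sigma$. A self-similar solution of the form $u(x,t)=(T-t)^{\alpha}f(|x|(T-t)^{\beta})$ means one whose profile $f:[0,\infty)\to[0,\infty)$, $f=f(\xi)$, $\xi=|x|(T-t)^\beta$, is a non-negative function with $f(0)=A>0$, $f'(0)=0$, such that $f^m$ is of class $C^1$ on $(0,\infty)$ (so that at any point $\xi_0\in(0,\infty)$ where $f$ vanishes, the interface condition $(f^m)'(\xi_0)=0$ holds) and which solves, wherever it is positive, $$(f^m)''(\xi)+\frac{N-1}{\xi}(f^m)'(\xi)+\alpha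 f(\xi)+\beta\xi f'(\xi)+\xi^{\sigma}f^p(\xi)=0 .$$ The behavior $f(\xi)\sim\left[D+\frac{\alpha(1-m)}{2mN}\xi^2\right]^{-1/(1-m)}$ as $\xi\to0$ is understood as the expansion $f(\xi)^{m-1}=D+\frac{\alpha(1-m)}{2mN}\xi^2+o(\xi^2)$; the notation $f\sim g$ as $\xi\to\infty$ means $f/g\to1$. *)

theory Defs
  imports "HOL-Analysis.Analysis" "HOL-Library.Landau_Symbols"
begin

definition m_c :: "nat \<Rightarrow> real" where
  "m_c N = (real N - 2) / real N"

definition m_s :: "nat \<Rightarrow> real" where
  "m_s N = (real N - 2) / (real N + 2)"

definition p_L :: "real \<Rightarrow> real \<Rightarrow> real" where
  "p_L m \<sigma> = 1 + \<sigma> * (1 - m) / 2"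

text \<open>The exponents \<^term>\<open>p_c\<close> and \<^term>\<open>p_s\<close> are meaningful for \<open>N \<ge> 3\<close> only.\<close>

definition p_c :: "nat \<Rightarrow> real \<Rightarrow> real \<Rightarrow> real" where
  "p_c N m \<sigma> = m * (real N + \<sigma>) / (real N - 2)"

definition p_s :: "nat \<Rightarrow> real \<Rightarrow> real \<Rightarrow> real" where
  "p_s N m \<sigma> = m * (real N + 2 * \<sigma> + 2) / (real N - 2)"

definition L_const :: "real \<Rightarrow> real \<Rightarrow> real \<Rightarrow> real" where
  "L_const m \<sigma> p = \<sigma> * (m - 1) + 2 * (p - 1)"

definition ss_alpha :: "real \<Rightarrow> real \<Rightarrow> real \<Rightarrow> real" where
  "ss_alpha m \<sigma> p = - (\<sigma> + 2) / L_const m \<sigma> p"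

definition ss_beta :: "real \<Rightarrow> real \<Rightarrow> real \<Rightarrow> real" where
  "ss_beta m \<sigma> p = - (p - m) / L_const m \<sigma> p"

text \<open>
  Profiles are functions on \<open>[0,\<infinity>)\<close>; the values of \<open>f\<close> on negative reals play no role,
  and \<open>f'(0) = 0\<close> is the one-sided derivative.  Since \<open>0 powr m = 0\<close>, the function
  \<open>f powr m\<close> vanishes exactly where \<open>f\<close> does, so requiring it to be \<open>C\<^sup>1\<close> on \<open>(0,\<infinity>)\<close>
  includes the interface condition at the zeros of \<open>f\<close>.
  The differential equation results from inserting
  \<open>u(x,t) = (T-t)\<^sup>\<alpha> f(|x|(T-t)\<^sup>\<beta>)\<close> into \<open>u\<^sub>t = \<Delta>u\<^sup>m + |x|\<^sup>\<sigma> u\<^sup>p\<close>.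
\<close>

definition is_profile :: "nat \<Rightarrow> real \<Rightarrow> real \<Rightarrow> real \<Rightarrow> (real \<Rightarrow> real) \<Rightarrow> bool" where
  "is_profile N m \<sigma> p f \<longleftrightarrow>
     (\<forall>\<xi>\<ge>0. f \<xi> \<ge> 0) \<and> f 0 > 0 \<and>
     (f has_real_derivative 0) (at 0 within {0..}) \<and>
     (\<lambda>\<xi>. f \<xi> powr m) C1_differentiable_on {0<..} \<and>
     (\<forall>\<xi>>0. f \<xi> > 0 \<longrightarrow>
        f differentiable (at \<xi>) \<and>
        deriv (\<lambda>\<xi>. f \<xi> powr m) differentiable (at \<xi>) \<and>
        deriv (deriv (\<lambda>\<xi>. f \<xi> powr m)) \<xi>
          + (real N - 1) / \<xi> * deriv (\<lambda>\<xi>. f \<xi> powr m) \<xi>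
          + ss_alpha m \<sigma> p * f \<xi>
          + ss_beta m \<sigma> p * \<xi> * deriv f \<xi>
          + \<xi> powr \<sigma> * f \<xi> powr p = 0)"

text \<open>
  \<open>u\<close> is a self-similar solution on \<open>\<real>\<^sup>N \<times> (0,T)\<close> with profile \<open>f\<close> and extinction time
  \<open>T\<close>; the space \<open>\<real>\<^sup>N\<close> is represented by a Euclidean space type of dimension \<open>N\<close>.  By
  convention, being a solution means that the profile solves the profile equation in the
  sense of \<^const>\<open>is_profile\<close>.
\<close>

definition self_similar_solution ::
  "real \<Rightarrow> real \<Rightarrow> real \<Rightarrow> real \<Rightarrow> (real \<Rightarrow> real) \<Rightarrow> ('a::euclidean_space \<Rightarrow> real \<Rightarrow> real) \<Rightarrow> bool"
  where
  "self_similar_solution m \<sigma> p T f u \<longleftrightarrow>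
     T > 0 \<and> is_profile DIM('a) m \<sigma> p f \<and>
     (\<forall>x. \<forall>t\<in>{0<..<T}.
        u x t = (T - t) powr ss_alpha m \<sigma> p * f (norm x * (T - t) powr ss_beta m \<sigma> p))"

text \<open>\<open>f(\<xi>) ~ [D + \<alpha>(1-m)/(2mN) \<xi>\<^sup>2]\<close> to the power \<open>-1/(1-m)\<close> as \<open>\<xi> \<rightarrow> 0\<close>, understood as
  the second-order expansion of \<open>f\<close> to the power \<open>m-1\<close>.\<close>

definition origin_behavior ::
  "nat \<Rightarrow> real \<Rightarrow> real \<Rightarrow> real \<Rightarrow> real \<Rightarrow> (real \<Rightarrow> real) \<Rightarrow> bool" where
  "origin_behavior N m \<sigma> p D f \<longleftrightarrow>
     (\<lambda>\<xi>. f \<xi> powr (m - 1) - (D + ss_alpha m \<sigma> p * (1 - m) / (2 * m * real N) * \<xi>\<^sup>2))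
       \<in> o[at_right 0](\<lambda>\<xi>. \<xi>\<^sup>2)"

definition decay_at_infinity :: "real \<Rightarrow> real \<Rightarrow> (real \<Rightarrow> real) \<Rightarrow> bool" where
  "decay_at_infinity k C f \<longleftrightarrow> f \<sim>[at_top] (\<lambda>\<xi>. C * \<xi> powr (- k))"

end

theory Submission
  imports Defs
begin

text \<open>
  In the variables \<open>s = ln \<xi>\<close> and \<open>H = \<xi>\<^sup>\<mu> f\<^sup>m\<close> with \<open>\<mu> = m (\<sigma> + 2) / (p - m)\<close> the profile equation
  becomes that of a damped particle, \<open>H'' = - (c + G) H' + a H - H\<^sup>q\<close> with \<open>q = p / m\<close> and
  \<open>G = (\<beta> / m) \<xi>\<^sup>2 f\<^bsup>1-m\<^esup> > 0\<close>, where \<open>G\<close> tends to zero at both ends; \<open>c\<close> has the sign of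
  \<open>p - p\<^sub>s\<close> and \<open>a\<close> that of \<open>p - p\<^sub>c\<close>.  The energy
  \<open>E = H'\<^sup>2 / 2 - a H\<^sup>2 / 2 + H\<^bsup>q+1\<^esup> / (q + 1)\<close> starts from zero and \<open>E' = - (c + G) H'\<^sup>2\<close>.
  If \<open>c > 0\<close>, every trajectory stays in the well \<open>E < 0\<close> and converges to the equilibrium: slow decay.
  If \<open>c < 0\<close>, the damping is eventually negative, so a trajectory that stays positive must have
  \<open>E \<le> 0\<close> from then on, cannot converge to the equilibrium and tends to zero: fast decay.  For
  \<open>a \<le> 0\<close> the energy is positive, so nothing survives; for small \<open>a > 0\<close>, \<open>E \<le> 0\<close> at the
  time when \<open>G = - c\<close> forces a growth of \<open>G\<close> backwards in time that contradicts an a priori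
  bound.  For \<open>p\<close> slightly below \<open>p\<^sub>s\<close> a fast decaying profile is found by shooting in \<open>f 0\<close>: for
  small data \<open>E > 0\<close>, so \<open>H\<close> has no local minimum, for a fixed datum it has one, because it
  oscillates at \<open>p = p\<^sub>s\<close>, and a datum on the border between these behaviors does not cross zero.
\<close>

subsection \<open>Real functions on half-lines\<close>

text \<open>The logarithmic variables work because \<alpha> = \<beta> \<theta> with \<theta> =
  (\<sigma> + 2) / (p - m): the drift \<alpha> f + \<beta> \<xi> f' = \<beta> (\<theta> f + \<xi>
  f') is a positive multiple of H', so the only non-autonomous term is a friction, and p < p_L is
  exactly the decay of its factor exp (- \<kappa> s). At H = 0 the linear part has the exponents
  \<mu>, along which regular data start, and - (c + \<mu>), which is the fast decay rate. The a
  priori bound on G compares f^(m-1) with the quadratic of a Barenblatt profile. Two obstacles shape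
  the shooting. In w = f^m the drift w^(1/m-1) w' need not be Lipschitz at w = 0, so the equation is
  integrated once into a Volterra equation whose nonlinearities have the exponents 1/m and p/m, both
  above one. And having a strict local minimum is an open condition but not a closed one: its closed
  counterpart, a point with H' = 0 and H^(q-1) \<le> a, is made strict again by backward uniqueness
  at the equilibrium.\<close>

lemma pos_of_tendsto_at_bot:
  fixes F F' :: "real \<Rightarrow> real"
  assumes lim: "(F \<longlongrightarrow> 0) at_bot"
    and der: "\<And>t. t \<le> s \<Longrightarrow> (F has_real_derivative F' t) (at t)"
    and nonneg: "\<And>t. t \<le> s \<Longrightarrow> F' t \<ge> 0"
    and pos: "eventually (\<lambda>t. F' t > 0) at_bot"
  shows "F s > 0"
proof -
  obtain t0 where t0: "\<And>t. t \<le> t0 \<Longrightarrow> F' t > 0"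
    using pos unfolding eventually_at_bot_linorder by blast
  define t where "t = min t0 s"
  have mono: "F x \<le> F y" if "x \<le> y" "y \<le> s" for x y
    using that by (intro DERIV_nonneg_imp_nondecreasing[of x y F]) (auto intro!: der nonneg exI)
  have "eventually (\<lambda>u. F u \<le> F (t - 1)) at_bot"
    unfolding eventually_at_bot_linorder
    by (rule exI[of _ "t - 1"]) (auto intro!: mono simp: t_def)
  then have "0 \<le> F (t - 1)"
    by (rule tendsto_upperbound[OF lim]) simp
  also have "F (t - 1) < F t"
    by (rule DERIV_pos_imp_increasing[of "t - 1" t F]) (auto intro!: exI der t0 simp: t_def)
  also have "F t \<le> F s"
    by (rule mono) (auto simp: t_def)
  finally show ?thesis .
qed

section \<open>Zeros of continuous functions\<close>

lemma first_crossing: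
  fixes F :: "real \<Rightarrow> real"
  assumes cont: "continuous_on {x..y} F" and xy: "x \<le> y" and "F x < 0" "F y \<ge> 0"
  shows "\<exists>t. x < t \<and> t \<le> y \<and> F t = 0 \<and> (\<forall>u. x \<le> u \<longrightarrow> u < t \<longrightarrow> F u < 0)"
proof -
  define Z where "Z = {u \<in> {x..y}. F u \<ge> 0}"
  have "Z = {x..y} \<inter> F -` {0..}" by (auto simp: Z_def)
  then have "closed Z"
    using continuous_closed_preimage[OF cont closed_atLeastAtMost closed_atLeast] by simp
  moreover have "y \<in> Z" using xy assms by (auto simp: Z_def)
  moreover have bdd: "bdd_below Z" by (auto simp: Z_def intro!: bdd_belowI[of _ x])
  ultimately have tZ: "Inf Z \<in> Z" using closed_contains_Inf[of Z] by blast
  define t where "t = Inf Z"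
  have neg: "F u < 0" if "x \<le> u" "u < t" for u
  proof (rule ccontr)
    assume "\<not> F u < 0"
    then have "u \<in> Z" using that tZ by (auto simp: Z_def t_def)
    then show False using that cInf_lower[OF _ bdd, of u] by (auto simp: t_def)
  qed
  have tx: "x < t" using tZ assms(3) by (cases "t = x") (auto simp: Z_def t_def)
  have "F t = 0"
  proof (rule ccontr)
    assume "F t \<noteq> 0"
    then have "F t > 0" using tZ by (auto simp: Z_def t_def)
    moreover have "continuous_on {x..t} F"
      using cont by (rule continuous_on_subset) (use tZ in \<open>auto simp: Z_def t_def\<close>)
    ultimately obtain u where "x \<le> u" "u \<le> t" "F u = 0"
      using IVT'[of F x 0 t] tx assms(3) by auto
    then show False using neg[of u] \<open>F t > 0\<close> by (cases "u = t") auto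
  qed
  moreover have "t \<le> y" using tZ by (auto simp: Z_def t_def)
  ultimately show ?thesis using tx neg by blast
qed

lemma last_crossing:
  fixes F :: "real \<Rightarrow> real"
  assumes cont: "continuous_on {x..y} F" and xy: "x \<le> y" and "F x \<ge> 0" "F y < 0"
  shows "\<exists>t. x \<le> t \<and> t < y \<and> F t = 0 \<and> (\<forall>u. t < u \<longrightarrow> u \<le> y \<longrightarrow> F u < 0)"
proof -
  have "continuous_on {- y..- x} (\<lambda>u. F (- u))"
    by (rule continuous_on_compose2[OF cont]) (auto intro!: continuous_intros)
  then obtain t where t: "- y < t" "t \<le> - x" "F (- t) = 0"
    "\<And>u. - y \<le> u \<Longrightarrow> u < t \<Longrightarrow> F (- u) < 0"
    using first_crossing[of "- y" "- x" "\<lambda>u. F (- u)"] xy assms(3,4) by (simp, blast)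
  have "F u < 0" if "- t < u" "u \<le> y" for u
    using t(4)[of "- u"] that by auto
  then show ?thesis using t by (intro exI[of _ "- t"]) auto
qed

text \<open>The first zero is approached through negative values; a negative derivative there would
  make \<open>F\<close> positive just before it.\<close>

lemma crossing_deriv:
  fixes F F' :: "real \<Rightarrow> real"
  assumes der: "\<And>t. x \<le> t \<Longrightarrow> t \<le> y \<Longrightarrow> (F has_real_derivative F' t) (at t)"
    and xy: "x \<le> y" and "F x < 0" "F y \<ge> 0"
  shows "\<exists>t. x < t \<and> t \<le> y \<and> F t = 0 \<and> F' t \<ge> 0"
proof -
  have "continuous_on {x..y} F"
    using der by (blast intro: DERIV_atLeastAtMost_imp_continuous_on)
  from first_crossing[OF this xy assms(3,4)]
  obtain t where t: "x < t" "t \<le> y" "F t = 0" "\<forall>u. x \<le> u \<longrightarrow> u < t \<longrightarrow> F u < 0"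
    by (elim exE conjE) (rule that)
  have "F' t \<ge> 0"
  proof (rule ccontr)
    assume "\<not> F' t \<ge> 0"
    then obtain d where d: "d > 0" "\<And>h. 0 < h \<Longrightarrow> h < d \<Longrightarrow> F t < F (t - h)"
      using DERIV_neg_dec_left[OF der[of t]] t by auto
    define h where "h = min (d / 2) (t - x)"
    have "F t < F (t - h)" using d(1) t by (intro d(2)) (auto simp: h_def)
    moreover have "F (t - h) < 0" using d(1) t by (auto simp: h_def)
    ultimately show False using t by simp
  qed
  then show ?thesis using t by blast
qed

section \<open>Limits at infinity of functions and their derivatives\<close>

lemma mono_bounded_tendsto:
  fixes F :: "real \<Rightarrow> real"
  assumes mono: "\<And>s t. S \<le> s \<Longrightarrow> s \<le> t \<Longrightarrow> F s \<le> F t"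
    and bdd: "\<And>s. S \<le> s \<Longrightarrow> F s \<le> B"
  shows "\<exists>l. (F \<longlongrightarrow> l) at_top \<and> (\<forall>s\<ge>S. F s \<le> l) \<and> l \<le> B"
proof -
  have bd: "bdd_above (F ` {S..})" by (rule bdd_aboveI[of _ B]) (use bdd in auto)
  define l where "l = Sup (F ` {S..})"
  have le: "F s \<le> l" if "S \<le> s" for s
    unfolding l_def using that by (intro cSup_upper bd) auto
  have lB: "l \<le> B" unfolding l_def by (rule cSup_least) (use bdd in auto)
  have "(F \<longlongrightarrow> l) at_top"
  proof (rule increasing_tendsto)
    show "\<forall>\<^sub>F n in at_top. F n \<le> l"
      using le by (auto simp: eventually_at_top_linorder)
    fix x assume "x < l"
    then obtain s where "S \<le> s" "x < F s"
      unfolding l_def using less_cSup_iff[OF _ bd, of x] by auto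
    then show "\<forall>\<^sub>F n in at_top. x < F n"
      unfolding eventually_at_top_linorder
      by (intro exI[of _ s] allI impI) (use mono in \<open>auto intro: less_le_trans\<close>)
  qed
  then show ?thesis using le lB by blast
qed

lemma antimono_bounded_tendsto:
  fixes F :: "real \<Rightarrow> real"
  assumes mono: "\<And>s t. S \<le> s \<Longrightarrow> s \<le> t \<Longrightarrow> F t \<le> F s"
    and bdd: "\<And>s. S \<le> s \<Longrightarrow> B \<le> F s"
  shows "\<exists>l. (F \<longlongrightarrow> l) at_top \<and> (\<forall>s\<ge>S. l \<le> F s) \<and> B \<le> l"
proof -
  obtain l where l: "((\<lambda>s. - F s) \<longlongrightarrow> l) at_top" "\<forall>s\<ge>S. - F s \<le> l" "l \<le> - B"
    using mono_bounded_tendsto[of S "\<lambda>s. - F s" "- B"] mono bdd by (simp, blast)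
  then have "(F \<longlongrightarrow> - l) at_top" using tendsto_minus[OF l(1)] by simp
  then show ?thesis using l by (intro exI[of _ "- l"]) force
qed

text \<open>Convergence of \<open>F\<close> does not give F' -> 0, but the mean value theorem on
  windows of length \<eta> gives small values of \<open>F'\<close> at points within \<eta> of every
  late time. This closeness is what \<open>barbalat\<close> exploits.\<close>

lemma mvt_selection:
  fixes F F' :: "real \<Rightarrow> real"
  assumes der: "\<And>t. S \<le> t \<Longrightarrow> (F has_real_derivative F' t) (at t)"
    and lim: "(F \<longlongrightarrow> l) at_top" and eta: "\<eta> > 0"
  shows "\<exists>z. (\<forall>s\<ge>S. s < z s \<and> z s < s + \<eta>) \<and> filterlim z at_top at_top
    \<and> ((\<lambda>s. F' (z s)) \<longlongrightarrow> 0) at_top"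
proof -
  have "\<exists>z. s < z \<and> z < s + \<eta> \<and> F (s + \<eta>) - F s = \<eta> * F' z" if "S \<le> s" for s
    using MVT2[of s "s + \<eta>" F F'] der that eta by auto
  then obtain z where z: "\<And>s. S \<le> s \<Longrightarrow> s < z s \<and> z s < s + \<eta> \<and> F (s + \<eta>) - F s = \<eta> * F' (z s)"
    by metis
  have ev: "\<forall>\<^sub>F s in at_top. s \<le> z s"
    using z by (auto simp: eventually_at_top_linorder intro!: exI[of _ S] less_imp_le)
  have 1: "filterlim z at_top at_top"
    by (rule filterlim_at_top_mono[OF filterlim_ident ev])
  have "((\<lambda>s. F (s + \<eta>)) \<longlongrightarrow> l) at_top"
    using eta by (intro filterlim_compose[OF lim] filterlim_at_top_mono[OF filterlim_ident]) auto
  then have "((\<lambda>s. (F (s + \<eta>) - F s) / \<eta>) \<longlongrightarrow> (l - l) / \<eta>) at_top"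
    using eta by (intro tendsto_intros lim) auto
  then have "((\<lambda>s. (F (s + \<eta>) - F s) / \<eta>) \<longlongrightarrow> 0) at_top" by simp
  moreover have "\<forall>\<^sub>F s in at_top. (F (s + \<eta>) - F s) / \<eta> = F' (z s)"
    using z eta by (auto simp: eventually_at_top_linorder intro!: exI[of _ S])
  ultimately have "((\<lambda>s. F' (z s)) \<longlongrightarrow> 0) at_top"
    by (rule Lim_transform_eventually)
  then show ?thesis using z 1 by blast
qed

lemma tendsto_deriv_zero:
  fixes F F' :: "real \<Rightarrow> real"
  assumes der: "\<And>t. S \<le> t \<Longrightarrow> (F has_real_derivative F' t) (at t)"
    and lim: "(F \<longlongrightarrow> l) at_top" and lim': "(F' \<longlongrightarrow> k) at_top"
  shows "k = 0"
proof -
  obtain z :: "real \<Rightarrow> real" where z: "filterlim z at_top at_top" "((\<lambda>s. F' (z s)) \<longlongrightarrow> 0) at_top"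
    using mvt_selection[OF der lim zero_less_one] by blast
  have "((\<lambda>s. F' (z s)) \<longlongrightarrow> k) at_top"
    by (rule filterlim_compose[OF lim' z(1)])
  then show ?thesis using tendsto_unique z(2) by (metis trivial_limit_at_top_linorder)
qed

text \<open>For a monotone function one selection of times going to infinity decides the limit. The
  energy is eventually monotone, but its limit can be computed only along times with small
  \<open>H1\<close>.\<close>

lemma mono_tendsto_of_selection:
  fixes F :: "real \<Rightarrow> real"
  assumes mono: "\<And>s t. S \<le> s \<Longrightarrow> s \<le> t \<Longrightarrow> F s \<le> F t"
    and z: "filterlim z at_top at_top" and lim: "((\<lambda>s. F (z s)) \<longlongrightarrow> l) (at_top :: real filter)"
  shows "(F \<longlongrightarrow> l) at_top" "\<And>s. S \<le> s \<Longrightarrow> F s \<le> l"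
proof -
  have ev: "\<forall>\<^sub>F t in at_top. F s \<le> F (z t)" if "S \<le> s" for s
  proof -
    have "\<forall>\<^sub>F t in at_top. s \<le> z t" using z by (auto simp: filterlim_at_top)
    then show ?thesis by eventually_elim (use mono that in auto)
  qed
  show le: "F s \<le> l" if "S \<le> s" for s
    by (rule tendsto_lowerbound[OF lim ev[OF that]]) simp
  obtain l' where l': "(F \<longlongrightarrow> l') at_top"
    using mono_bounded_tendsto[of S F l, OF mono le] by blast
  have "((\<lambda>s. F (z s)) \<longlongrightarrow> l') at_top" by (rule filterlim_compose[OF l' z])
  then have "l' = l" using tendsto_unique lim by (metis trivial_limit_at_top_linorder)
  then show "(F \<longlongrightarrow> l) at_top" using l' by simp
qed

text \<open>\<open>F'\<close> is small at points within \<eta> of any late time; there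
  \<open>K\<close> is small because \<open>r\<close> is, and the bound on \<open>K'\<close> carries
  this to the time itself at the cost \<eta> M. The vanishing part \<open>r\<close> needs no
  derivative.\<close>

lemma barbalat:
  fixes F F' K K' r :: "real \<Rightarrow> real"
  assumes der: "\<And>t. S \<le> t \<Longrightarrow> (F has_real_derivative F' t) (at t)"
    and lim: "(F \<longlongrightarrow> l) at_top"
    and F': "\<And>t. S \<le> t \<Longrightarrow> F' t = K t + r t" and r: "(r \<longlongrightarrow> 0) at_top"
    and K: "\<And>t. S \<le> t \<Longrightarrow> (K has_real_derivative K' t) (at t)"
    and K': "\<And>t. S \<le> t \<Longrightarrow> \<bar>K' t\<bar> \<le> M"
  shows "(K \<longlongrightarrow> 0) at_top"
proof (rule tendstoI)
  fix e :: real assume e: "e > 0"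
  have M0: "M \<ge> 0" using K'[of S] by auto
  \<comment> \<open>Small enough that \<open>K\<close> changes by less than e / 3 over one
    window.\<close>
  define \<eta> where "\<eta> = e / (3 * (M + 1))"
  have eta: "\<eta> > 0" using e M0 by (auto simp: \<eta>_def)
  obtain z where z: "\<And>s. S \<le> s \<Longrightarrow> s < z s" "\<And>s. S \<le> s \<Longrightarrow> z s < s + \<eta>"
    "filterlim z at_top at_top" "((\<lambda>s. F' (z s)) \<longlongrightarrow> 0) at_top"
    using mvt_selection[OF der lim eta] by blast
  have "((\<lambda>s. r (z s)) \<longlongrightarrow> 0) at_top" by (rule filterlim_compose[OF r z(3)])
  then have "\<forall>\<^sub>F s in at_top. \<bar>r (z s)\<bar> < e / 3"
    using e by (auto dest!: tendstoD[of _ _ _ "e / 3"])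
  moreover have "\<forall>\<^sub>F s in at_top. \<bar>F' (z s)\<bar> < e / 3"
    using z(4) e by (auto dest!: tendstoD[of _ _ _ "e / 3"])
  moreover have "\<forall>\<^sub>F s in at_top. S \<le> s" by (rule eventually_ge_at_top)
  ultimately show "\<forall>\<^sub>F s in at_top. dist (K s) 0 < e"
  proof eventually_elim
    case (elim s)
    obtain u where u: "s < u" "u < z s" "K (z s) - K s = (z s - s) * K' u"
      using MVT2[of s "z s" K K'] z(1) K elim by force
    have "\<bar>K (z s) - K s\<bar> = (z s - s) * \<bar>K' u\<bar>" using u by (auto simp: abs_mult)
    also have "\<dots> \<le> \<eta> * M"
      using z(2)[of s] elim u K'[of u] eta by (intro mult_mono) auto
    also have "\<dots> < e / 3" using e M0 by (auto simp: \<eta>_def field_simps)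
    finally have "\<bar>K (z s) - K s\<bar> < e / 3" .
    moreover have "F' (z s) = K (z s) + r (z s)" using F'[of "z s"] z(1)[of s] elim by auto
    ultimately have "\<bar>K s\<bar> < e" using elim by linarith
    then show ?case by simp
  qed
qed

text \<open>The equation expands at rate at least \<mu>, so above the level
  \<open>R s / \<mu>\<close> the solution is pushed upwards for ever, and linear growth already
  contradicts the bound \<open>B\<close>. Since \<open>R\<close> is nonincreasing, the level at time
  \<open>s\<close> serves for all later times.\<close>

lemma expanding_bound_upper:
  fixes z b r R :: "real \<Rightarrow> real"
  assumes der: "\<And>t. S \<le> t \<Longrightarrow> (z has_real_derivative b t * z t + r t) (at t)"
    and b: "\<And>t. S \<le> t \<Longrightarrow> b t \<ge> \<mu>" and mu: "\<mu> > 0"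
    and r: "\<And>t. S \<le> t \<Longrightarrow> \<bar>r t\<bar> \<le> R t"
    and R: "\<And>s t. S \<le> s \<Longrightarrow> s \<le> t \<Longrightarrow> R t \<le> R s"
    and zb: "\<And>t. S \<le> t \<Longrightarrow> z t \<le> B" and s: "S \<le> s"
  shows "z s \<le> R s / \<mu>"
proof (rule ccontr)
  assume "\<not> z s \<le> R s / \<mu>"
  define k where "k = R s / \<mu>"
  have k0: "k \<ge> 0" unfolding k_def using r[OF s] mu by auto
  have zk: "z s > k" using \<open>\<not> z s \<le> R s / \<mu>\<close> by (simp add: k_def)
  \<comment> \<open>A barrier strictly between the level and \<open>z s\<close>: above it z' is at
    least \<mu> (k' - k) > 0, so it is never crossed downwards.\<close>
  define k' where "k' = (k + z s) / 2"
  have k': "k < k'" "k' < z s" using zk by (auto simp: k'_def)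
  have grow: "b t * z t + r t \<ge> \<mu> * (k' - k)" if "s \<le> t" "z t \<ge> k'" for t
  proof -
    have "b t * z t \<ge> \<mu> * k'" using b[of t] that s mu k' k0 by (intro mult_mono) auto
    moreover have "r t \<ge> - R s" using r[of t] R[of s t] that s by auto
    moreover have "R s = \<mu> * k" using mu by (auto simp: k_def)
    ultimately show ?thesis by (simp add: algebra_simps)
  qed
  have stay: "z t > k'" if "s \<le> t" for t
  proof (rule ccontr)
    assume "\<not> z t > k'"
    have "((\<lambda>t. k' - z t) has_real_derivative - (b t * z t + r t)) (at t)" if "s \<le> t" for t
      using that s by (auto intro!: derivative_eq_intros der)
    then obtain u where "s < u" "u \<le> t" "k' - z u = 0" "- (b u * z u + r u) \<ge> 0"
      using crossing_deriv[of s t "\<lambda>t. k' - z t" "\<lambda>t. - (b t * z t + r t)"] \<open>s \<le> t\<close> k' \<open>\<not> z t > k'\<close>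
      by (simp, blast)
    moreover have "\<mu> * (k' - k) > 0" using mu k' by auto
    ultimately show False using grow[of u] by auto
  qed
  have lin: "z t \<ge> z s + \<mu> * (k' - k) * (t - s)" if "s \<le> t" for t
  proof -
    have "z s - \<mu> * (k' - k) * s \<le> z t - \<mu> * (k' - k) * t"
    proof (rule DERIV_nonneg_imp_nondecreasing[OF that])
      fix x assume x: "s \<le> x" "x \<le> t"
      show "\<exists>y. ((\<lambda>t. z t - \<mu> * (k' - k) * t) has_real_derivative y) (at x) \<and> 0 \<le> y"
        using x s stay[of x] grow[of x]
        by (intro exI[of _ "b x * z x + r x - \<mu> * (k' - k)"]) (auto intro!: derivative_eq_intros der)
    qed
    then show ?thesis by (simp add: algebra_simps)
  qed
  \<comment> \<open>The time at which the linear lower bound equals \<open>B + 1\<close>.\<close>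
  define t where "t = s + (B - z s + 1) / (\<mu> * (k' - k))"
  have pos: "\<mu> * (k' - k) > 0" using mu k' by auto
  have "s \<le> t" unfolding t_def using pos zb[OF s] by (auto intro!: divide_nonneg_pos)
  moreover have "\<mu> * (k' - k) * (t - s) = B - z s + 1"
    using mu k' by (simp add: t_def)
  ultimately have "z t \<ge> z s + (B - z s + 1)" using lin[of t] by simp
  then show False using zb[of t] \<open>s \<le> t\<close> s by auto
qed

lemma expanding_bound:
  fixes z b r R :: "real \<Rightarrow> real"
  assumes der: "\<And>t. S \<le> t \<Longrightarrow> (z has_real_derivative b t * z t + r t) (at t)"
    and b: "\<And>t. S \<le> t \<Longrightarrow> b t \<ge> \<mu>" and mu: "\<mu> > 0"
    and r: "\<And>t. S \<le> t \<Longrightarrow> \<bar>r t\<bar> \<le> R t"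
    and R: "\<And>s t. S \<le> s \<Longrightarrow> s \<le> t \<Longrightarrow> R t \<le> R s"
    and zb: "\<And>t. S \<le> t \<Longrightarrow> \<bar>z t\<bar> \<le> B" and s: "S \<le> s"
  shows "\<bar>z s\<bar> \<le> R s / \<mu>"
proof -
  have "z s \<le> R s / \<mu>"
  proof (rule expanding_bound_upper[where z = z and r = r and S = S and b = b and B = B])
    show "z t \<le> B" if "S \<le> t" for t using zb[OF that] by linarith
  qed (rule mu s | erule der b r | erule (1) R)+
  moreover have "- z s \<le> R s / \<mu>"
  proof (rule expanding_bound_upper[where z = "\<lambda>t. - z t" and r = "\<lambda>t. - r t" and S = S and b = b and B = B])
    fix t assume t: "S \<le> t"
    show "((\<lambda>t. - z t) has_real_derivative b t * - z t + - r t) (at t)"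
      using der[OF t] by (auto intro!: derivative_eq_intros)
    show "\<bar>- r t\<bar> \<le> R t" using r[OF t] by simp
    show "- z t \<le> B" using zb[OF t] by linarith
  qed (rule mu s | erule b | erule (1) R)+
  ultimately show ?thesis by auto
qed

text \<open>\<open>F + K / l * exp (- l * t)\<close> is nonincreasing, and with the minus sign it is
  nondecreasing, which bounds the former from below.\<close>

lemma tendsto_of_exp_bound_deriv:
  fixes F z :: "real \<Rightarrow> real"
  assumes der: "\<And>t. S \<le> t \<Longrightarrow> (F has_real_derivative z t) (at t)"
    and z: "\<And>t. S \<le> t \<Longrightarrow> \<bar>z t\<bar> \<le> K * exp (- l * t)" and l: "l > 0" and K: "K \<ge> 0"
  shows "\<exists>L. (F \<longlongrightarrow> L) at_top"
proof -
  define P where "P = (\<lambda>t. F t + K / l * exp (- l * t))"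
  have P: "P t \<le> P s" if "S \<le> s" "s \<le> t" for s t
  proof (rule DERIV_nonpos_imp_nonincreasing[OF that(2)])
    fix x assume x: "s \<le> x" "x \<le> t"
    then show "\<exists>y. (P has_real_derivative y) (at x) \<and> y \<le> 0"
      unfolding P_def using that z[of x] l
      by (intro exI[of _ "z x - K * exp (- l * x)"]) (auto intro!: derivative_eq_intros der)
  qed
  have Q: "F s - K / l * exp (- l * s) \<le> F t - K / l * exp (- l * t)" if "S \<le> s" "s \<le> t" for s t
  proof (rule DERIV_nonneg_imp_nondecreasing[OF that(2)])
    fix x assume x: "s \<le> x" "x \<le> t"
    then show "\<exists>y. ((\<lambda>t. F t - K / l * exp (- l * t)) has_real_derivative y) (at x) \<and> 0 \<le> y"
      using that z[of x] l
      by (intro exI[of _ "z x + K * exp (- l * x)"]) (auto intro!: derivative_eq_intros der)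
  qed
  have "F S - K / l * exp (- l * S) \<le> P t" if "S \<le> t" for t
  proof -
    have "F t - K / l * exp (- l * t) \<le> P t" using K l by (auto simp: P_def)
    then show ?thesis using Q[of S t] that by auto
  qed
  then obtain L where L: "(P \<longlongrightarrow> L) at_top"
    using antimono_bounded_tendsto[of S P, OF P] by blast
  have lt: "filterlim (\<lambda>t. - l * t) at_bot at_top"
    using filterlim_tendsto_neg_mult_at_bot[of "\<lambda>_. - l" "- l" at_top "\<lambda>t. t"] l
    by (simp add: filterlim_ident)
  have "((\<lambda>t. P t - K / l * exp (- l * t)) \<longlongrightarrow> L - K / l * 0) at_top"
    by (intro tendsto_intros L filterlim_compose[OF exp_at_bot lt])
  then show ?thesis by (auto simp: P_def)
qed

subsection \<open>The profile equation in logarithmic variables\<close>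

text \<open>\<open>I\<close> consists of all reals for a positive profile, and of the times before
  the first zero for a shooting solution that crosses. \<open>H1_less\<close> says that f decreases;
  \<open>H_bot\<close> and \<open>y_bot\<close> describe the regular start at the origin. By
  \<open>a_eq\<close> the roots of x^2 + c x - a are \<mu> and - (c + \<mu>).\<close>

locale damped_trajectory =
  fixes a c q \<kappa> \<rho> \<mu> g0 :: real and I :: "real set" and H H1 :: "real \<Rightarrow> real"
  assumes q: "q > 1" and kappa: "\<kappa> > 0" and rho: "\<rho> > 0" and mu: "\<mu> > 0" and g0: "g0 > 0"
    and a_eq: "a = \<mu> * (c + \<mu>)"
    and I_down: "\<And>s t. s \<in> I \<Longrightarrow> t \<le> s \<Longrightarrow> t \<in> I" and I_ne: "I \<noteq> {}"
    and H_pos: "\<And>s. s \<in> I \<Longrightarrow> H s > 0"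
    and H_deriv: "\<And>s. s \<in> I \<Longrightarrow> (H has_real_derivative H1 s) (at s)"
    and H1_deriv: "\<And>s. s \<in> I \<Longrightarrow> (H1 has_real_derivative
        - (c + g0 * exp (- \<kappa> * s) * H s powr \<rho>) * H1 s + a * H s - H s powr q) (at s)"
    and H1_less: "\<And>s. s \<in> I \<Longrightarrow> H1 s < \<mu> * H s"
    and H_bot: "(H \<longlongrightarrow> 0) at_bot"
    and y_bot: "((\<lambda>s. H1 s / H s) \<longlongrightarrow> \<mu>) at_bot"
begin

definition G :: "real \<Rightarrow> real" where "G s = g0 * exp (- \<kappa> * s) * H s powr \<rho>"
text \<open>With \<open>V\<close> the force is \<open>H * (a - V)\<close>, the positive equilibrium
  is V = a, and the logarithmic derivative is simply (q - 1) H1 / H.\<close>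

definition V :: "real \<Rightarrow> real" where "V s = H s powr (q - 1)"
definition Pot :: "real \<Rightarrow> real" where "Pot h = h powr (q + 1) / (q + 1) - a * h\<^sup>2 / 2"
definition E :: "real \<Rightarrow> real" where "E s = (H1 s)\<^sup>2 / 2 + Pot (H s)"

lemma G_pos: "s \<in> I \<Longrightarrow> G s > 0"
  using g0 H_pos[of s] by (simp add: G_def)

lemma V_pos: "s \<in> I \<Longrightarrow> V s > 0"
  using H_pos[of s] by (simp add: V_def)

lemma H_powr_q: "s \<in> I \<Longrightarrow> H s powr q = H s * V s"
  using H_pos[of s] powr_add[of "H s" 1 "q - 1"] by (simp add: V_def)

lemma H_powr_q1: "s \<in> I \<Longrightarrow> H s powr (q + 1) = (H s)\<^sup>2 * V s"
  using H_pos[of s] powr_add[of "H s" 2 "q - 1"] by (simp add: V_def powr_numeral add.commute)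

lemma H1_deriv_eq:
  "s \<in> I \<Longrightarrow> (H1 has_real_derivative - (c + G s) * H1 s + H s * (a - V s)) (at s)"
  using H1_deriv[of s] H_powr_q[of s] by (simp add: G_def algebra_simps)

lemma V_deriv: "s \<in> I \<Longrightarrow> (V has_real_derivative (q - 1) * (H1 s / H s) * V s) (at s)"
proof -
  assume s: "s \<in> I"
  have "H s powr (q - 1 - of_nat 1) = H s powr (q - 1) / H s"
    using H_pos[OF s] powr_diff[of "H s" "q - 1" 1] by simp
  then show ?thesis
    unfolding V_def[abs_def]
    by (intro DERIV_cong[OF DERIV_fun_powr[OF H_deriv[OF s] H_pos[OF s]]]) simp
qed

lemma G_deriv: "s \<in> I \<Longrightarrow> (G has_real_derivative G s * (- \<kappa> + \<rho> * (H1 s / H s))) (at s)"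
proof -
  assume s: "s \<in> I"
  have "((\<lambda>s. H s powr \<rho>) has_real_derivative \<rho> * H s powr (\<rho> - of_nat 1) * H1 s) (at s)"
    by (rule DERIV_fun_powr[OF H_deriv[OF s] H_pos[OF s]])
  moreover have "H s powr (\<rho> - of_nat 1) = H s powr \<rho> / H s"
    using H_pos[OF s] by (simp add: powr_diff)
  ultimately have D: "((\<lambda>s. H s powr \<rho>) has_real_derivative \<rho> * (H s powr \<rho> / H s) * H1 s) (at s)"
    by simp
  have 2: "((\<lambda>s. g0 * exp (- \<kappa> * s)) has_real_derivative g0 * exp (- \<kappa> * s) * - \<kappa>) (at s)"
    by (auto intro!: derivative_eq_intros)
  show ?thesis
    unfolding G_def[abs_def] by (rule DERIV_cong[OF DERIV_mult[OF 2 D]]) (simp add: algebra_simps)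
qed

lemma y_deriv:
  "s \<in> I \<Longrightarrow> ((\<lambda>s. H1 s / H s) has_real_derivative
     - (H1 s / H s)\<^sup>2 - (c + G s) * (H1 s / H s) + a - V s) (at s)"
  using H_pos[of s]
  by (auto intro!: derivative_eq_intros H_deriv H1_deriv_eq simp: field_simps power2_eq_square)

lemma Pot_deriv:
  "h > 0 \<Longrightarrow> (Pot has_real_derivative h * (h powr (q - 1) - a)) (at h)"
proof -
  assume h: "h > 0"
  have 1: "((\<lambda>x. x powr (q + 1)) has_real_derivative (q + 1) * h powr q) (at h)"
    using DERIV_fun_powr[OF DERIV_ident h, of "q + 1"] by simp
  have "((\<lambda>x. a * x\<^sup>2 / 2) has_real_derivative a * (2 * h) / 2) (at h)"
    by (auto intro!: derivative_eq_intros)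
  from DERIV_diff[OF DERIV_cdivide[OF 1, of "q + 1"] this]
  have "(Pot has_real_derivative (q + 1) * h powr q / (q + 1) - a * (2 * h) / 2) (at h)"
    unfolding Pot_def[abs_def] by simp
  moreover have "(q + 1) * h powr q / (q + 1) - a * (2 * h) / 2 = h * (h powr (q - 1) - a)"
    using q h powr_add[of h 1 "q - 1"] by (simp add: right_diff_distrib)
  ultimately show ?thesis by simp
qed

lemma Pot_H: "s \<in> I \<Longrightarrow> Pot (H s) = (H s)\<^sup>2 * (V s / (q + 1) - a / 2)"
  unfolding Pot_def by (simp only: H_powr_q1) (simp add: algebra_simps)

lemma E_deriv: "s \<in> I \<Longrightarrow> (E has_real_derivative - (c + G s) * (H1 s)\<^sup>2) (at s)"
proof -
  assume s: "s \<in> I"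
  have 1: "((\<lambda>s. Pot (H s)) has_real_derivative H s * (V s - a) * H1 s) (at s)"
    using DERIV_chain2[OF Pot_deriv[OF H_pos[OF s]] H_deriv[OF s]] by (simp add: V_def)
  have 2: "((\<lambda>s. (H1 s)\<^sup>2 / 2) has_real_derivative
      H1 s * (- (c + G s) * H1 s + H s * (a - V s))) (at s)"
    by (auto intro!: derivative_eq_intros H1_deriv_eq[OF s])
  show ?thesis
    unfolding E_def[abs_def]
    by (rule DERIV_cong[OF DERIV_add[OF 2 1]]) (simp add: algebra_simps power2_eq_square)
qed

section \<open>Behavior at minus infinity and the sign of the energy\<close>

lemma ev_I: "eventually (\<lambda>s. s \<in> I) at_bot"
  using I_ne I_down unfolding eventually_at_bot_linorder by blast

lemma H_nonneg_bot: "eventually (\<lambda>s. 0 \<le> H s) at_bot"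
  using ev_I by eventually_elim (auto intro: less_imp_le H_pos)

lemma H1_bot: "(H1 \<longlongrightarrow> 0) at_bot"
proof -
  have "((\<lambda>s. H1 s / H s * H s) \<longlongrightarrow> \<mu> * 0) at_bot"
    by (intro tendsto_intros y_bot H_bot)
  moreover have "eventually (\<lambda>s. H1 s / H s * H s = H1 s) at_bot"
    using ev_I by eventually_elim (use H_pos in force)
  ultimately show ?thesis using Lim_transform_eventually by fastforce
qed

lemma H1_pos_bot: "eventually (\<lambda>s. H1 s > 0) at_bot"
proof -
  have "eventually (\<lambda>s. H1 s / H s > 0) at_bot"
    using order_tendstoD(1)[OF y_bot mu] .
  then show ?thesis using ev_I
    by eventually_elim (use H_pos in \<open>force simp: zero_less_divide_iff\<close>)
qed

lemma V_bot: "(V \<longlongrightarrow> 0) at_bot"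
  unfolding V_def using q H_nonneg_bot by (intro tendsto_zero_powrI[OF H_bot tendsto_const]) auto

lemma E_bot: "(E \<longlongrightarrow> 0) at_bot"
proof -
  have "((\<lambda>s. H s powr (q + 1)) \<longlongrightarrow> 0) at_bot"
    using q H_nonneg_bot by (intro tendsto_zero_powrI[OF H_bot tendsto_const]) auto
  then have "((\<lambda>s. (H1 s)\<^sup>2 / 2 + (H s powr (q + 1) / (q + 1) - a * (H s)\<^sup>2 / 2)) \<longlongrightarrow>
      0\<^sup>2 / 2 + (0 / (q + 1) - a * 0\<^sup>2 / 2)) at_bot"
    using q by (intro tendsto_intros H1_bot H_bot) auto
  then show ?thesis by (simp add: E_def[abs_def] Pot_def)
qed

text \<open>Negative damping feeds the energy, which starts from zero; near minus infinity
  \<open>H1 > 0\<close>, so the gain is strict.\<close>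

lemma E_pos:
  assumes d: "\<And>t. t \<in> I \<Longrightarrow> c + G t < 0" and s: "s \<in> I"
  shows "E s > 0"
proof (rule pos_of_tendsto_at_bot[OF E_bot])
  fix t assume "t \<le> s"
  then have t: "t \<in> I" using I_down s by blast
  show "(E has_real_derivative - (c + G t) * (H1 t)\<^sup>2) (at t)" by (rule E_deriv[OF t])
  show "0 \<le> - (c + G t) * (H1 t)\<^sup>2" using d[OF t] by (intro mult_nonneg_nonneg) auto
next
  show "eventually (\<lambda>t. - (c + G t) * (H1 t)\<^sup>2 > 0) at_bot"
    using H1_pos_bot ev_I by eventually_elim (use d in \<open>force intro!: mult_pos_pos\<close>)
qed

text \<open>\<open>G > 0\<close> makes the loss of energy strict even for c = 0, the case of the
  critical exponent.\<close>

lemma E_neg: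
  assumes c: "c \<ge> 0" and s: "s \<in> I"
  shows "E s < 0"
proof -
  have "- E s > 0"
  proof (rule pos_of_tendsto_at_bot[of "\<lambda>s. - E s"])
    show "((\<lambda>s. - E s) \<longlongrightarrow> 0) at_bot" using tendsto_minus[OF E_bot] by simp
    fix t assume "t \<le> s"
    then have t: "t \<in> I" using I_down s by blast
    show "((\<lambda>s. - E s) has_real_derivative (c + G t) * (H1 t)\<^sup>2) (at t)"
      using DERIV_minus[OF E_deriv[OF t]] by (simp add: algebra_simps)
    show "0 \<le> (c + G t) * (H1 t)\<^sup>2" using G_pos[OF t] c by simp
  next
    show "eventually (\<lambda>t. (c + G t) * (H1 t)\<^sup>2 > 0) at_bot"
      using H1_pos_bot ev_I by eventually_elim (use G_pos c in \<open>force intro!: mult_pos_pos\<close>)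
  qed
  then show ?thesis by simp
qed

lemma E_mono:
  assumes "s \<le> t" "t \<in> I" and d: "\<And>u. s \<le> u \<Longrightarrow> u \<le> t \<Longrightarrow> c + G u \<le> 0"
  shows "E s \<le> E t"
proof (rule DERIV_nonneg_imp_nondecreasing[OF assms(1)])
  fix x assume x: "s \<le> x" "x \<le> t"
  then have "x \<in> I" using I_down assms by blast
  then show "\<exists>y. (E has_real_derivative y) (at x) \<and> 0 \<le> y"
    using E_deriv[of x] d[OF x] by (intro exI[of _ "- (c + G x) * (H1 x)\<^sup>2"]) (auto simp: mult_nonpos_nonneg)
qed

lemma E_antimono:
  assumes "s \<le> t" "t \<in> I" and c: "c \<ge> 0"
  shows "E t \<le> E s"
proof (rule DERIV_nonpos_imp_nonincreasing[OF assms(1)])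
  fix x assume x: "s \<le> x" "x \<le> t"
  then have "x \<in> I" using I_down assms by blast
  then show "\<exists>y. (E has_real_derivative y) (at x) \<and> y \<le> 0"
    using E_deriv[of x] G_pos[of x] c
    by (intro exI[of _ "- (c + G x) * (H1 x)\<^sup>2"]) (auto intro!: mult_nonpos_nonneg)
qed

section \<open>The positive equilibrium and turning points\<close>

definition Hs :: real where "Hs = a powr (1 / (q - 1))"

lemma Hs_powr: "a > 0 \<Longrightarrow> Hs powr (q - 1) = a"
  using q by (simp add: Hs_def powr_powr)

lemma V_eq_a: "s \<in> I \<Longrightarrow> a > 0 \<Longrightarrow> V s = a \<longleftrightarrow> H s = Hs"
  using H_pos[of s] q by (auto simp: V_def Hs_def powr_powr)

lemma Pot_ge:
  assumes a: "a > 0" and h: "h > 0"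
  shows "Pot h \<ge> Pot Hs"
proof -
  have Hs0: "Hs > 0" using a by (simp add: Hs_def)
  have sgn: "x powr (q - 1) \<le> a" if "0 < x" "x \<le> Hs" for x
    using powr_mono2[of "q - 1" x Hs] that q Hs_powr[OF a] by simp
  have sgn': "x powr (q - 1) \<ge> a" if "Hs \<le> x" for x
    using powr_mono2[of "q - 1" Hs x] that q Hs_powr[OF a] Hs0 by simp
  show ?thesis
  proof (cases "h \<le> Hs")
    case True
    show ?thesis
      by (rule DERIV_nonpos_imp_nonincreasing[OF True])
        (use h sgn in \<open>auto intro!: exI[of _ "_ * (_ - a)"] Pot_deriv mult_nonneg_nonpos\<close>)
  next
    case False
    then have "Hs \<le> h" by simp
    then show ?thesis
      by (rule DERIV_nonneg_imp_nondecreasing)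
        (use Hs0 sgn' in \<open>auto intro!: exI[of _ "_ * (_ - a)"] Pot_deriv mult_nonneg_nonneg\<close>)
  qed
qed

text \<open>Backward uniqueness at the equilibrium: \<open>F = E - Pot Hs\<close> satisfies \<open>\<bar>F'\<bar> \<le> 2 \<bar>c + G\<bar> F\<close>, so
  if it vanishes once then it vanishes for all earlier times, against the limit \<open>E \<rightarrow> 0\<close>.\<close>

lemma not_at_equilibrium:
  assumes a: "a > 0" and s: "s \<in> I"
  shows "E s > Pot Hs"
proof (rule ccontr)
  assume "\<not> E s > Pot Hs"
  define F where "F = (\<lambda>t. E t - Pot Hs)"
  have F_H1: "(H1 t)\<^sup>2 \<le> 2 * F t" if "t \<in> I" for t
    using Pot_ge[OF a H_pos[OF that]] by (simp add: F_def E_def)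
  have F_le: "F t \<le> 0" if "t \<le> s" for t
  proof -
    have tI: "t \<in> I" using that s I_down by blast
    have "continuous_on {t..s} (\<lambda>u. \<bar>c + G u\<bar>)"
      using G_deriv s I_down
      by (intro continuous_intros DERIV_atLeastAtMost_imp_continuous_on) blast
    then have "compact ((\<lambda>u. \<bar>c + G u\<bar>) ` {t..s})" by (rule compact_continuous_image) simp
    then obtain M where M: "\<And>u. u \<in> {t..s} \<Longrightarrow> \<bar>c + G u\<bar> \<le> M"
      using bounded_imp_bdd_above[OF compact_imp_bounded] unfolding bdd_above_def by (metis imageI)
    have "F t * exp (2 * M * t) \<le> F s * exp (2 * M * s)"
    proof (rule DERIV_nonneg_imp_nondecreasing[OF that])
      fix u assume u: "t \<le> u" "u \<le> s"
      then have uI: "u \<in> I" using s I_down by blast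
      have "((\<lambda>u. F u * exp (2 * M * u)) has_real_derivative
          (- (c + G u) * (H1 u)\<^sup>2 + 2 * M * F u) * exp (2 * M * u)) (at u)"
        unfolding F_def by (auto intro!: derivative_eq_intros E_deriv[OF uI] simp: algebra_simps)
      moreover have "(c + G u) * (H1 u)\<^sup>2 \<le> M * (2 * F u)"
        using M[of u] u F_H1[OF uI] by (intro mult_mono) auto
      then have "0 \<le> - (c + G u) * (H1 u)\<^sup>2 + 2 * M * F u" by (simp add: algebra_simps)
      ultimately show "\<exists>y. ((\<lambda>u. F u * exp (2 * M * u)) has_real_derivative y) (at u) \<and> 0 \<le> y"
        by (intro exI[of _ "(- (c + G u) * (H1 u)\<^sup>2 + 2 * M * F u) * exp (2 * M * u)"])
          (simp add: zero_le_mult_iff)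
    qed
    moreover have "F s \<le> 0" using \<open>\<not> _\<close> by (simp add: F_def)
    ultimately have "F t * exp (2 * M * t) \<le> 0"
      by (meson exp_ge_zero mult_nonpos_nonneg order_trans)
    then show ?thesis by (simp add: mult_le_0_iff)
  qed
  have "(E \<longlongrightarrow> 0) at_bot" by (rule E_bot)
  moreover have "\<forall>\<^sub>F t in at_bot. E t \<le> Pot Hs"
    using F_le by (auto simp: F_def eventually_at_bot_linorder)
  ultimately have "0 \<le> Pot Hs" by (rule tendsto_upperbound) simp
  moreover have "Pot Hs < 0"
  proof -
    have Hs0: "Hs > 0" using a by (simp add: Hs_def)
    have "Hs powr (q + 1) = Hs\<^sup>2 * a"
      using powr_add[of Hs 2 "q - 1"] Hs0 Hs_powr[OF a] by (simp add: powr_numeral add.commute)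
    then have "Pot Hs = Hs\<^sup>2 * a * (1 / (q + 1) - 1 / 2)" by (simp add: Pot_def algebra_simps)
    moreover have "1 / (q + 1) < 1 / 2" using q by simp
    ultimately show ?thesis using Hs0 a by (simp add: mult_pos_neg)
  qed
  ultimately show False by simp
qed

lemma not_equilibrium:
  assumes "a > 0" "s \<in> I" "H1 s = 0" shows "H s \<noteq> Hs"
  using not_at_equilibrium[OF assms(1,2)] assms(3) by (auto simp: E_def)

text \<open>\<open>H1\<close> passes a zero with nonnegative derivative, and at a zero the damping
  term drops out, leaving \<open>H1' = H * (a - V)\<close>.\<close>

lemma turning_point:
  assumes "s1 < s2" "s2 \<in> I" "H1 s1 < 0" "H1 s2 \<ge> 0"
  obtains t where "s1 < t" "t \<le> s2" "H1 t = 0" "V t \<le> a"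
proof -
  have "(H1 has_real_derivative - (c + G t) * H1 t + H t * (a - V t)) (at t)" if "s1 \<le> t" "t \<le> s2" for t
    using H1_deriv_eq I_down assms that by blast
  then obtain t where t: "s1 < t" "t \<le> s2" "H1 t = 0" "- (c + G t) * H1 t + H t * (a - V t) \<ge> 0"
    using crossing_deriv[of s1 s2 H1 "\<lambda>t. - (c + G t) * H1 t + H t * (a - V t)"] assms by auto
  then have "t \<in> I" using I_down assms by blast
  then have "V t \<le> a" using H_pos[of t] t by (simp add: zero_le_mult_iff)
  then show thesis using that t by blast
qed

text \<open>As q > 1, V \<le> a implies V / (q + 1) \<le> a / 2, so the potential is nonpositive. In
  particular positive energy excludes local minima of \<open>H\<close>.\<close>

lemma E_turning:
  assumes "t \<in> I" "H1 t = 0" "V t \<le> a" shows "E t \<le> 0"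
proof -
  have "V t * 2 \<le> a * (q + 1)" using assms V_pos[of t] q by (intro mult_mono) auto
  then have "V t / (q + 1) - a / 2 \<le> 0" using q by (simp add: field_simps)
  then show ?thesis using assms by (simp add: E_def Pot_H mult_nonneg_nonpos)
qed

text \<open>While \<open>V\<close> is large and \<open>H\<close> increases, \<open>ln V + H1 / H\<close> decreases.\<close>

lemma V_bound:
  assumes s: "s \<in> I"
  shows "V s \<le> ((q - 1) * \<mu> + \<bar>c\<bar> * \<mu> + \<bar>a\<bar> + 1) * exp \<mu>"
proof (rule ccontr)
  \<comment> \<open>Chosen so that (q - 1) y - y^2 - (c + G) y + a - V, the derivative of ln V + y
    with y = H1 / H, is nonpositive for V \<ge> V0 and 0 \<le> y \<le> \<mu>. The factor exp \<mu>
    accounts for the drop of y, which is at most \<mu>.\<close>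
  define V0 where "V0 = (q - 1) * \<mu> + \<bar>c\<bar> * \<mu> + \<bar>a\<bar> + 1"
  define y where "y = (\<lambda>s. H1 s / H s)"
  assume "\<not> ?thesis"
  then have V1: "V s > V0 * exp \<mu>" by (simp add: V0_def)
  have V0: "V0 > 0" using q mu by (auto simp: V0_def intro!: add_nonneg_pos)
  have V01: "V0 < V0 * exp \<mu>" using V0 mu by simp
  have Vc: "continuous_on {t..s} V" for t
    using V_deriv s I_down by (blast intro: DERIV_atLeastAtMost_imp_continuous_on)
  have "eventually (\<lambda>t. V t < V0) at_bot" using V_bot V0 by (rule order_tendstoD(2))
  then obtain t0 where t0: "\<And>t. t \<le> t0 \<Longrightarrow> V t < V0" unfolding eventually_at_bot_linorder by blast
  define t1 where "t1 = min t0 s"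
  have "continuous_on {t1..s} (\<lambda>t. V0 - V t)" by (intro continuous_intros Vc)
  moreover have "t1 \<le> s" "V0 - V t1 \<ge> 0" "V0 - V s < 0"
    using t0[of t1] V1 V01 by (auto simp: t1_def)
  ultimately obtain s0 where s0: "s0 < s" "V s0 = V0" "\<And>u. s0 < u \<Longrightarrow> u \<le> s \<Longrightarrow> V u > V0"
    using last_crossing[of t1 s "\<lambda>t. V0 - V t"] by auto
  have "continuous_on {s0..s} (\<lambda>t. V t - V0 * exp \<mu>)" by (intro continuous_intros Vc)
  from first_crossing[OF this] obtain s3 where s3: "s0 < s3" "s3 \<le> s" "V s3 = V0 * exp \<mu>"
    "\<And>u. s0 \<le> u \<Longrightarrow> u < s3 \<Longrightarrow> V u < V0 * exp \<mu>"
    using s0 V1 V01 by (auto simp: not_less)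
  have I3: "u \<in> I" if "u \<le> s3" for u using s s3 that I_down by (meson order_trans)
  have Vy: "(V has_real_derivative (q - 1) * y u * V u) (at u)" if "u \<le> s3" for u
    using V_deriv[OF I3[OF that]] by (simp add: y_def)
  have yd: "(y has_real_derivative - (y u)\<^sup>2 - (c + G u) * y u + a - V u) (at u)" if "u \<le> s3" for u
    using y_deriv[OF I3[OF that]] by (simp add: y_def)
  have aV0: "a < V0"
  proof -
    have "0 \<le> (q - 1) * \<mu>" "0 \<le> \<bar>c\<bar> * \<mu>" using q mu by auto
    then show ?thesis unfolding V0_def by linarith
  qed
  \<comment> \<open>Above V0 > a, a zero of y has y' = a - V < 0. Hence once y is nonpositive it
    stays so up to \<open>s3\<close>, and \<open>V\<close> could not climb to its value there; this
    gives y > 0 during the climb.\<close>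
  have y_nonpos: "y u \<le> 0" if t: "s0 \<le> t" "y t \<le> 0" "t \<le> u" "u \<le> s3" for t u
  proof (rule ccontr)
    assume yu: "\<not> y u \<le> 0"
    have "continuous_on {t..u} y"
      using yd t by (intro DERIV_atLeastAtMost_imp_continuous_on) (meson order_trans)
    then have "continuous_on {t..u} (\<lambda>x. - y x)" by (intro continuous_intros)
    from last_crossing[OF this] obtain x where x: "t \<le> x" "x < u" "y x = 0" "\<And>v. x < v \<Longrightarrow> v \<le> u \<Longrightarrow> y v > 0"
      using t yu by auto
    have Vx: "V x \<ge> V0" using s0 t x s3(2) by (cases "x = s0") (auto intro!: less_imp_le)
    have "(y has_real_derivative a - V x) (at x)" using yd[of x] x t by simp
    from DERIV_neg_dec_right[OF this] obtain d where d: "d > 0" "\<And>h. 0 < h \<Longrightarrow> h < d \<Longrightarrow> y (x + h) < y x"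
      using Vx aV0 by auto
    define h where "h = min (d / 2) (u - x)"
    have "y (x + h) < 0" using d(2)[of h] d(1) x by (auto simp: h_def)
    moreover have "y (x + h) > 0" using x(4)[of "x + h"] d(1) x(2) by (auto simp: h_def)
    ultimately show False by simp
  qed
  have y_pos: "y t > 0" if t: "s0 \<le> t" "t < s3" for t
  proof (rule ccontr)
    assume "\<not> y t > 0"
    then have yn: "y u \<le> 0" if "t \<le> u" "u \<le> s3" for u using y_nonpos[of t u] that t by auto
    have "V s3 \<le> V t"
    proof (rule DERIV_nonpos_imp_nonincreasing[of t s3 V])
      fix x assume "t \<le> x" "x \<le> s3"
      then show "\<exists>y. (V has_real_derivative y) (at x) \<and> y \<le> 0"
        using Vy[of x] yn[of x] V_pos[OF I3[of x]] q
        by (intro exI[of _ "(q - 1) * y x * V x"]) (simp add: mult_le_0_iff zero_le_mult_iff)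
    qed (use t in auto)
    then show False using s3(3) s3(4)[of t] t by auto
  qed
  have y_less: "y u < \<mu>" if "u \<le> s3" for u
    using H1_less[OF I3[OF that]] H_pos[OF I3[OF that]] by (simp add: y_def field_simps)
  have ys3: "y s3 \<ge> 0"
  proof (rule ccontr)
    assume "\<not> y s3 \<ge> 0"
    have "continuous_on {s0..s3} y"
      using yd by (intro DERIV_atLeastAtMost_imp_continuous_on) blast
    then have "continuous_on {s0..s3} (\<lambda>x. - y x)" by (intro continuous_intros)
    from first_crossing[OF this] obtain x where "s0 < x" "x \<le> s3" "y x = 0"
      using y_pos[of s0] s3 \<open>\<not> y s3 \<ge> 0\<close> by auto
    then show False using y_pos[of x] \<open>\<not> y s3 \<ge> 0\<close> by (cases "x = s3") auto
  qed
  have "ln (V s3) + y s3 \<le> ln (V s0) + y s0"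
  proof (rule DERIV_nonpos_imp_nonincreasing[of s0 s3 "\<lambda>x. ln (V x) + y x"])
    fix x assume x: "s0 \<le> x" "x \<le> s3"
    have Vx: "V x \<ge> V0" using s0 x s3(2) by (cases "x = s0") (auto intro!: less_imp_le)
    have y0: "0 \<le> y x" using y_pos[of x] ys3 x by (cases "x = s3") auto
    have Gx: "G x > 0" using G_pos I3 x by blast
    have D: "((\<lambda>x. ln (V x) + y x) has_real_derivative
        (q - 1) * y x + (- (y x)\<^sup>2 - (c * y x + G x * y x) + a - V x)) (at x)"
      using V_pos[OF I3[of x]] x by (auto intro!: derivative_eq_intros Vy yd simp: field_simps)
    have "(q - 1) * y x \<le> (q - 1) * \<mu>" using y_less[of x] x q by simp
    moreover have "- c * y x \<le> \<bar>c\<bar> * \<mu>" using y_less[of x] x y0 by (intro mult_mono) auto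
    then have "- (c * y x) \<le> \<bar>c\<bar> * \<mu>" by simp
    moreover have "0 \<le> G x * y x" "0 \<le> (y x)\<^sup>2" using Gx y0 by auto
    moreover have "a \<le> \<bar>a\<bar>" by simp
    ultimately have "(q - 1) * y x + (- (y x)\<^sup>2 - (c * y x + G x * y x) + a - V x) \<le> 0"
      using Vx unfolding V0_def by linarith
    then show "\<exists>y'. ((\<lambda>x. ln (V x) + y x) has_real_derivative y') (at x) \<and> y' \<le> 0" using D by blast
  qed (use s3 in auto)
  moreover have "ln (V s3) = ln V0 + \<mu>" using V0 by (simp add: s3(3) ln_mult)
  ultimately show False using ys3 y_less[of s0] s3 s0(2) by simp
qed

text \<open>The bound involves only the constants q, \<mu>, c and a, not the trajectory; the
  argument for small initial values rests on this uniformity.\<close>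

lemma H_le:
  assumes s: "s \<in> I"
  shows "H s \<le> (((q - 1) * \<mu> + \<bar>c\<bar> * \<mu> + \<bar>a\<bar> + 1) * exp \<mu>) powr (1 / (q - 1))"
proof -
  have "H s = V s powr (1 / (q - 1))" using H_pos[OF s] q by (simp add: V_def powr_powr)
  also have "\<dots> \<le> (((q - 1) * \<mu> + \<bar>c\<bar> * \<mu> + \<bar>a\<bar> + 1) * exp \<mu>) powr (1 / (q - 1))"
    using V_bound[OF s] V_pos[OF s] q by (intro powr_mono2) auto
  finally show ?thesis .
qed

lemma H_bound: "\<exists>B>0. \<forall>s\<in>I. H s \<le> B"
proof -
  obtain s where "s \<in> I" using I_ne by blast
  then show ?thesis using H_le H_pos by (meson less_le_trans)
qed

end

section \<open>Trajectories that exist for all times\<close>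

locale global_trajectory = damped_trajectory a c q \<kappa> \<rho> \<mu> g0 UNIV H H1
  for a c q \<kappa> \<rho> \<mu> g0 :: real and H H1 :: "real \<Rightarrow> real"
begin

lemma G_top: "(G \<longlongrightarrow> 0) at_top"
proof -
  obtain B where B: "B > 0" "\<And>s. H s \<le> B" using H_bound by blast
  have lt: "filterlim (\<lambda>t. - \<kappa> * t) at_bot at_top"
    using filterlim_tendsto_neg_mult_at_bot[of "\<lambda>_. - \<kappa>" "- \<kappa>" at_top "\<lambda>t. t"] kappa
    by (simp add: filterlim_ident)
  have "((\<lambda>s. g0 * exp (- \<kappa> * s) * B powr \<rho>) \<longlongrightarrow> g0 * 0 * B powr \<rho>) at_top"
    by (intro tendsto_intros filterlim_compose[OF exp_at_bot lt])
  then have lim: "((\<lambda>s. g0 * exp (- \<kappa> * s) * B powr \<rho>) \<longlongrightarrow> 0) at_top" by simp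
  have "norm (G s) \<le> g0 * exp (- \<kappa> * s) * B powr \<rho>" for s
    using g0 rho H_pos[of s] B(2)[of s] powr_mono2[of \<rho> "H s" B]
    by (auto simp: G_def intro!: mult_left_mono)
  then show ?thesis by (intro Lim_null_comparison[OF _ lim] always_eventually allI)
qed

lemma damping_neg:
  assumes "c < 0"
  obtains S where "S \<ge> S0" "\<And>s. S \<le> s \<Longrightarrow> c + G s \<le> c / 2" "\<And>s. S \<le> s \<Longrightarrow> G s \<le> 1"
proof -
  have "eventually (\<lambda>s. G s < - c / 2) at_top" "eventually (\<lambda>s. G s < 1) at_top"
    using assms by (auto intro: order_tendstoD(2)[OF G_top])
  then have "eventually (\<lambda>s. G s < - c / 2 \<and> G s < 1) at_top" by (rule eventually_conj)
  then obtain S where S: "\<And>s. S \<le> s \<Longrightarrow> G s < - c / 2 \<and> G s < 1"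
    unfolding eventually_at_top_linorder by blast
  show thesis
    by (rule that[of "max S S0"]) (use S in \<open>force+\<close>)
qed

lemma tendsto_Pot:
  assumes "(H \<longlongrightarrow> h) at_top"
  shows "((\<lambda>s. Pot (H s)) \<longlongrightarrow> Pot h) at_top"
proof -
  have "((\<lambda>s. H s powr (q + 1)) \<longlongrightarrow> h powr (q + 1)) at_top"
    using q H_pos by (intro tendsto_powr'[OF assms tendsto_const]) (auto intro!: always_eventually less_imp_le)
  then show ?thesis unfolding Pot_def using q
    by (intro tendsto_diff tendsto_divide tendsto_mult tendsto_const tendsto_power assms) auto
qed

lemma H_limit_nonneg: "(H \<longlongrightarrow> h) at_top \<Longrightarrow> h \<ge> 0"
  using H_pos by (intro tendsto_lowerbound[of H h at_top 0]) (auto intro!: always_eventually less_imp_le)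

text \<open>The equation turns convergence of \<open>H\<close> and \<open>H1\<close> into
  convergence of \<open>H1'\<close>, whose limit must vanish because \<open>H1\<close>
  converges.\<close>

lemma H1_tendsto_equilibrium:
  assumes lim: "(H \<longlongrightarrow> h) at_top" and lim1: "(H1 \<longlongrightarrow> 0) at_top"
  shows "a * h = h powr q"
proof -
  have "((\<lambda>s. H s powr q) \<longlongrightarrow> h powr q) at_top"
    using q H_pos by (intro tendsto_powr'[OF lim tendsto_const]) (auto intro!: always_eventually less_imp_le)
  then have "((\<lambda>s. - (c + G s) * H1 s + a * H s - H s powr q) \<longlongrightarrow> - (c + 0) * 0 + a * h - h powr q) at_top"
    by (intro tendsto_diff tendsto_add tendsto_mult tendsto_minus tendsto_const lim lim1 G_top)
  then have "((\<lambda>s. - (c + G s) * H1 s + a * H s - H s powr q) \<longlongrightarrow> a * h - h powr q) at_top" by simp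
  from tendsto_deriv_zero[OF _ lim1 this, of 0] have "a * h - h powr q = 0"
    using H1_deriv by (simp add: G_def)
  then show ?thesis by simp
qed

lemma H1_tendsto_zero:
  assumes lim: "(H \<longlongrightarrow> h) at_top" and E: "(E \<longlongrightarrow> Pot h) at_top"
  shows "(H1 \<longlongrightarrow> 0) at_top"
proof -
  have "((\<lambda>s. sqrt (2 * (E s - Pot (H s)))) \<longlongrightarrow> sqrt (2 * (Pot h - Pot h))) at_top"
    by (intro tendsto_intros E tendsto_Pot lim)
  moreover have "sqrt (2 * (E s - Pot (H s))) = \<bar>H1 s\<bar>" for s by (simp add: E_def)
  ultimately have "((\<lambda>s. \<bar>H1 s\<bar>) \<longlongrightarrow> 0) at_top" by simp
  then show ?thesis by (simp add: tendsto_rabs_zero_iff)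
qed

text \<open>Convergence of \<open>H\<close> alone makes \<open>H1\<close> small only at selected
  times; along these the energy tends to the potential of the limit.\<close>

lemma E_selection:
  assumes lim: "(H \<longlongrightarrow> h) at_top"
  obtains z :: "real \<Rightarrow> real" where "filterlim z at_top at_top" "((\<lambda>s. E (z s)) \<longlongrightarrow> Pot h) at_top"
proof -
  obtain z :: "real \<Rightarrow> real" where z: "filterlim z at_top at_top" "((\<lambda>s. H1 (z s)) \<longlongrightarrow> 0) at_top"
    using mvt_selection[of 0 H H1, OF _ lim zero_less_one] H_deriv by blast
  have "((\<lambda>s. (H1 (z s))\<^sup>2 / 2 + Pot (H (z s))) \<longlongrightarrow> 0\<^sup>2 / 2 + Pot h) at_top"
    by (intro tendsto_intros z filterlim_compose[OF tendsto_Pot[OF lim] z(1)]) simp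
  then show thesis using that z by (simp add: E_def)
qed

lemma Pot_equilibrium_nonpos:
  assumes "h \<ge> 0" "a * h = h powr q"
  shows "Pot h \<le> 0"
proof (cases "h = 0")
  case False
  then have h: "h > 0" using assms by simp
  have "h powr q = h * h powr (q - 1)" using powr_add[of h 1 "q - 1"] h by simp
  then have a: "a = h powr (q - 1)" using assms h by simp
  have "h powr (q + 1) = h\<^sup>2 * a"
    using powr_add[of h 2 "q - 1"] h a by (simp add: powr_numeral add.commute)
  then have "Pot h = h\<^sup>2 * a * (1 / (q + 1) - 1 / 2)" by (simp add: Pot_def algebra_simps)
  moreover have "1 / (q + 1) - 1 / 2 \<le> 0" using q by simp
  moreover have "h\<^sup>2 * a \<ge> 0" using a by simp
  ultimately show ?thesis by (simp only: mult_nonneg_nonpos)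
qed (use q in \<open>simp add: Pot_def\<close>)

text \<open>A positive energy would persist, since it is nondecreasing after \<open>S\<close>. Then
  \<open>H\<close> has no local minimum, so it is eventually monotone and converges to an
  equilibrium. There the potential, and with it the limit of the energy, is nonpositive.\<close>

lemma energy_nonpos:
  assumes d: "\<And>s. S \<le> s \<Longrightarrow> c + G s \<le> 0"
  shows "E S \<le> 0"
proof (rule ccontr)
  assume "\<not> E S \<le> 0"
  then have ES: "E S > 0" by simp
  have Em: "E s \<le> E t" if "S \<le> s" "s \<le> t" for s t
    using that d by (intro E_mono) auto
  obtain B where B: "\<And>s. H s \<le> B" using H_bound by blast
  have "\<exists>h. (H \<longlongrightarrow> h) at_top"
  proof (cases "\<forall>s\<ge>S. H1 s \<ge> 0")
    case True
    have "H s \<le> H t" if "S \<le> s" "s \<le> t" for s t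
      using that True H_deriv
      by (intro DERIV_nonneg_imp_nondecreasing[of s t H]) (auto intro: order_trans)
    then show ?thesis using mono_bounded_tendsto[of S H B] B by blast
  next
    case False
    then obtain s1 where s1: "S \<le> s1" "H1 s1 < 0" by (auto simp: not_le)
    have neg: "H1 s < 0" if "s1 \<le> s" for s
    proof (rule ccontr)
      assume "\<not> H1 s < 0"
      moreover have "s1 < s" using that \<open>\<not> H1 s < 0\<close> s1 by (cases "s = s1") auto
      ultimately obtain t where "s1 < t" "H1 t = 0" "V t \<le> a"
        using turning_point[of s1 s] s1 by auto
      then have "E t \<le> 0" by (intro E_turning) auto
      then show False using Em[of S t] s1 \<open>s1 < t\<close> ES by simp
    qed
    have "H t \<le> H s" if "s1 \<le> s" "s \<le> t" for s t
      using that neg H_deriv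
      by (intro DERIV_nonpos_imp_nonincreasing[of s t H]) (auto intro: order_trans less_imp_le)
    moreover have "0 \<le> H s" for s using H_pos[of s] by simp
    ultimately show ?thesis using antimono_bounded_tendsto[of s1 H 0] by blast
  qed
  then obtain h where h: "(H \<longlongrightarrow> h) at_top" by blast
  obtain z :: "real \<Rightarrow> real" where z: "filterlim z at_top at_top" "((\<lambda>s. E (z s)) \<longlongrightarrow> Pot h) at_top"
    using E_selection[OF h] by blast
  have E: "(E \<longlongrightarrow> Pot h) at_top" "E S \<le> Pot h"
    using mono_tendsto_of_selection[of S E z "Pot h"] Em z by auto
  have "Pot h \<le> 0"
    by (rule Pot_equilibrium_nonpos[OF H_limit_nonneg[OF h]
          H1_tendsto_equilibrium[OF h H1_tendsto_zero[OF h E(1)]]])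
  then show False using ES E(2) by simp
qed

lemma not_global_nonpos:
  assumes c: "c < 0" and a: "a \<le> 0"
  shows False
proof -
  obtain S where S: "\<And>s. S \<le> s \<Longrightarrow> c + G s \<le> c / 2" using damping_neg[OF c] by blast
  have "E S \<le> 0" by (rule energy_nonpos) (use S c in force)
  moreover have "Pot (H S) > 0"
    unfolding Pot_H[OF UNIV_I]
  proof (rule mult_pos_pos)
    show "0 < (H S)\<^sup>2" using H_pos[of S] by simp
    have "V S / (q + 1) > 0" using V_pos[of S] q by simp
    then show "0 < V S / (q + 1) - a / 2" using a by linarith
  qed
  moreover have "(H1 S)\<^sup>2 \<ge> 0" by simp
  ultimately show False unfolding E_def by linarith
qed

text \<open>The first limit comes from the convergence of the energy: - c H1^2 is the leading part
  of its derivative and G H1^2 vanishes at infinity, so c \<noteq> 0 is essential. The second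
  repeats the argument for \<open>H1\<close> and its derivative.\<close>

lemma barbalat_trajectory:
  assumes c: "c \<noteq> 0" and e: "(E \<longlongrightarrow> e) at_top" and b: "\<And>s. S \<le> s \<Longrightarrow> \<bar>H1 s\<bar> \<le> B1"
  shows "(H1 \<longlongrightarrow> 0) at_top" "((\<lambda>s. H s * (a - V s)) \<longlongrightarrow> 0) at_top"
proof -
  obtain B where B: "B > 0" "\<And>s. H s \<le> B" using H_bound by blast
  define V1 where "V1 = ((q - 1) * \<mu> + \<bar>c\<bar> * \<mu> + \<bar>a\<bar> + 1) * exp \<mu>"
  have V1: "0 < V s" "V s \<le> V1" for s using V_bound[of s] V_pos[of s] by (auto simp: V1_def)
  have "eventually (\<lambda>s. G s < 1) at_top" by (rule order_tendstoD(2)[OF G_top]) simp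
  then obtain S1 where S1: "\<And>s. S1 \<le> s \<Longrightarrow> G s < 1" unfolding eventually_at_top_linorder by blast
  define S' where "S' = max S S1"
  have B1: "B1 \<ge> 0" using b[of S] by simp
  define M where "M = (\<bar>c\<bar> + 1) * B1 + B * (\<bar>a\<bar> + V1)"
  have H1': "\<bar>- (c + G s) * H1 s + H s * (a - V s)\<bar> \<le> M" if "S' \<le> s" for s
  proof -
    have 1: "\<bar>- (c + G s) * H1 s\<bar> \<le> (\<bar>c\<bar> + 1) * B1"
      using S1[of s] G_pos[of s] b[of s] that unfolding abs_mult
      by (intro mult_mono) (auto simp: S'_def)
    have 2: "\<bar>H s * (a - V s)\<bar> \<le> B * (\<bar>a\<bar> + V1)"
      using B V1[of s] H_pos[of s] unfolding abs_mult by (intro mult_mono) (auto intro: less_imp_le)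
    show ?thesis unfolding M_def using 1 2 by (intro order_trans[OF abs_triangle_ineq] add_mono)
  qed
  have HB: "((\<lambda>s. G s * (H1 s)\<^sup>2) \<longlongrightarrow> 0) at_top"
  proof (rule Lim_null_comparison)
    show "\<forall>\<^sub>F s in at_top. norm (G s * (H1 s)\<^sup>2) \<le> G s * B1\<^sup>2"
      unfolding eventually_at_top_linorder
    proof (intro exI allI impI)
      fix s assume "S \<le> s"
      then have "(H1 s)\<^sup>2 \<le> B1\<^sup>2" using b[of s] abs_le_square_iff[of "H1 s" B1] by simp
      then show "norm (G s * (H1 s)\<^sup>2) \<le> G s * B1\<^sup>2" using G_pos[of s] by simp
    qed
    show "((\<lambda>s. G s * B1\<^sup>2) \<longlongrightarrow> 0) at_top" using tendsto_mult_left_zero[OF G_top] .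
  qed
  have "((\<lambda>s. - c * (H1 s)\<^sup>2) \<longlongrightarrow> 0) at_top"
  proof (rule barbalat[of S' E "\<lambda>s. - (c + G s) * (H1 s)\<^sup>2" e _ "\<lambda>s. - (G s * (H1 s)\<^sup>2)"
      "\<lambda>s. - c * (2 * H1 s * (- (c + G s) * H1 s + H s * (a - V s)))" "\<bar>c\<bar> * (2 * B1 * M)"])
    fix t assume t: "S' \<le> t"
    show "(E has_real_derivative - (c + G t) * (H1 t)\<^sup>2) (at t)" by (rule E_deriv) simp
    show "- (c + G t) * (H1 t)\<^sup>2 = - c * (H1 t)\<^sup>2 + - (G t * (H1 t)\<^sup>2)" by (simp add: algebra_simps)
    show "((\<lambda>s. - c * (H1 s)\<^sup>2) has_real_derivative
        - c * (2 * H1 t * (- (c + G t) * H1 t + H t * (a - V t)))) (at t)"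
      by (rule derivative_eq_intros H1_deriv_eq refl UNIV_I)+ simp
    show "\<bar>- c * (2 * H1 t * (- (c + G t) * H1 t + H t * (a - V t)))\<bar> \<le> \<bar>c\<bar> * (2 * B1 * M)"
      using b[of t] H1'[OF t] t B1 unfolding abs_mult
      by (intro mult_mono) (auto simp: S'_def)
  qed (use e tendsto_minus[OF HB] in auto)
  then have "((\<lambda>s. (- 1 / c) * (- c * (H1 s)\<^sup>2)) \<longlongrightarrow> (- 1 / c) * 0) at_top"
    by (intro tendsto_intros)
  then have "((\<lambda>s. (H1 s)\<^sup>2) \<longlongrightarrow> 0) at_top" using c by simp
  then have "((\<lambda>s. sqrt ((H1 s)\<^sup>2)) \<longlongrightarrow> sqrt 0) at_top" by (rule tendsto_real_sqrt)
  then show lim1: "(H1 \<longlongrightarrow> 0) at_top" by (simp add: tendsto_rabs_zero_iff)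
  have "((\<lambda>s. - (c + G s) * H1 s) \<longlongrightarrow> - (c + 0) * 0) at_top" by (intro tendsto_intros G_top lim1)
  then have r: "((\<lambda>s. - (c + G s) * H1 s) \<longlongrightarrow> 0) at_top" by simp
  show "((\<lambda>s. H s * (a - V s)) \<longlongrightarrow> 0) at_top"
  proof (rule barbalat[OF _ lim1 _ r])
    fix t assume t: "S' \<le> t"
    show "(H1 has_real_derivative H t * (a - V t) + - (c + G t) * H1 t) (at t)"
      using H1_deriv_eq[of t] by (simp add: add.commute)
    show "H t * (a - V t) + - (c + G t) * H1 t = H t * (a - V t) + - (c + G t) * H1 t" ..
    have "((\<lambda>s. H s * (a - V s)) has_real_derivative
        H1 t * (a - V t) + (0 - (q - 1) * (H1 t / H t) * V t) * H t) (at t)"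
      by (intro DERIV_mult DERIV_diff DERIV_const H_deriv V_deriv UNIV_I)
    then show "((\<lambda>s. H s * (a - V s)) has_real_derivative H1 t * (a - q * V t)) (at t)"
      by (rule DERIV_cong) (use H_pos[of t] in \<open>simp add: field_simps\<close>)
    have "\<bar>a - q * V t\<bar> \<le> \<bar>a\<bar> + q * V1" using V1[of t] q
      by (intro order_trans[OF abs_triangle_ineq4] add_mono) (auto simp: abs_mult intro!: mult_mono)
    then show "\<bar>H1 t * (a - q * V t)\<bar> \<le> B1 * (\<bar>a\<bar> + q * V1)"
      using b[of t] t B1 unfolding abs_mult by (intro mult_mono) (auto simp: S'_def)
  qed
qed

lemma zero_or_equilibrium:
  assumes a: "a > 0" and K: "((\<lambda>s. H s * (a - V s)) \<longlongrightarrow> 0) at_top"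
  shows "(H \<longlongrightarrow> 0) at_top \<or> (H \<longlongrightarrow> Hs) at_top"
proof -
  \<comment> \<open>\<open>H * (a - V)\<close> has a positive value at the level Hs / 2, so
    \<open>H\<close> eventually avoids this level and stays on one side of it.\<close>
  define x0 where "x0 = Hs / 2"
  have Hs0: "Hs > 0" using a by (simp add: Hs_def)
  then have x0: "0 < x0" "x0 < Hs" by (auto simp: x0_def)
  define v0 where "v0 = x0 powr (q - 1)"
  have v0: "v0 < a" using powr_less_mono2[of "q - 1" x0 Hs] x0 q Hs_powr[OF a] by (simp add: v0_def)
  have "x0 * (a - v0) > 0" using x0 v0 by simp
  then have "eventually (\<lambda>s. H s * (a - V s) < x0 * (a - v0)) at_top" by (rule order_tendstoD(2)[OF K])
  then obtain S where S: "\<And>s. S \<le> s \<Longrightarrow> H s * (a - V s) < x0 * (a - v0)"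
    unfolding eventually_at_top_linorder by blast
  have ne: "H s \<noteq> x0" if "S \<le> s" for s using S[OF that] by (auto simp: V_def v0_def)
  have Hc: "continuous_on {x..y} H" for x y
    using H_deriv by (blast intro: DERIV_atLeastAtMost_imp_continuous_on)
  show ?thesis
  proof (cases "H S < x0")
    case True
    have less: "H s < x0" if "S \<le> s" for s
    proof (rule ccontr)
      assume "\<not> H s < x0"
      then have "x0 \<le> H s" by simp
      then obtain u where "S \<le> u" "H u = x0" using IVT'[of H S x0 s] Hc \<open>S \<le> s\<close> True by auto
      then show False using ne by blast
    qed
    have "(H \<longlongrightarrow> 0) at_top"
    proof (rule Lim_null_comparison)
      show "((\<lambda>s. H s * (a - V s) / (a - v0)) \<longlongrightarrow> 0) at_top"
        using tendsto_divide[OF K tendsto_const[of "a - v0"]] v0 by simp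
      show "\<forall>\<^sub>F s in at_top. norm (H s) \<le> H s * (a - V s) / (a - v0)"
        unfolding eventually_at_top_linorder
      proof (intro exI allI impI)
        fix s assume "S \<le> s"
        then have "V s \<le> v0"
          unfolding V_def v0_def using less[of s] H_pos[of s] q by (intro powr_mono2) auto
        then have "H s * (a - v0) \<le> H s * (a - V s)" using H_pos[of s] by simp
        then show "norm (H s) \<le> H s * (a - V s) / (a - v0)"
          using v0 H_pos[of s] by (simp add: pos_le_divide_eq)
      qed
    qed
    then show ?thesis ..
  next
    case False
    have ge: "H s \<ge> x0" if "S \<le> s" for s
    proof (rule ccontr)
      assume "\<not> x0 \<le> H s"
      then have "H s \<le> x0" "x0 \<le> H S" using False by auto
      then obtain u where "S \<le> u" "H u = x0" using IVT2'[of H s x0 S] Hc \<open>S \<le> s\<close> by auto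
      then show False using ne by blast
    qed
    have "((\<lambda>s. a - V s) \<longlongrightarrow> 0) at_top"
    proof (rule Lim_null_comparison)
      show "((\<lambda>s. \<bar>H s * (a - V s)\<bar> / x0) \<longlongrightarrow> 0) at_top"
        using tendsto_divide[OF tendsto_rabs[OF K] tendsto_const[of x0]] x0 by simp
      show "\<forall>\<^sub>F s in at_top. norm (a - V s) \<le> \<bar>H s * (a - V s)\<bar> / x0"
        unfolding eventually_at_top_linorder
      proof (intro exI allI impI)
        fix s assume "S \<le> s"
        then have "\<bar>a - V s\<bar> * x0 \<le> \<bar>a - V s\<bar> * H s" using ge by (intro mult_left_mono) auto
        then show "norm (a - V s) \<le> \<bar>H s * (a - V s)\<bar> / x0"
          using x0 H_pos[of s] by (simp add: pos_le_divide_eq abs_mult mult.commute)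
      qed
    qed
    then have "((\<lambda>s. a - (a - V s)) \<longlongrightarrow> a - 0) at_top" by (intro tendsto_intros)
    then have "((\<lambda>s. V s powr (1 / (q - 1))) \<longlongrightarrow> a powr (1 / (q - 1))) at_top"
      using a by (intro tendsto_intros) auto
    moreover have "V s powr (1 / (q - 1)) = H s" for s
      using H_pos[of s] q by (simp add: V_def powr_powr)
    ultimately show ?thesis by (simp add: Hs_def)
  qed
qed

text \<open>Nonpositive energy gives |H1| \<le> sqrt a * H, the bound that the convergence argument
  requires. The equilibrium is excluded as a limit: the nondecreasing energy would tend to
  \<open>Pot Hs\<close> from below, while it is always larger.\<close>

lemma H_top_of_c_neg:
  assumes c: "c < 0" and a: "a > 0"
  shows "(H \<longlongrightarrow> 0) at_top"
proof -
  obtain S where S: "\<And>s. S \<le> s \<Longrightarrow> c + G s \<le> c / 2" using damping_neg[OF c] by blast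
  have d: "c + G s \<le> 0" if "S \<le> s" for s using S[OF that] c by simp
  have E0: "E s \<le> 0" if "S \<le> s" for s
    using energy_nonpos[of s] d that by force
  have Em: "E s \<le> E t" if "S \<le> s" "s \<le> t" for s t
    using that d by (intro E_mono) auto
  obtain e where e: "(E \<longlongrightarrow> e) at_top" "\<forall>s\<ge>S. E s \<le> e"
    using mono_bounded_tendsto[of S E 0, OF Em E0] by blast
  obtain B where B: "B > 0" "\<And>s. H s \<le> B" using H_bound by blast
  have "\<bar>H1 s\<bar> \<le> sqrt a * B" if "S \<le> s" for s
  proof -
    have "(H1 s)\<^sup>2 \<le> - 2 * Pot (H s)" using E0[OF that] by (simp add: E_def)
    also have "\<dots> = a * (H s)\<^sup>2 - 2 * ((H s)\<^sup>2 * V s / (q + 1))" by (simp add: Pot_H algebra_simps)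
    also have "\<dots> \<le> a * (H s)\<^sup>2" using V_pos[of s] q by simp
    finally have "(H1 s)\<^sup>2 \<le> (sqrt a * H s)\<^sup>2" using a by (simp add: power_mult_distrib)
    then have "\<bar>H1 s\<bar> \<le> sqrt a * H s" using a H_pos[of s] by (metis UNIV_I abs_le_square_iff abs_of_nonneg less_imp_le mult_nonneg_nonneg real_sqrt_ge_zero)
    also have "\<dots> \<le> sqrt a * B" using B a by (intro mult_left_mono) auto
    finally show ?thesis .
  qed
  note conv = barbalat_trajectory[OF _ e(1) this]
  have False if h: "(H \<longlongrightarrow> Hs) at_top"
  proof -
    have "((\<lambda>s. (H1 s)\<^sup>2 / 2 + Pot (H s)) \<longlongrightarrow> 0\<^sup>2 / 2 + Pot Hs) at_top"
      using c by (intro tendsto_intros tendsto_Pot h conv(1)) auto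
    then have "(E \<longlongrightarrow> Pot Hs) at_top" by (simp add: E_def[abs_def])
    then have "e = Pot Hs" using e(1) tendsto_unique by (metis trivial_limit_at_top_linorder)
    then show False using e(2) not_at_equilibrium[OF a, of S] by force
  qed
  then show ?thesis using zero_or_equilibrium[OF a conv(2)] c by auto
qed

text \<open>The energy decreases and is bounded below by the minimum of the potential, so it
  converges and bounds \<open>H1\<close>. If \<open>H\<close> tended to zero the energy would too,
  but it is already negative and nonincreasing.\<close>

lemma H_top_of_c_pos:
  assumes c: "c > 0"
  shows "a > 0" "(H \<longlongrightarrow> Hs) at_top"
proof -
  show a: "a > 0" using mu c by (simp add: a_eq)
  have Em: "E t \<le> E s" if "s \<le> t" for s t
    using that c by (intro E_antimono) auto
  have ge: "E s \<ge> Pot Hs" for s using not_at_equilibrium[OF a, of s] by simp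
  obtain e where e: "(E \<longlongrightarrow> e) at_top" "\<forall>s\<ge>0. e \<le> E s"
    using antimono_bounded_tendsto[of 0 E "Pot Hs"] Em ge by blast
  have "\<bar>H1 s\<bar> \<le> sqrt (2 * (E 0 - Pot Hs))" if "0 \<le> s" for s
  proof -
    have "(H1 s)\<^sup>2 \<le> 2 * (E 0 - Pot Hs)"
      using Em[OF that] Pot_ge[OF a H_pos[of s]] by (simp add: E_def)
    then show ?thesis using real_sqrt_le_mono[of "(H1 s)\<^sup>2"] by simp
  qed
  note conv = barbalat_trajectory[OF _ e(1) this]
  have False if h: "(H \<longlongrightarrow> 0) at_top"
  proof -
    have "((\<lambda>s. (H1 s)\<^sup>2 / 2 + Pot (H s)) \<longlongrightarrow> 0\<^sup>2 / 2 + Pot 0) at_top"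
      using c by (intro tendsto_intros tendsto_Pot h conv(1)) auto
    then have "(E \<longlongrightarrow> 0) at_top" using q by (simp add: E_def[abs_def] Pot_def)
    then have "e = 0" using e(1) tendsto_unique by (metis trivial_limit_at_top_linorder)
    then show False using e(2) E_neg[of 0] c by force
  qed
  then show "(H \<longlongrightarrow> Hs) at_top" using zero_or_equilibrium[OF a conv(2)] c by auto
qed

end

section \<open>Oscillation for c = 0, the fast decay rate, and nonexistence for small a\<close>

context global_trajectory begin

text \<open>For c = 0 the damping is only \<open>G\<close>, which vanishes at infinity, so
  dissipation does not give convergence. Monotonicity provides the limit of \<open>H\<close>
  instead; it is not zero, because its potential lies below a negative energy.\<close>

lemma monotone_imp_equilibrium:
  assumes c: "c = 0" and mono: "(\<forall>s\<ge>S. H1 s \<ge> 0) \<or> (\<forall>s\<ge>S. H1 s \<le> 0)"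
  shows "(H \<longlongrightarrow> Hs) at_top"
proof -
  obtain B where B: "\<And>s. H s \<le> B" using H_bound by blast
  have Em: "E t \<le> E s" if "s \<le> t" for s t
    using that c by (intro E_antimono) auto
  have "\<exists>h. (H \<longlongrightarrow> h) at_top"
    using mono
  proof
    assume "\<forall>s\<ge>S. H1 s \<ge> 0"
    then have "H s \<le> H t" if "S \<le> s" "s \<le> t" for s t
      using that H_deriv by (intro DERIV_nonneg_imp_nondecreasing[of s t H]) (auto intro: order_trans)
    then show ?thesis using mono_bounded_tendsto[of S H B] B by blast
  next
    assume "\<forall>s\<ge>S. H1 s \<le> 0"
    then have "H t \<le> H s" if "S \<le> s" "s \<le> t" for s t
      using that H_deriv by (intro DERIV_nonpos_imp_nonincreasing[of s t H]) (auto intro: order_trans)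
    moreover have "0 \<le> H s" for s using H_pos[of s] by simp
    ultimately show ?thesis using antimono_bounded_tendsto[of S H 0] by blast
  qed
  then obtain h where h: "(H \<longlongrightarrow> h) at_top" by blast
  obtain z :: "real \<Rightarrow> real" where z: "filterlim z at_top at_top" "((\<lambda>s. E (z s)) \<longlongrightarrow> Pot h) at_top"
    using E_selection[OF h] by blast
  have "((\<lambda>s. - E (z s)) \<longlongrightarrow> - Pot h) at_top" by (intro tendsto_minus z)
  from mono_tendsto_of_selection[of 0 "\<lambda>s. - E s" z, OF _ z(1) this]
  have "((\<lambda>s. - E s) \<longlongrightarrow> - Pot h) at_top" and "- E 0 \<le> - Pot h" using Em by auto
  then have E: "(E \<longlongrightarrow> Pot h) at_top" and le: "Pot h \<le> E 0"
    using tendsto_minus[of "\<lambda>s. - E s" "- Pot h"] by auto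
  have h0: "h \<ge> 0" by (rule H_limit_nonneg[OF h])
  have eq: "a * h = h powr q" by (rule H1_tendsto_equilibrium[OF h H1_tendsto_zero[OF h E]])
  have "h \<noteq> 0" using le E_neg[of 0] c q by (auto simp: Pot_def)
  then have "h > 0" using h0 by simp
  then have "h powr q = h * h powr (q - 1)" using powr_add[of h 1 "q - 1"] by simp
  then have "h powr (q - 1) = a" using eq \<open>h > 0\<close> by simp
  then have "h = Hs" using \<open>h > 0\<close> q by (auto simp: Hs_def powr_powr)
  then show ?thesis using h by simp
qed

text \<open>Near the equilibrium \<open>v = H1 / (H - Hs)\<close> satisfies \<open>v' \<le> - \<epsilon> (1 + v\<^sup>2)\<close>, which is
  incompatible with \<open>arctan v\<close> being bounded.\<close>

lemma not_eventually_monotone: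
  assumes c: "c = 0" and mono: "(\<forall>s\<ge>S. H1 s \<ge> 0) \<or> (\<forall>s\<ge>S. H1 s \<le> 0)"
  shows False
proof -
  have a: "a > 0" using mu c by (simp add: a_eq)
  have Hs0: "Hs > 0" using a by (simp add: Hs_def)
  have lim: "(H \<longlongrightarrow> Hs) at_top" by (rule monotone_imp_equilibrium[OF c mono])
  \<comment> \<open>Touching Hs would make the monotone \<open>H\<close> constant afterwards, hence
    at rest in the equilibrium, which backward uniqueness excludes.\<close>
  have ne: "H s \<noteq> Hs" if s: "S \<le> s" for s
  proof
    assume Hs: "H s = Hs"
    have const: "H t = Hs" if t: "s \<le> t" for t
      using mono
    proof
      assume m: "\<forall>s\<ge>S. H1 s \<ge> 0"
      have up: "H x \<le> H y" if "S \<le> x" "x \<le> y" for x y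
        using that m H_deriv by (intro DERIV_nonneg_imp_nondecreasing[of x y H]) (auto intro: order_trans)
      have "H t \<le> Hs"
        by (rule tendsto_lowerbound[OF lim]) (use up s t in \<open>auto simp: eventually_at_top_linorder intro!: exI[of _ t]\<close>)
      then show ?thesis using up[OF s t] Hs by simp
    next
      assume m: "\<forall>s\<ge>S. H1 s \<le> 0"
      have dn: "H y \<le> H x" if "S \<le> x" "x \<le> y" for x y
        using that m H_deriv by (intro DERIV_nonpos_imp_nonincreasing[of x y H]) (auto intro: order_trans)
      have "Hs \<le> H t"
        by (rule tendsto_upperbound[OF lim]) (use dn s t in \<open>auto simp: eventually_at_top_linorder intro!: exI[of _ t]\<close>)
      then show ?thesis using dn[OF s t] Hs by simp
    qed
    obtain z where "s < z" "z < s + 1" "H (s + 1) - H s = (s + 1 - s) * H1 z"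
      using MVT2[of s "s + 1" H H1] H_deriv by auto
    then have "H1 z = 0" "H z = Hs" using const[of "s + 1"] const[of z] Hs by auto
    then show False using not_equilibrium[OF a, of z] by simp
  qed
  define v where "v = (\<lambda>s. H1 s / (H s - Hs))"
  \<comment> \<open>The difference quotient of h^q - a h at Hs; its limit (q - 1) a > 0 is the
    restoring force in v' = - v^2 - G v - k.\<close>
  define k where "k = (\<lambda>s. (H s powr q - a * H s) / (H s - Hs))"
  have Hsq: "Hs powr q = a * Hs"
    using powr_add[of Hs 1 "q - 1"] Hs0 Hs_powr[OF a] by simp
  have "((\<lambda>x. x powr q - a * x) has_real_derivative q * Hs powr (q - of_nat 1) * 1 - a * 1) (at Hs)"
    by (intro DERIV_diff DERIV_fun_powr DERIV_cmult DERIV_ident Hs0)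
  then have "((\<lambda>x. (x powr q - a * x - (Hs powr q - a * Hs)) / (x - Hs)) \<longlongrightarrow> q * a - a) (at Hs)"
    using Hs_powr[OF a] by (simp add: has_field_derivative_iff)
  moreover have "filterlim H (at Hs) at_top"
    using lim ne by (auto simp: filterlim_at eventually_at_top_linorder intro!: exI[of _ S])
  ultimately have "((\<lambda>s. (H s powr q - a * H s - (Hs powr q - a * Hs)) / (H s - Hs)) \<longlongrightarrow> q * a - a) at_top"
    by (rule filterlim_compose)
  then have klim: "(k \<longlongrightarrow> q * a - a) at_top" by (simp add: k_def[abs_def] Hsq)
  define k0 where "k0 = (q * a - a) / 2"
  have k0: "k0 > 0" using a q by (simp add: k0_def)
  have "eventually (\<lambda>s. k s > k0) at_top"
  proof (rule order_tendstoD(1)[OF klim])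
    have "x / 2 < x" if "x > 0" for x :: real using that by simp
    from this[of "q * a - a"] show "k0 < q * a - a" using k0 by (simp add: k0_def)
  qed
  moreover have "eventually (\<lambda>s. G s < sqrt k0) at_top"
    by (rule order_tendstoD(2)[OF G_top]) (use k0 in simp)
  ultimately have "eventually (\<lambda>s. k s > k0 \<and> G s < sqrt k0) at_top" by (rule eventually_conj)
  then obtain S1 where S1: "\<And>s. S1 \<le> s \<Longrightarrow> k s > k0 \<and> G s < sqrt k0"
    unfolding eventually_at_top_linorder by blast
  define S' where "S' = max S S1"
  \<comment> \<open>From - G v \<le> v^2 / 2 + G^2 / 2 and G^2 \<le> k0 < k, the right-hand side of
    the Riccati equation is at most - v^2 / 2 - k0 / 2.\<close>
  define \<epsilon> where "\<epsilon> = min (1 / 2) (k0 / 2)"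
  have eps: "\<epsilon> > 0" using k0 by (simp add: \<epsilon>_def)
  have vd: "(v has_real_derivative - (v s)\<^sup>2 - G s * v s - k s) (at s)" if "S' \<le> s" for s
  proof -
    have n: "H s - Hs \<noteq> 0" using ne[of s] that by (simp add: S'_def)
    have "((\<lambda>s. H s - Hs) has_real_derivative H1 s - 0) (at s)"
      by (intro DERIV_diff DERIV_const H_deriv UNIV_I)
    then have "(v has_real_derivative
        ((- (c + G s) * H1 s + H s * (a - V s)) * (H s - Hs) - H1 s * (H1 s - 0)) / ((H s - Hs) * (H s - Hs))) (at s)"
      unfolding v_def by (intro DERIV_divide H1_deriv_eq UNIV_I n)
    moreover have "k s * (H s - Hs) = H s powr q - a * H s" using n by (simp add: k_def)
    then have "H s * (a - V s) = - (k s * (H s - Hs))"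
      using H_powr_q[of s] by (simp add: algebra_simps)
    moreover have "H1 s = v s * (H s - Hs)" using n by (simp add: v_def)
    moreover have "((- (c + G s) * (v s * D) + - (k s * D)) * D - v s * D * (v s * D - 0)) / (D * D)
        = - (v s)\<^sup>2 - G s * v s - k s" if "D \<noteq> 0" for D
      using that c by (simp add: field_simps power2_eq_square)
    ultimately show ?thesis using n by simp
  qed
  have vle: "- (v s)\<^sup>2 - G s * v s - k s \<le> - \<epsilon> * (1 + (v s)\<^sup>2)" if "S' \<le> s" for s
  proof -
    have "0 \<le> (v s + G s)\<^sup>2" by simp
    then have "- (G s * v s) \<le> (v s)\<^sup>2 / 2 + (G s)\<^sup>2 / 2" by (simp add: power2_sum field_simps)
    moreover have "(G s)\<^sup>2 \<le> (sqrt k0)\<^sup>2"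
      using S1[of s] that G_pos[of s] by (intro power_mono) (auto simp: S'_def)
    then have "(G s)\<^sup>2 \<le> k0" using k0 by simp
    moreover have "k0 < k s" using S1[of s] that by (simp add: S'_def)
    ultimately have 1: "- (v s)\<^sup>2 - G s * v s - k s \<le> - (v s)\<^sup>2 / 2 - k0 / 2" by (simp add: field_simps)
    have "\<epsilon> * (v s)\<^sup>2 \<le> 1 / 2 * (v s)\<^sup>2" by (intro mult_right_mono) (auto simp: \<epsilon>_def)
    moreover have "\<epsilon> \<le> k0 / 2" by (simp add: \<epsilon>_def)
    ultimately show ?thesis using 1 by (simp add: algebra_simps)
  qed
  have dec: "arctan (v s) + \<epsilon> * s \<le> arctan (v S') + \<epsilon> * S'" if "S' \<le> s" for s
  proof (rule DERIV_nonpos_imp_nonincreasing[OF that, of "\<lambda>s. arctan (v s) + \<epsilon> * s"])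
    fix x assume x: "S' \<le> x" "x \<le> s"
    have "((\<lambda>s. arctan (v s) + \<epsilon> * s) has_real_derivative
        inverse (1 + (v x)\<^sup>2) * (- (v x)\<^sup>2 - G x * v x - k x) + \<epsilon> * 1) (at x)"
      by (intro DERIV_add DERIV_cmult DERIV_ident DERIV_chain2[OF DERIV_arctan] vd x)
    moreover have "0 < 1 + (v x)\<^sup>2" by (simp add: add_pos_nonneg)
    then have "inverse (1 + (v x)\<^sup>2) * (- (v x)\<^sup>2 - G x * v x - k x) \<le> - \<epsilon>"
      using vle[OF x(1)] by (simp add: field_simps)
    ultimately show "\<exists>y. ((\<lambda>s. arctan (v s) + \<epsilon> * s) has_real_derivative y) (at x) \<and> y \<le> 0"
      by (intro exI[of _ "inverse (1 + (v x)\<^sup>2) * (- (v x)\<^sup>2 - G x * v x - k x) + \<epsilon> * 1"]) simp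
  qed
  \<comment> \<open>Over this time arctan v would drop by 4 > pi.\<close>
  define s where "s = S' + 4 / \<epsilon>"
  have "S' \<le> s" using eps by (simp add: s_def)
  from dec[OF this] have "arctan (v s) + 4 \<le> arctan (v S')" using eps by (simp add: s_def algebra_simps)
  moreover have "- (pi / 2) < arctan (v s)" "arctan (v S') < pi / 2"
    by (rule arctan_lbound arctan_ubound)+
  ultimately show False using pi_less_4 by simp
qed

lemma oscillation:
  assumes c: "c = 0"
  shows "\<exists>s1 s2. s1 < s2 \<and> H1 s1 < 0 \<and> 0 < H1 s2"
proof -
  obtain s1 where s1: "H1 s1 < 0"
    using not_eventually_monotone[OF c, of 0] by (meson linorder_not_le)
  obtain s2 where "s1 \<le> s2" "0 < H1 s2"
    using not_eventually_monotone[OF c, of s1] by (meson linorder_not_le)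
  then show ?thesis using s1 by (intro exI[of _ s1] exI[of _ s2]) (cases "s1 = s2"; auto)
qed

text \<open>The slope y = H1 / H solves a Riccati equation whose autonomous part factors as (\<mu> -
  y) (y + \<delta>) with \<delta> = c + \<mu>. Once y \<le> 0, the deviation z = y + \<delta> obeys
  an expanding linear equation, so its boundedness forces it to be as small as the perturbation. An
  exponentially small z is integrable, and z is the derivative of ln H + \<delta> s.\<close>

lemma fast_decay:
  assumes c: "c < 0" and a: "a > 0"
  shows "\<exists>C>0. ((\<lambda>s. exp ((c + \<mu>) * s) * H s) \<longlongrightarrow> C) at_top"
proof -
  define \<delta> where "\<delta> = c + \<mu>"
  define y where "y = (\<lambda>s. H1 s / H s)"
  define z where "z = (\<lambda>s. y s + \<delta>)"
  have delta: "\<delta> > 0" using a mu by (simp add: a_eq \<delta>_def zero_less_mult_iff)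
  have Hlim: "(H \<longlongrightarrow> 0) at_top" by (rule H_top_of_c_neg[OF c a])
  have Vlim: "(V \<longlongrightarrow> 0) at_top"
    unfolding V_def using q H_pos
    by (intro tendsto_zero_powrI[OF Hlim tendsto_const]) (auto intro!: always_eventually less_imp_le)
  obtain S0 where S0: "\<And>s. S0 \<le> s \<Longrightarrow> c + G s \<le> c / 2" using damping_neg[OF c] by blast
  have "c + G s \<le> 0" if "S0 \<le> s" for s using S0[OF that] c by simp
  then have E0: "E s \<le> 0" if "S0 \<le> s" for s
    using energy_nonpos[of s] that by force
  have "eventually (\<lambda>s. V s < a) at_top" by (rule order_tendstoD(2)[OF Vlim a])
  then obtain S1 where S1: "\<And>s. S1 \<le> s \<Longrightarrow> V s < a" unfolding eventually_at_top_linorder by blast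
  define S where "S = max S0 S1"
  \<comment> \<open>While V < a, a zero of \<open>H1\<close> has \<open>H1' > 0\<close>, so a
    positive \<open>H1\<close> would persist and \<open>H\<close> could not tend to zero.\<close>
  have H1_nonpos: "H1 s \<le> 0" if s: "S \<le> s" for s
  proof (rule ccontr)
    assume pos: "\<not> H1 s \<le> 0"
    have up: "H1 t \<ge> 0" if t: "s \<le> t" for t
    proof (rule ccontr)
      assume neg: "\<not> H1 t \<ge> 0"
      have "((\<lambda>u. - H1 u) has_real_derivative - (- (c + G u) * H1 u + H u * (a - V u))) (at u)" for u
        by (intro DERIV_minus H1_deriv_eq UNIV_I)
      then obtain u where u: "s < u" "u \<le> t" "- H1 u = 0" "- (- (c + G u) * H1 u + H u * (a - V u)) \<ge> 0"
        using crossing_deriv[of s t "\<lambda>u. - H1 u" "\<lambda>u. - (- (c + G u) * H1 u + H u * (a - V u))"] pos neg t by auto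
      moreover have "H u * (a - V u) > 0" using S1[of u] H_pos[of u] s u by (simp add: S_def)
      ultimately show False by simp
    qed
    have "H s \<le> H t" if "s \<le> t" for t
      using that up H_deriv by (intro DERIV_nonneg_imp_nondecreasing[of s t H]) auto
    then have "H s \<le> 0"
      by (intro tendsto_lowerbound[OF Hlim]) (auto simp: eventually_at_top_linorder)
    then show False using H_pos[of s] by simp
  qed
  have y0: "y s \<le> 0" if "S \<le> s" for s
    using H1_nonpos[OF that] H_pos[of s] by (simp add: y_def divide_nonpos_pos)
  have y1: "\<bar>y s\<bar> \<le> sqrt a" if "S \<le> s" for s
  proof -
    have "(H1 s)\<^sup>2 \<le> - 2 * Pot (H s)" using E0[of s] that by (simp add: E_def S_def)
    also have "\<dots> = a * (H s)\<^sup>2 - 2 * ((H s)\<^sup>2 * V s / (q + 1))" by (simp add: Pot_H algebra_simps)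
    also have "\<dots> \<le> a * (H s)\<^sup>2" using V_pos[of s] q by simp
    finally have "(y s)\<^sup>2 \<le> a" using H_pos[of s] by (simp add: y_def power_divide pos_divide_le_eq)
    then show ?thesis using real_sqrt_le_mono[of "(y s)\<^sup>2" a] by simp
  qed
  have zd: "(z has_real_derivative (\<mu> - y s) * z s + (- (G s * y s) - V s)) (at s)" for s
  proof -
    have "(z has_real_derivative (- (y s)\<^sup>2 - (c + G s) * y s + a - V s) + 0) (at s)"
      unfolding z_def y_def by (intro DERIV_add DERIV_const y_deriv UNIV_I)
    then show ?thesis
      by (rule DERIV_cong) (simp add: z_def \<delta>_def a_eq algebra_simps power2_eq_square)
  qed
  have zb: "\<bar>z s\<bar> \<le> sqrt a + \<delta>" if "S \<le> s" for s
    using y1[OF that] delta by (simp add: z_def abs_le_iff)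
  have r: "\<bar>- (G s * y s) - V s\<bar> \<le> G s * sqrt a + V s" if "S \<le> s" for s
  proof -
    have "\<bar>G s * y s\<bar> \<le> G s * sqrt a"
      using y1[OF that] G_pos[of s] unfolding abs_mult by (intro mult_mono) auto
    then show ?thesis using V_pos[OF UNIV_I, of s] by linarith
  qed
  have bmu: "\<mu> - y s \<ge> \<mu>" if "S \<le> s" for s using y0[OF that] by simp
  have rlim: "((\<lambda>s. G s * sqrt a + V s) \<longlongrightarrow> 0) at_top"
    using tendsto_add[OF tendsto_mult_left_zero[OF G_top, of "sqrt a"] Vlim] by simp
  \<comment> \<open>A first application with a constant bound makes the logarithmic slope negative, so that
     \<open>V\<close> and \<open>G\<close> decay exponentially; the second application then gives an exponential rate.\<close>
  have "eventually (\<lambda>s. G s * sqrt a + V s < \<mu> * \<delta> / 2) at_top"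
    by (rule order_tendstoD(2)[OF rlim]) (use mu delta in simp)
  then obtain S2 where S2: "\<And>s. S2 \<le> s \<Longrightarrow> G s * sqrt a + V s < \<mu> * \<delta> / 2"
    unfolding eventually_at_top_linorder by blast
  define S3 where "S3 = max S S2"
  have z1: "\<bar>z s\<bar> \<le> \<delta> / 2" if "S3 \<le> s" for s
  proof -
    have "\<bar>z s\<bar> \<le> (\<mu> * \<delta> / 2) / \<mu>"
    proof (rule expanding_bound[where z = z and s = s and S = S3 and R = "\<lambda>_. \<mu> * \<delta> / 2" and B = "sqrt a + \<delta>"
        and b = "\<lambda>t. \<mu> - y t" and r = "\<lambda>t. - (G t * y t) - V t"])
      fix t assume t: "S3 \<le> t"
      show "(z has_real_derivative (\<mu> - y t) * z t + (- (G t * y t) - V t)) (at t)" by (rule zd)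
      show "\<mu> \<le> \<mu> - y t" using bmu t by (simp add: S3_def)
      show "\<bar>- (G t * y t) - V t\<bar> \<le> \<mu> * \<delta> / 2" using r[of t] S2[of t] t by (simp add: S3_def)
      show "\<bar>z t\<bar> \<le> sqrt a + \<delta>" using zb t by (simp add: S3_def)
    qed (use mu that in auto)
    then show ?thesis using mu by simp
  qed
  \<comment> \<open>A slope of at most - \<delta> / 2 makes \<open>V\<close> decay at rate (q - 1)
    \<delta> / 2; for \<open>G\<close> the explicit factor exp (- \<kappa> s) suffices, since the
    slope is nonpositive.\<close>
  define \<nu> where "\<nu> = min \<kappa> ((q - 1) * \<delta> / 2)"
  have lam: "\<nu> > 0" using kappa q delta by (simp add: \<nu>_def)
  have Vdec: "V s * exp (\<nu> * s) \<le> V S3 * exp (\<nu> * S3)" if "S3 \<le> s" for s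
  proof (rule DERIV_nonpos_imp_nonincreasing[OF that, of "\<lambda>s. V s * exp (\<nu> * s)"])
    fix x assume x: "S3 \<le> x" "x \<le> s"
    have "((\<lambda>s. exp (\<nu> * s)) has_real_derivative exp (\<nu> * x) * \<nu>) (at x)"
      by (auto intro!: derivative_eq_intros)
    from DERIV_mult[OF V_deriv[OF UNIV_I] this]
    have "((\<lambda>s. V s * exp (\<nu> * s)) has_real_derivative ((q - 1) * y x + \<nu>) * (V x * exp (\<nu> * x))) (at x)"
      by (rule DERIV_cong) (simp add: y_def algebra_simps)
    moreover have "(q - 1) * y x + \<nu> \<le> 0"
    proof -
      have "y x \<le> - \<delta> / 2" using z1[OF x(1)] unfolding z_def by linarith
      then have "(q - 1) * y x \<le> (q - 1) * (- \<delta> / 2)" using q by (intro mult_left_mono) auto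
      then show ?thesis by (simp add: \<nu>_def)
    qed
    ultimately show "\<exists>y. ((\<lambda>s. V s * exp (\<nu> * s)) has_real_derivative y) (at x) \<and> y \<le> 0"
      using V_pos[OF UNIV_I, of x]
      by (intro exI[of _ "((q - 1) * y x + \<nu>) * (V x * exp (\<nu> * x))"]) (simp add: mult_le_0_iff)
  qed
  have Gdec: "G s * exp (\<nu> * s) \<le> G S3 * exp (\<nu> * S3)" if "S3 \<le> s" for s
  proof (rule DERIV_nonpos_imp_nonincreasing[OF that, of "\<lambda>s. G s * exp (\<nu> * s)"])
    fix x assume x: "S3 \<le> x" "x \<le> s"
    have "((\<lambda>s. exp (\<nu> * s)) has_real_derivative exp (\<nu> * x) * \<nu>) (at x)"
      by (auto intro!: derivative_eq_intros)
    from DERIV_mult[OF G_deriv[OF UNIV_I] this]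
    have "((\<lambda>s. G s * exp (\<nu> * s)) has_real_derivative (\<nu> - \<kappa> + \<rho> * y x) * (G x * exp (\<nu> * x))) (at x)"
      by (rule DERIV_cong) (simp add: y_def algebra_simps)
    moreover have "\<nu> - \<kappa> + \<rho> * y x \<le> 0"
    proof -
      have "\<rho> * y x \<le> 0" using y0[of x] x rho by (simp add: S3_def mult_le_0_iff)
      then show ?thesis by (simp add: \<nu>_def)
    qed
    ultimately show "\<exists>y. ((\<lambda>s. G s * exp (\<nu> * s)) has_real_derivative y) (at x) \<and> y \<le> 0"
      using G_pos[OF UNIV_I, of x]
      by (intro exI[of _ "(\<nu> - \<kappa> + \<rho> * y x) * (G x * exp (\<nu> * x))"]) (simp add: mult_le_0_iff)
  qed
  define K where "K = G S3 * exp (\<nu> * S3) * sqrt a + V S3 * exp (\<nu> * S3)"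
  have K0: "K \<ge> 0" using G_pos[of S3] V_pos[of S3] a by (simp add: K_def)
  have rK: "G s * sqrt a + V s \<le> K * exp (- \<nu> * s)" if "S3 \<le> s" for s
  proof -
    have "(G s * sqrt a + V s) * exp (\<nu> * s) \<le> K"
    proof -
      have "(G s * sqrt a + V s) * exp (\<nu> * s) = G s * exp (\<nu> * s) * sqrt a + V s * exp (\<nu> * s)"
        by (simp add: algebra_simps)
      also have "\<dots> \<le> K"
        unfolding K_def using a by (intro add_mono mult_right_mono Gdec Vdec that) auto
      finally show ?thesis .
    qed
    then have "(G s * sqrt a + V s) * exp (\<nu> * s) * exp (- \<nu> * s) \<le> K * exp (- \<nu> * s)"
      by (intro mult_right_mono) auto
    then show ?thesis by (simp add: mult.assoc flip: exp_add)
  qed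
  have z2: "\<bar>z s\<bar> \<le> K / \<mu> * exp (- \<nu> * s)" if "S3 \<le> s" for s
  proof -
    have "\<bar>z s\<bar> \<le> (K * exp (- \<nu> * s)) / \<mu>"
    proof (rule expanding_bound[where z = z and s = s and S = S3 and R = "\<lambda>s. K * exp (- \<nu> * s)" and B = "sqrt a + \<delta>"
        and b = "\<lambda>t. \<mu> - y t" and r = "\<lambda>t. - (G t * y t) - V t"])
      fix t assume t: "S3 \<le> t"
      show "(z has_real_derivative (\<mu> - y t) * z t + (- (G t * y t) - V t)) (at t)" by (rule zd)
      show "\<mu> \<le> \<mu> - y t" using bmu t by (simp add: S3_def)
      show "\<bar>- (G t * y t) - V t\<bar> \<le> K * exp (- \<nu> * t)" using r[of t] rK[of t] t by (simp add: S3_def)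
      show "\<bar>z t\<bar> \<le> sqrt a + \<delta>" using zb t by (simp add: S3_def)
      show "K * exp (- \<nu> * u) \<le> K * exp (- \<nu> * t)" if "t \<le> u" for u
        using K0 lam that by (intro mult_left_mono) auto
    qed (use mu that in auto)
    then show ?thesis by simp
  qed
  have "((\<lambda>s. ln (H s) + \<delta> * s) has_real_derivative z s) (at s)" for s
    using H_pos[of s] by (auto intro!: derivative_eq_intros H_deriv simp: z_def y_def)
  then obtain L where "((\<lambda>s. ln (H s) + \<delta> * s) \<longlongrightarrow> L) at_top"
    using tendsto_of_exp_bound_deriv[of S3 "\<lambda>s. ln (H s) + \<delta> * s" z "K / \<mu>" \<nu>] z2 lam K0 mu by auto
  then have "((\<lambda>s. exp (ln (H s) + \<delta> * s)) \<longlongrightarrow> exp L) at_top" by (intro tendsto_intros)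
  moreover have "exp (ln (H s) + \<delta> * s) = exp (\<delta> * s) * H s" for s
    using H_pos[of s] by (simp add: exp_add)
  ultimately show ?thesis by (intro exI[of _ "exp L"]) (simp add: \<delta>_def)
qed

text \<open>The last time at which the damping vanishes has nonpositive energy, so there \<open>V\<close> and the
  logarithmic slope are small with \<open>a\<close>.  They stay small on a bounded backward time interval, along
  which \<open>G\<close> then grows at an exponential rate close to \<open>\<kappa>\<close>.\<close>

lemma not_global_small:
  assumes c: "c < 0" and a: "a > 0" and B: "\<And>s. G s \<le> B"
    and e: "0 < \<epsilon>" "\<epsilon> \<le> 1" "\<rho> * \<epsilon> \<le> \<kappa> / 2" and T: "T > 0" "B < - c * exp (\<kappa> / 2 * T)"
    and small: "a * (q + 5) / 2 * exp ((3 + q + 2 * \<bar>c\<bar> + 2 * B) * T) < \<epsilon>\<^sup>2"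
  shows False
proof -
  define y where "y = (\<lambda>s. H1 s / H s)"
  \<comment> \<open>Collects the constants of the estimate \<open>R' \<ge> - K * R\<close> below,
    valid while |y| \<le> 1.\<close>
  define K where "K = 3 + q + 2 * \<bar>c\<bar> + 2 * B"
  have B0: "B > 0" using B[of 0] G_pos[of 0] by simp
  have K0: "K > 0" using q B0 by (simp add: K_def)
  have Gc: "continuous_on {x..y} G" for x y
    using G_deriv by (blast intro: DERIV_atLeastAtMost_imp_continuous_on)
  obtain S where S: "\<And>s. S \<le> s \<Longrightarrow> c + G s \<le> c / 2" using damping_neg[OF c] by blast
  \<comment> \<open>If the damping were negative throughout, the energy would be positive, having
    been fed from minus infinity on, against \<open>energy_nonpos\<close>.\<close>
  have "\<exists>s. c + G s \<ge> 0"
  proof (rule ccontr)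
    assume "\<not> ?thesis"
    then have n: "c + G s < 0" for s by (auto simp: not_le)
    then have "E 0 > 0" by (intro E_pos) auto
    moreover have "E 0 \<le> 0" by (rule energy_nonpos) (use n in \<open>auto intro: less_imp_le\<close>)
    ultimately show False by simp
  qed
  then obtain s0 where s0: "c + G s0 \<ge> 0" by blast
  have "s0 < S" using S[of s0] s0 c by (force simp: not_le[symmetric])
  have "continuous_on {s0..S} (\<lambda>s. c + G s)" by (intro continuous_intros Gc)
  then obtain s1 where s1: "c + G s1 = 0" "\<And>u. s1 < u \<Longrightarrow> u \<le> S \<Longrightarrow> c + G u < 0"
    using last_crossing[of s0 S "\<lambda>s. c + G s"] \<open>s0 < S\<close> s0 S[of S] c by auto
  have "c + G u \<le> 0" if "s1 \<le> u" for u
    using s1 S[of u] c that by (cases "u \<le> S"; cases "u = s1") (auto intro: less_imp_le)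
  then have E1: "E s1 \<le> 0" by (rule energy_nonpos)
  have y1: "(y s1)\<^sup>2 + 2 * V s1 / (q + 1) \<le> a"
  proof -
    have "(H1 s1)\<^sup>2 + 2 * ((H s1)\<^sup>2 * (V s1 / (q + 1) - a / 2)) \<le> 0" using E1 by (simp add: E_def Pot_H)
    moreover have "H1 s1 = y s1 * H s1" using H_pos[of s1] by (simp add: y_def)
    ultimately have "(H s1)\<^sup>2 * ((y s1)\<^sup>2 + 2 * V s1 / (q + 1) - a) \<le> 0"
      by (simp add: power_mult_distrib algebra_simps)
    then show ?thesis using H_pos[of s1] by (simp add: mult_le_0_iff)
  qed
  \<comment> \<open>The summand \<open>a\<close> absorbs the inhomogeneous term 2 a y, so that
    \<open>R\<close> satisfies a homogeneous differential inequality.\<close>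
  define R where "R = (\<lambda>s. (y s)\<^sup>2 + V s + a)"
  have R1: "R s1 \<le> a * (q + 5) / 2"
  proof -
    have "0 \<le> (y s1)\<^sup>2" "0 < V s1" using V_pos by auto
    moreover have "2 * V s1 / (q + 1) \<le> a" using y1 \<open>0 \<le> (y s1)\<^sup>2\<close> by linarith
    then have "V s1 \<le> a * (q + 1) / 2" using q by (simp add: field_simps)
    moreover have "(y s1)\<^sup>2 \<le> a" using y1 V_pos[of s1] q by (smt (verit) UNIV_I divide_nonneg_pos)
    ultimately show ?thesis by (simp add: R_def field_simps)
  qed
  define R' where "R' = (\<lambda>s. 2 * y s * (- (y s)\<^sup>2 - (c + G s) * y s + a - V s) + (q - 1) * y s * V s)"
  have Rd: "(R has_real_derivative R' s) (at s)" for s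
  proof -
    have "(y has_real_derivative - (y s)\<^sup>2 - (c + G s) * y s + a - V s) (at s)"
      unfolding y_def by (rule y_deriv) simp
    from DERIV_power[OF this, of 2]
    have "((\<lambda>s. (y s)\<^sup>2) has_real_derivative 2 * y s * (- (y s)\<^sup>2 - (c + G s) * y s + a - V s)) (at s)"
      by (rule DERIV_cong) simp
    from DERIV_add[OF DERIV_add[OF this V_deriv[OF UNIV_I]] DERIV_const[of a]]
    show ?thesis by (simp add: R_def R'_def y_def)
  qed
  have R'_ge: "R' s \<ge> - K * R s" if "\<bar>y s\<bar> \<le> 1" for s
  proof -
    have V0: "V s > 0" by (rule V_pos) simp
    have 1: "- (2 * y s * (y s)\<^sup>2) \<ge> - 2 * (y s)\<^sup>2"
      using mult_right_mono[of "y s" 1 "(y s)\<^sup>2"] that by simp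
    have "\<bar>c + G s\<bar> \<le> \<bar>c\<bar> + B" using B[of s] G_pos[of s] by simp
    then have 2: "- (2 * ((c + G s) * (y s)\<^sup>2)) \<ge> - (2 * ((\<bar>c\<bar> + B) * (y s)\<^sup>2))"
      by (simp add: mult_right_mono abs_le_iff)
    have 3: "2 * y s * a \<ge> - 2 * a" using mult_right_mono[of "- 1" "y s" a] that a by (simp add: mult.commute)
    have "(q - 3) * y s \<ge> - (q + 3)"
    proof -
      have "\<bar>(q - 3) * y s\<bar> \<le> (q + 3) * 1" using that q unfolding abs_mult by (intro mult_mono) auto
      then show ?thesis by simp
    qed
    then have 4: "(q - 3) * y s * V s \<ge> - (q + 3) * V s" using V0 by (intro mult_right_mono) auto
    have "R' s = - (2 * y s * (y s)\<^sup>2) - (2 * ((c + G s) * (y s)\<^sup>2)) + 2 * y s * a + (q - 3) * y s * V s"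
      by (simp add: R'_def algebra_simps power2_eq_square)
    also have "\<dots> \<ge> - 2 * (y s)\<^sup>2 - 2 * ((\<bar>c\<bar> + B) * (y s)\<^sup>2) - 2 * a - (q + 3) * V s"
      using 1 2 3 4 by linarith
    finally have *: "R' s \<ge> - 2 * (y s)\<^sup>2 - 2 * ((\<bar>c\<bar> + B) * (y s)\<^sup>2) - 2 * a - (q + 3) * V s" .
    have "(2 + 2 * (\<bar>c\<bar> + B)) * (y s)\<^sup>2 \<le> K * (y s)\<^sup>2" using q by (intro mult_right_mono) (auto simp: K_def)
    moreover have "2 * a \<le> K * a" using q a B0 by (intro mult_right_mono) (auto simp: K_def)
    moreover have "(q + 3) * V s \<le> K * V s" using V0 B0 by (intro mult_right_mono) (auto simp: K_def)
    ultimately show ?thesis using * by (simp add: R_def algebra_simps)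
  qed
  \<comment> \<open>Backward Gronwall from \<open>s1\<close> to the last earlier time at which
    \<open>R\<close> equals the square of \<epsilon>: in between |y| \<le> 1, and the hypothesis
    \<open>small\<close> contradicts that value.\<close>
  have y_less: "R s < \<epsilon>\<^sup>2" if s: "s1 - T \<le> s" "s \<le> s1" for s
  proof (rule ccontr)
    assume big: "\<not> R s < \<epsilon>\<^sup>2"
    have exp1: "1 \<le> exp (K * T)" using K0 T by simp
    have "a * (q + 5) / 2 \<le> a * (q + 5) / 2 * exp (K * T)"
      using mult_left_mono[OF exp1, of "a * (q + 5) / 2"] a q by simp
    then have R1e: "R s1 < \<epsilon>\<^sup>2" using R1 small by (simp add: K_def)
    have "continuous_on {s..s1} (\<lambda>u. R u - \<epsilon>\<^sup>2)"
      using Rd by (intro continuous_intros DERIV_atLeastAtMost_imp_continuous_on) blast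
    then obtain t where t: "s \<le> t" "t < s1" "R t = \<epsilon>\<^sup>2" "\<And>u. t < u \<Longrightarrow> u \<le> s1 \<Longrightarrow> R u < \<epsilon>\<^sup>2"
      using last_crossing[of s s1 "\<lambda>u. R u - \<epsilon>\<^sup>2"] s big R1e by auto
    have "R t * exp (K * t) \<le> R s1 * exp (K * s1)"
    proof (rule DERIV_nonneg_imp_nondecreasing[of t s1 "\<lambda>u. R u * exp (K * u)"])
      fix u assume u: "t \<le> u" "u \<le> s1"
      have "R u \<le> \<epsilon>\<^sup>2" using t u by (cases "u = t") (auto intro: less_imp_le)
      then have "(y u)\<^sup>2 \<le> \<epsilon>\<^sup>2" using V_pos[of u] a by (simp add: R_def)
      also have "\<epsilon>\<^sup>2 \<le> 1\<^sup>2" using e by (intro power_mono) auto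
      finally have "\<bar>y u\<bar> \<le> 1" by (simp add: abs_square_le_1)
      then have "R' u \<ge> - K * R u" by (rule R'_ge)
      moreover have "((\<lambda>u. exp (K * u)) has_real_derivative exp (K * u) * K) (at u)"
        by (auto intro!: derivative_eq_intros)
      from DERIV_mult[OF Rd this]
      have "((\<lambda>u. R u * exp (K * u)) has_real_derivative (R' u + K * R u) * exp (K * u)) (at u)"
        by (rule DERIV_cong) (simp add: algebra_simps)
      ultimately show "\<exists>y. ((\<lambda>u. R u * exp (K * u)) has_real_derivative y) (at u) \<and> 0 \<le> y"
        by (intro exI[of _ "(R' u + K * R u) * exp (K * u)"]) simp
    qed (use t in simp)
    then have "R t * exp (K * t) * exp (- K * t) \<le> R s1 * exp (K * s1) * exp (- K * t)"
      by (intro mult_right_mono) auto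
    then have "R t \<le> R s1 * exp (K * (s1 - t))" by (simp add: mult.assoc right_diff_distrib flip: exp_add)
    also have "\<dots> \<le> a * (q + 5) / 2 * exp (K * T)"
    proof (intro mult_mono R1)
      have "K * (s1 - t) \<le> K * T" using s t K0 by (intro mult_left_mono) auto
      then show "exp (K * (s1 - t)) \<le> exp (K * T)" by simp
    qed (use a q in auto)
    also have "\<dots> < \<epsilon>\<^sup>2" using small by (simp add: K_def)
    finally show False using t by simp
  qed
  \<comment> \<open>Since \<rho> y \<le> \<kappa> / 2, the logarithmic derivative of
    \<open>G\<close> is at most - \<kappa> / 2; going back by \<open>T\<close> multiplies G s1 = - c
    by at least exp (\<kappa> T / 2), which exceeds the bound \<open>B\<close>.\<close>
  have "G s1 * exp (\<kappa> / 2 * s1) \<le> G (s1 - T) * exp (\<kappa> / 2 * (s1 - T))"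
  proof (rule DERIV_nonpos_imp_nonincreasing[of "s1 - T" s1 "\<lambda>u. G u * exp (\<kappa> / 2 * u)"])
    fix u assume u: "s1 - T \<le> u" "u \<le> s1"
    have "((\<lambda>u. exp (\<kappa> / 2 * u)) has_real_derivative exp (\<kappa> / 2 * u) * (\<kappa> / 2)) (at u)"
      by (auto intro!: derivative_eq_intros)
    from DERIV_mult[OF G_deriv[OF UNIV_I] this]
    have "((\<lambda>u. G u * exp (\<kappa> / 2 * u)) has_real_derivative (\<rho> * y u - \<kappa> / 2) * (G u * exp (\<kappa> / 2 * u))) (at u)"
      by (rule DERIV_cong) (simp add: y_def algebra_simps)
    moreover have "\<rho> * y u \<le> \<kappa> / 2"
    proof -
      have "(y u)\<^sup>2 < \<epsilon>\<^sup>2" using y_less[OF u] V_pos[of u] a by (simp add: R_def)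
      then have "y u \<le> \<epsilon>" using e by (simp add: power_less_imp_less_base less_imp_le)
      then have "\<rho> * y u \<le> \<rho> * \<epsilon>" using rho by (intro mult_left_mono) auto
      then show ?thesis using e by simp
    qed
    ultimately show "\<exists>y. ((\<lambda>u. G u * exp (\<kappa> / 2 * u)) has_real_derivative y) (at u) \<and> y \<le> 0"
      using G_pos[OF UNIV_I, of u]
      by (intro exI[of _ "(\<rho> * y u - \<kappa> / 2) * (G u * exp (\<kappa> / 2 * u))"]) (simp add: mult_le_0_iff)
  qed (use T in simp)
  then have "G s1 * exp (\<kappa> / 2 * s1) * exp (- (\<kappa> / 2 * (s1 - T))) \<le>
      G (s1 - T) * exp (\<kappa> / 2 * (s1 - T)) * exp (- (\<kappa> / 2 * (s1 - T)))"
    by (intro mult_right_mono) auto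
  then have "G s1 * exp (\<kappa> / 2 * T) \<le> G (s1 - T)"
    by (simp add: mult.assoc right_diff_distrib flip: exp_add)
  moreover have "G s1 = - c" using s1 by simp
  ultimately show False using B[of "s1 - T"] T by simp
qed

end

subsection \<open>Positive radial solutions\<close>

lemma tendsto_zero_if_deriv:
  fixes F F' :: "real \<Rightarrow> real"
  assumes "(F \<longlongrightarrow> 0) (at_right 0)" and x: "x > 0"
    and der: "\<And>t. 0 < t \<Longrightarrow> t \<le> x \<Longrightarrow> (F has_real_derivative F' t) (at t)"
    and neg: "\<And>t. 0 < t \<Longrightarrow> t \<le> x \<Longrightarrow> F' t < 0"
  shows "F x < 0"
proof -
  have dec: "F t < F u" if "0 < u" "u < t" "t \<le> x" for t u
  proof (rule DERIV_neg_imp_decreasing[OF that(2)])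
    fix y assume "u \<le> y" "y \<le> t"
    then show "\<exists>z. DERIV F y :> z \<and> z < 0" using that der[of y] neg[of y] by auto
  qed
  have "eventually (\<lambda>u. F (x / 2) \<le> F u) (at_right 0)"
    using x dec by (intro eventually_at_rightI[of 0 "x / 2"]) (auto intro: less_imp_le)
  then have "F (x / 2) \<le> 0" using tendsto_lowerbound[OF assms(1)] by simp
  moreover have "F x < F (x / 2)" using x by (intro dec) auto
  ultimately show ?thesis by simp
qed

section \<open>Exponents of the logarithmic variables\<close>

locale exponents =
  fixes N :: nat and m \<sigma> p :: real
  assumes N: "N \<ge> 1" and m: "0 < m" "m < 1" and \<sigma>: "\<sigma> > 0" and p: "1 < p" "p < p_L m \<sigma>"
begin

abbreviation "\<alpha> \<equiv> ss_alpha m \<sigma> p"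
abbreviation "\<beta> \<equiv> ss_beta m \<sigma> p"
text \<open>\<theta> is the decay rate at which diffusion and source carry the same power of \<xi>,
  and \<mu> is this rate for f^m. \<open>c\<close> and \<open>a\<close> are the coefficients that
  the radial Laplacian acquires when \<xi> powr \<mu> is split off.\<close>

definition \<theta> :: real where "\<theta> = (\<sigma> + 2) / (p - m)"
definition \<mu> :: real where "\<mu> = m * \<theta>"
definition \<kappa> :: real where "\<kappa> = \<theta> * (1 - m) - 2"
definition \<rho> :: real where "\<rho> = (1 - m) / m"
definition q :: real where "q = p / m"
definition c :: real where "c = real N - 2 - 2 * \<mu>"
definition a :: real where "a = \<mu> * (real N - 2 - \<mu>)"

lemma L_neg: "L_const m \<sigma> p < 0"
  using p by (simp add: L_const_def p_L_def field_simps)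

lemma beta_pos: "\<beta> > 0"
  using L_neg p m by (simp add: ss_beta_def divide_neg_neg zero_less_divide_iff)

lemma alpha_eq: "\<alpha> = \<beta> * \<theta>"
proof -
  have "- d / L * (s / d) = - s / L" if "d \<noteq> 0" for d L s :: real using that by simp
  moreover have "p - m \<noteq> 0" using p m by simp
  ultimately show ?thesis unfolding ss_alpha_def ss_beta_def \<theta>_def by metis
qed

lemma theta_pos: "\<theta> > 0"
  using p m \<sigma> by (simp add: \<theta>_def)

lemma alpha_pos: "\<alpha> > 0"
  using beta_pos theta_pos by (simp add: alpha_eq)

lemma mu_pos: "\<mu> > 0"
  using theta_pos m by (simp add: \<mu>_def)

lemma rho_pos: "\<rho> > 0"
  using m by (simp add: \<rho>_def)

lemma q_gt_1: "q > 1"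
  using p m by (simp add: \<rho>_def q_def)

lemma kappa_pos: "\<kappa> > 0"
proof -
  have "2 * (p - m) < (\<sigma> + 2) * (1 - m)" using L_neg by (simp add: L_const_def algebra_simps)
  then have "2 < (\<sigma> + 2) * (1 - m) / (p - m)" using p m by (simp add: pos_less_divide_eq)
  then show ?thesis by (simp add: \<kappa>_def \<theta>_def)
qed

lemma mu_q: "\<mu> * (q - 1) = \<sigma> + 2"
  using p m by (simp add: \<mu>_def \<theta>_def q_def field_simps)

lemma mu_rho: "\<mu> * \<rho> = \<theta> * (1 - m)"
  using m by (simp add: \<mu>_def \<rho>_def)

lemma beta_mu: "\<beta> / m * \<mu> = \<alpha>"
  using m by (simp add: \<mu>_def alpha_eq)

lemma a_eq: "a = \<mu> * (c + \<mu>)"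
  by (simp add: a_def c_def)

end

text \<open>In w = f^m the diffusion is linear. \<open>J\<close> is an initial interval of the
  positive half-line, bounded or not, so that the locale also applies up to a possible first zero.
  The start is prescribed by limits at 0 only; \<open>w_flat\<close> is the one-sided condition
  w'(0) = 0.\<close>

locale radial_solution = exponents N m \<sigma> p
  for N :: nat and m \<sigma> p :: real +
  fixes w0 :: real and J :: "real set" and w w1 :: "real \<Rightarrow> real"
  assumes J_pos: "\<And>x. x \<in> J \<Longrightarrow> 0 < x" and J_down: "\<And>x y. x \<in> J \<Longrightarrow> 0 < y \<Longrightarrow> y \<le> x \<Longrightarrow> y \<in> J"
    and J_ne: "J \<noteq> {}"
    and w_pos: "\<And>x. x \<in> J \<Longrightarrow> w x > 0"
    and w_deriv: "\<And>x. x \<in> J \<Longrightarrow> (w has_real_derivative w1 x) (at x)"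
    and w1_deriv: "\<And>x. x \<in> J \<Longrightarrow> (w1 has_real_derivative
      - ((real N - 1) / x * w1 x) - ss_alpha m \<sigma> p * w x powr (1 / m)
      - ss_beta m \<sigma> p * x * (w x powr (1 / m - 1) * w1 x / m) - x powr \<sigma> * w x powr (p / m)) (at x)"
    and w_lim: "(w \<longlongrightarrow> w0) (at_right 0)" and w0: "w0 > 0"
    and w_flat: "((\<lambda>x. (w x - w0) / x) \<longlongrightarrow> 0) (at_right 0)"
begin

abbreviation "f \<equiv> \<lambda>x. w x powr (1 / m)"
abbreviation "f0 \<equiv> w0 powr (1 / m)"
text \<open>The drift is a divergence up to a multiple of f: x^(N-1) (\<alpha> f + \<beta> x f') =
  (\<beta> x^N f)' + (\<alpha> - N \<beta>) x^(N-1) f. Hence the derivative of the flux is free of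
  \<open>w1\<close>.\<close>

definition flux :: "real \<Rightarrow> real" where "flux x = x ^ (N - 1) * w1 x + \<beta> * x ^ N * f x"
definition src :: "real \<Rightarrow> real" where "src x = (\<alpha> - real N * \<beta>) * f x + x powr \<sigma> * w x powr (p / m)"

lemma f_pos: "x \<in> J \<Longrightarrow> f x > 0"
  using w_pos[of x] by simp

lemma f_deriv: "x \<in> J \<Longrightarrow> (f has_real_derivative w x powr (1 / m - 1) * w1 x / m) (at x)"
  by (rule DERIV_cong[OF DERIV_fun_powr[OF w_deriv w_pos]]) auto

lemma power_deriv: "x > 0 \<Longrightarrow> ((\<lambda>x. x ^ (N - 1)) has_real_derivative (real N - 1) / x * x ^ (N - 1)) (at x)"
proof -
  assume "x > 0"
  obtain n where n: "N = Suc n" using N by (cases N) auto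
  show ?thesis
    by (rule DERIV_cong[OF DERIV_pow]) (cases n; use \<open>x > 0\<close> n in simp)
qed

lemma power_N: "x ^ N = x * x ^ (N - 1)" for x :: real
  using N by (cases N) auto

lemma flux_deriv: "x \<in> J \<Longrightarrow> (flux has_real_derivative - (x ^ (N - 1) * src x)) (at x)"
proof -
  assume x: "x \<in> J"
  have x0: "x > 0" using J_pos[OF x] .
  have 1: "((\<lambda>x. \<beta> * x ^ N) has_real_derivative \<beta> * (real N * x ^ (N - 1))) (at x)"
    using DERIV_cmult[OF DERIV_pow[of N x UNIV], of \<beta>] by simp
  show ?thesis
    unfolding flux_def[abs_def] src_def
    by (rule DERIV_cong[OF DERIV_add[OF DERIV_mult[OF power_deriv[OF x0] w1_deriv[OF x]]
          DERIV_mult[OF 1 f_deriv[OF x]]]])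
      (use x0 in \<open>simp add: power_N algebra_simps\<close>)
qed

lemma ev_J: "eventually (\<lambda>x. x \<in> J) (at_right 0)"
proof -
  obtain r where r: "r \<in> J" using J_ne by blast
  show ?thesis using r J_pos[OF r] J_down[OF r] by (intro eventually_at_rightI[of 0 r]) auto
qed

lemma f_lim: "(f \<longlongrightarrow> f0) (at_right 0)"
  using w0 by (intro tendsto_intros w_lim) auto

lemma src_lim: "(src \<longlongrightarrow> (\<alpha> - real N * \<beta>) * f0) (at_right 0)"
proof -
  have "((\<lambda>x::real. x powr \<sigma>) \<longlongrightarrow> 0) (at_right 0)"
    using \<sigma> by (intro tendsto_zero_powrI[OF _ tendsto_const])
      (auto intro!: tendsto_ident_at eventually_at_rightI[of 0 1])
  then have "(src \<longlongrightarrow> (\<alpha> - real N * \<beta>) * f0 + 0 * w0 powr (p / m)) (at_right 0)"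
    unfolding src_def using w0
    by (intro tendsto_add tendsto_mult tendsto_const f_lim tendsto_powr w_lim) auto
  then show ?thesis by simp
qed

text \<open>\<open>w1\<close> is not directly known near 0. The mean value theorem gives \<eta> in
  (0, x) where it equals (w x - w0) / x, which tends to zero, and between \<eta> and x the flux
  changes only by O(x).\<close>

lemma flux_lim: "(flux \<longlongrightarrow> 0) (at_right 0)"
proof -
  obtain r0 where r0: "r0 \<in> J" using J_ne by blast
  define M where "M = \<bar>(\<alpha> - real N * \<beta>) * f0\<bar> + 1"
  have "eventually (\<lambda>x. \<bar>src x\<bar> < M) (at_right 0)"
    by (rule order_tendstoD(2)[OF tendsto_rabs[OF src_lim]]) (simp add: M_def)
  moreover have "eventually (\<lambda>x. f x < f0 + 1) (at_right 0)"
    by (rule order_tendstoD(2)[OF f_lim]) simp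
  ultimately have "eventually (\<lambda>x. \<bar>src x\<bar> < M \<and> f x < f0 + 1) (at_right 0)" by (rule eventually_conj)
  then obtain r1 where r1: "r1 > 0" "\<And>x. 0 < x \<Longrightarrow> x < r1 \<Longrightarrow> \<bar>src x\<bar> < M \<and> f x < f0 + 1"
    unfolding eventually_at_right_field by blast
  define r where "r = min (min r0 (r1 / 2)) 1"
  have r: "r > 0" "r \<le> 1" using r1 J_pos[OF r0] by (auto simp: r_def)
  have rJ: "x \<in> J" if "0 < x" "x \<le> r" for x using J_down[OF r0] that by (auto simp: r_def)
  have bnd: "\<bar>flux x\<bar> \<le> \<bar>(w x - w0) / x\<bar> + \<beta> * x * (f0 + 1) + M * x" if x: "0 < x" "x \<le> r" for x
  proof -
    \<comment> \<open>Extended by its limit, \<open>w\<close> is continuous on the closed interval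
      from 0, as the mean value theorem requires.\<close>
    define W where "W = (\<lambda>t. if t \<le> 0 then w0 else w t)"
    have Wd: "(W has_real_derivative w1 t) (at t)" if "0 < t" "t \<le> r" for t
    proof (rule has_field_derivative_transform_within_open[of w _ _ "{0<..}"])
      show "(w has_real_derivative w1 t) (at t)" using w_deriv rJ that by blast
    qed (use that in \<open>auto simp: W_def\<close>)
    have "continuous_on {0..x} W"
      unfolding continuous_on_eq_continuous_within
    proof
      fix t assume t: "t \<in> {0..x}"
      show "continuous (at t within {0..x}) W"
      proof (cases "t = 0")
        case True
        have "(W \<longlongrightarrow> w0) (at_right 0)"
          by (rule Lim_transform_eventually[OF w_lim]) (auto simp: W_def intro!: eventually_at_rightI[of 0 1])
        then have "(W \<longlongrightarrow> w0) (at 0 within {0..x})"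
          using x by (auto simp: at_within_Icc_at_right)
        then show ?thesis using True by (simp add: continuous_within W_def)
      next
        case False
        then show ?thesis using Wd[of t] t x by (auto intro: DERIV_isCont continuous_at_imp_continuous_at_within)
      qed
    qed
    moreover have "W differentiable (at t)" if "0 < t" "t < x" for t
      using Wd[of t] that x by (auto simp: real_differentiable_def)
    ultimately obtain l \<eta> where e: "0 < \<eta>" "\<eta> < x" "DERIV W \<eta> :> l" "W x - W 0 = (x - 0) * l"
      using MVT[OF x(1), of W] by blast
    have "l = w1 \<eta>" using DERIV_unique[OF e(3) Wd[of \<eta>]] e x by auto
    then have w1e: "w1 \<eta> = (w x - w0) / x" using e(4) x by (simp add: W_def)
    have "\<bar>flux x - flux \<eta>\<bar> \<le> M * \<bar>x - \<eta>\<bar>"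
    proof (rule field_differentiable_bound[of "{\<eta>..x}" flux "\<lambda>x. - (x ^ (N - 1) * src x)", unfolded real_norm_def])
      fix t assume t: "t \<in> {\<eta>..x}"
      show "(flux has_real_derivative - (t ^ (N - 1) * src t)) (at t within {\<eta>..x})"
        using flux_deriv[OF rJ[of t]] t e x by (auto intro: has_field_derivative_at_within)
      have "t ^ (N - 1) \<le> 1" using t e x r by (intro power_le_one) auto
      moreover have "\<bar>src t\<bar> \<le> M" using r1(2)[of t] r1(1) t e x by (auto simp: r_def)
      ultimately have "\<bar>t ^ (N - 1)\<bar> * \<bar>src t\<bar> \<le> 1 * M"
        using t e by (intro mult_mono) auto
      then show "\<bar>- (t ^ (N - 1) * src t)\<bar> \<le> M" by (simp add: abs_mult)
    qed (use e in auto)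
    also have "\<dots> \<le> M * x" using e by (intro mult_left_mono) (auto simp: M_def)
    finally have "\<bar>flux x\<bar> \<le> \<bar>flux \<eta>\<bar> + M * x" by linarith
    moreover have "\<bar>flux \<eta>\<bar> \<le> \<bar>w1 \<eta>\<bar> + \<beta> * x * (f0 + 1)"
    proof -
      have 1: "\<bar>\<eta> ^ (N - 1) * w1 \<eta>\<bar> \<le> 1 * \<bar>w1 \<eta>\<bar>"
        using e x r unfolding abs_mult by (intro mult_right_mono) (auto intro!: power_le_one)
      have "\<eta> ^ N \<le> \<eta> * 1" unfolding power_N using e x r by (intro mult_left_mono power_le_one) auto
      then have "\<bar>\<beta> * \<eta> ^ N * f \<eta>\<bar> \<le> \<beta> * x * (f0 + 1)"
        using e x r r1(2)[of \<eta>] r_def beta_pos unfolding abs_mult by (intro mult_mono) auto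
      then show ?thesis using 1 unfolding flux_def by linarith
    qed
    ultimately show ?thesis using w1e by simp
  qed
  have "((\<lambda>x. \<bar>(w x - w0) / x\<bar> + \<beta> * x * (f0 + 1) + M * x) \<longlongrightarrow> \<bar>0\<bar> + \<beta> * 0 * (f0 + 1) + M * 0) (at_right 0)"
    by (intro tendsto_intros w_flat)
  then have lim: "((\<lambda>x. \<bar>(w x - w0) / x\<bar> + \<beta> * x * (f0 + 1) + M * x) \<longlongrightarrow> 0) (at_right 0)" by simp
  show ?thesis
    by (rule Lim_null_comparison[OF _ lim])
      (use bnd r in \<open>auto intro!: eventually_at_rightI[of 0 r]\<close>)
qed

text \<open>L'Hopital for flux / x^N; the contribution \<beta> f0 of the drift is then
  subtracted.\<close>

lemma w1_lim: "((\<lambda>x. w1 x / x) \<longlongrightarrow> - (\<alpha> * f0 / real N)) (at_right 0)"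
proof -
  have "((\<lambda>x. flux x / x ^ N) \<longlongrightarrow> - ((\<alpha> - real N * \<beta>) * f0 / real N)) (at_right 0)"
  proof (rule lhopital_right_0[OF flux_lim])
    have "((\<lambda>x::real. x ^ N) \<longlongrightarrow> 0 ^ N) (at_right 0)" by (intro tendsto_intros)
    then show "((\<lambda>x::real. x ^ N) \<longlongrightarrow> 0) (at_right 0)" using N by (simp add: power_0_left)
    show "eventually (\<lambda>x::real. x ^ N \<noteq> 0) (at_right 0)" by (intro eventually_at_rightI[of 0 1]) auto
    show "eventually (\<lambda>x::real. real N * x ^ (N - 1) \<noteq> 0) (at_right 0)"
      using N by (intro eventually_at_rightI[of 0 1]) auto
    show "eventually (\<lambda>x. DERIV flux x :> - (x ^ (N - 1) * src x)) (at_right 0)"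
      using ev_J by eventually_elim (rule flux_deriv)
    show "eventually (\<lambda>x::real. DERIV (\<lambda>x. x ^ N) x :> real N * x ^ (N - 1)) (at_right 0)"
      by (rule always_eventually) (auto intro!: derivative_eq_intros)
    have "((\<lambda>x. - (src x / real N)) \<longlongrightarrow> - ((\<alpha> - real N * \<beta>) * f0 / real N)) (at_right 0)"
      using N by (intro tendsto_minus tendsto_divide src_lim tendsto_const) auto
    moreover have "eventually (\<lambda>x. - (src x / real N) = - (x ^ (N - 1) * src x) / (real N * x ^ (N - 1))) (at_right 0)"
      using N by (intro eventually_at_rightI[of 0 1]) auto
    ultimately show "((\<lambda>x. - (x ^ (N - 1) * src x) / (real N * x ^ (N - 1))) \<longlongrightarrow>
        - ((\<alpha> - real N * \<beta>) * f0 / real N)) (at_right 0)"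
      by (rule Lim_transform_eventually)
  qed
  then have "((\<lambda>x. flux x / x ^ N - \<beta> * f x) \<longlongrightarrow>
      - ((\<alpha> - real N * \<beta>) * f0 / real N) - \<beta> * f0) (at_right 0)"
    by (intro tendsto_diff tendsto_mult tendsto_const f_lim)
  moreover have "- ((\<alpha> - real N * \<beta>) * f0 / real N) - \<beta> * f0 = - (\<alpha> * f0 / real N)"
    using N by (simp add: field_simps)
  moreover have "eventually (\<lambda>x. flux x / x ^ N - \<beta> * f x = w1 x / x) (at_right 0)"
    unfolding flux_def power_N by (intro eventually_at_rightI[of 0 1]) (auto simp: field_simps)
  ultimately show ?thesis using Lim_transform_eventually by fastforce
qed

text \<open>\<open>w1\<close> is negative near 0 by the limit of w1 / x. At a first zero the
  equation leaves only - \<alpha> f and the negative source as its derivative, so zero cannot be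
  reached from below.\<close>

lemma w1_neg: assumes x: "x \<in> J" shows "w1 x < 0"
proof (rule ccontr)
  assume "\<not> w1 x < 0"
  have "eventually (\<lambda>x. w1 x / x < 0) (at_right 0)"
    by (rule order_tendstoD(2)[OF w1_lim]) (use alpha_pos w0 N in simp)
  then obtain r where r: "r > 0" "\<And>x. 0 < x \<Longrightarrow> x < r \<Longrightarrow> w1 x / x < 0"
    unfolding eventually_at_right_field by blast
  define x0 where "x0 = min (r / 2) x"
  have x0: "0 < x0" "x0 \<le> x" "x0 < r" using r J_pos[OF x] by (auto simp: x0_def)
  then have "w1 x0 < 0" using r(2)[of x0] by (simp add: divide_less_0_iff)
  moreover have J: "t \<in> J" if "x0 \<le> t" "t \<le> x" for t using J_down[OF x] that x0 by auto
  ultimately obtain t where t: "x0 < t" "t \<le> x" "w1 t = 0"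
    "- ((real N - 1) / t * w1 t) - \<alpha> * f t
      - \<beta> * t * (w t powr (1 / m - 1) * w1 t / m) - t powr \<sigma> * w t powr (p / m) \<ge> 0"
    using crossing_deriv[of x0 x w1 "\<lambda>x. - ((real N - 1) / x * w1 x) - \<alpha> * f x
      - \<beta> * x * (w x powr (1 / m - 1) * w1 x / m) - x powr \<sigma> * w x powr (p / m)"]
      w1_deriv x0 \<open>\<not> w1 x < 0\<close> by fastforce
  have "\<alpha> * f t > 0" using alpha_pos f_pos[OF J[of t]] t by simp
  moreover have "t powr \<sigma> * w t powr (p / m) \<ge> 0" by simp
  moreover have "t powr \<sigma> * w t powr (p / m) \<le> - (\<alpha> * f t)" using t by simp
  ultimately show False by linarith
qed

lemma w_antimono: "x \<in> J \<Longrightarrow> 0 < y \<Longrightarrow> y < x \<Longrightarrow> w x < w y"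
proof (rule DERIV_neg_imp_decreasing[of y x w])
  fix z assume "x \<in> J" "0 < y" "y \<le> z" "z \<le> x"
  then have "z \<in> J" using J_down[of x z] by simp
  then show "\<exists>l. DERIV w z :> l \<and> l < 0" using w_deriv w1_neg by blast
qed

lemma w_less_w0: assumes x: "x \<in> J" shows "w x < w0"
proof -
  have "w x - w0 < 0"
  proof (rule tendsto_zero_if_deriv[of "\<lambda>x. w x - w0" x w1])
    show "((\<lambda>x. w x - w0) \<longlongrightarrow> 0) (at_right 0)" using tendsto_diff[OF w_lim tendsto_const[of w0]] by simp
    show "x > 0" using J_pos[OF x] .
    fix t assume "0 < t" "t \<le> x"
    then have t: "t \<in> J" using J_down[OF x] by blast
    show "w1 t < 0" by (rule w1_neg[OF t])
    show "((\<lambda>x. w x - w0) has_real_derivative w1 t) (at t)"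
      using DERIV_diff[OF w_deriv[OF t] DERIV_const[of w0]] by simp
  qed
  then show ?thesis by simp
qed

text \<open>As long as \<open>w1 < 0\<close> the drift term is linear in \<open>x ^ (N - 1) * w1\<close> with a locally bounded
  coefficient, so this quantity cannot return to zero.\<close>

lemma w1_not_tendsto_zero:
  assumes J: "J = {0<..<R}"
  shows "\<not> (w1 \<longlongrightarrow> 0) (at_left R)"
proof
  assume lim: "(w1 \<longlongrightarrow> 0) (at_left R)"
  have R: "R > 0" using J_ne J by auto
  define M where "M = \<beta> * R * w0 powr (1 / m - 1) / m"
  define P where "P = (\<lambda>x. x ^ (N - 1) * w1 x * exp (M * x))"
  define P' where "P' = (\<lambda>x. (x ^ (N - 1) * (- \<alpha> * f x - x powr \<sigma> * w x powr (p / m))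
      + (M - \<beta> * x * w x powr (1 / m - 1) / m) * (x ^ (N - 1) * w1 x)) * exp (M * x))"
  have Pd: "(P has_real_derivative P' x) (at x)" if x: "x \<in> J" for x
  proof -
    have "((\<lambda>x. exp (M * x)) has_real_derivative exp (M * x) * M) (at x)"
      by (auto intro!: derivative_eq_intros)
    from DERIV_mult[OF DERIV_mult[OF power_deriv[OF J_pos[OF x]] w1_deriv[OF x]] this]
    show ?thesis unfolding P_def
      by (rule DERIV_cong) (use J_pos[OF x] in \<open>simp add: P'_def algebra_simps\<close>)
  qed
  have P'_neg: "P' x \<le> 0" if x: "x \<in> J" for x
  proof -
    have x0: "0 < x" "x < R" using x J by auto
    have "w x powr (1 / m - 1) \<le> w0 powr (1 / m - 1)"
      using w_less_w0[OF x] w_pos[OF x] m by (intro powr_mono2) auto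
    then have "\<beta> * x * w x powr (1 / m - 1) / m \<le> M"
      unfolding M_def using x0 beta_pos m by (intro divide_right_mono mult_mono) auto
    then have A: "0 \<le> M - \<beta> * x * w x powr (1 / m - 1) / m" by simp
    have B: "x ^ (N - 1) * w1 x \<le> 0" using w1_neg[OF x] x0 by (simp add: mult_le_0_iff)
    have 1: "(M - \<beta> * x * w x powr (1 / m - 1) / m) * (x ^ (N - 1) * w1 x) \<le> 0"
      by (rule mult_nonneg_nonpos[OF A B])
    have "\<alpha> * f x + x powr \<sigma> * w x powr (p / m) \<ge> 0"
      using alpha_pos f_pos[OF x] by (intro add_nonneg_nonneg) auto
    then have "x ^ (N - 1) * (- \<alpha> * f x - x powr \<sigma> * w x powr (p / m)) \<le> 0"
      using x0 by (intro mult_nonneg_nonpos) auto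
    then show ?thesis unfolding P'_def using 1 by (intro mult_nonpos_nonneg) auto
  qed
  define x1 where "x1 = R / 2"
  have x1: "x1 \<in> J" using R J by (auto simp: x1_def)
  have Px1: "P x1 < 0" using w1_neg[OF x1] J_pos[OF x1] by (simp add: P_def mult_less_0_iff)
  have "eventually (\<lambda>x. P x \<le> P x1) (at_left R)"
  proof (rule eventually_at_leftI[of x1])
    fix x assume x: "x \<in> {x1<..<R}"
    show "P x \<le> P x1"
    proof (rule DERIV_nonpos_imp_nonincreasing[of x1 x P])
      fix t assume "x1 \<le> t" "t \<le> x"
      then have "t \<in> J" using x x1 J by auto
      then show "\<exists>y. (P has_real_derivative y) (at t) \<and> y \<le> 0" using Pd P'_neg by blast
    qed (use x in simp)
  qed (use R in \<open>simp add: x1_def\<close>)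
  moreover have "(P \<longlongrightarrow> R ^ (N - 1) * 0 * exp (M * R)) (at_left R)"
    unfolding P_def by (intro tendsto_intros lim)
  then have "(P \<longlongrightarrow> 0) (at_left R)" by simp
  ultimately have "0 \<le> P x1" by (intro tendsto_upperbound[of P 0 "at_left R"]) auto
  then show False using Px1 by simp
qed

definition Hf :: "real \<Rightarrow> real" where "Hf s = exp (\<mu> * s) * w (exp s)"
definition H1f :: "real \<Rightarrow> real" where "H1f s = exp (\<mu> * s) * (\<mu> * w (exp s) + exp s * w1 (exp s))"

lemma exp_at_right: "filterlim (exp :: real \<Rightarrow> real) (at_right 0) at_bot"
  by (auto simp: filterlim_at_withinI exp_at_bot filterlim_at eventually_at_bot_linorder)

lemma Hf_powr: "exp s \<in> J \<Longrightarrow> Hf s powr r = exp (\<mu> * r * s) * w (exp s) powr r"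
  using w_pos[of "exp s"] by (simp add: Hf_def powr_mult exp_powr_real mult_ac)

lemma G_eq:
  assumes "exp s \<in> J"
  shows "\<beta> / m * exp (- \<kappa> * s) * Hf s powr \<rho> = \<beta> / m * (exp s)\<^sup>2 * w (exp s) powr (1 / m - 1)"
proof -
  have "exp (- \<kappa> * s) * exp (\<mu> * \<rho> * s) = exp (2 * s)"
    unfolding mu_rho \<kappa>_def by (simp add: algebra_simps flip: exp_add)
  moreover have "\<rho> = 1 / m - 1" using m by (simp add: \<rho>_def field_simps)
  moreover have "exp (2 * s) = (exp s)\<^sup>2" by (simp add: exp_double)
  ultimately have "exp (- \<kappa> * s) * Hf s powr \<rho> = (exp s)\<^sup>2 * w (exp s) powr (1 / m - 1)"
    unfolding Hf_powr[OF assms] by (metis mult.assoc)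
  then show ?thesis by (simp only: mult.assoc)
qed

sublocale traj: damped_trajectory a c q \<kappa> \<rho> \<mu> "\<beta> / m" "{s. exp s \<in> J}" Hf H1f
proof
  show "1 < q" "0 < \<kappa>" "0 < \<rho>" "0 < \<mu>" "0 < \<beta> / m" "a = \<mu> * (c + \<mu>)"
    using q_gt_1 kappa_pos rho_pos mu_pos beta_pos m a_eq by auto
  show "\<And>s t. s \<in> {s. exp s \<in> J} \<Longrightarrow> t \<le> s \<Longrightarrow> t \<in> {s. exp s \<in> J}" using J_down by auto
  obtain r where "r \<in> J" using J_ne by blast
  then show "{s. exp s \<in> J} \<noteq> {}" using J_pos by (auto intro!: exI[of _ "ln r"])
next
  fix s assume "s \<in> {s. exp s \<in> J}"
  then have s: "exp s \<in> J" by simp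
  note w_pos[OF s, simp]
  show "0 < Hf s" by (simp add: Hf_def)
  have e: "((\<lambda>s. exp (\<mu> * s)) has_real_derivative exp (\<mu> * s) * \<mu>) (at s)"
    by (auto intro!: derivative_eq_intros)
  have we: "((\<lambda>s. w (exp s)) has_real_derivative w1 (exp s) * exp s) (at s)"
    by (rule DERIV_chain2[OF w_deriv[OF s] DERIV_exp])
  show "(Hf has_real_derivative H1f s) (at s)"
    unfolding Hf_def[abs_def] by (rule DERIV_cong[OF DERIV_mult[OF e we]]) (simp add: H1f_def algebra_simps)
  define x where "x = exp s"
  have x0: "x > 0" and xJ: "x \<in> J" using s by (auto simp: x_def)
  define e\<mu> where "e\<mu> = exp (\<mu> * s)"
  define W2 where "W2 = - ((real N - 1) / x * w1 x) - \<alpha> * f x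
      - \<beta> * x * (w x powr (1 / m - 1) * w1 x / m) - x powr \<sigma> * w x powr (p / m)"
  have w1e: "((\<lambda>s. w1 (exp s)) has_real_derivative W2 * exp s) (at s)"
    unfolding W2_def x_def by (rule DERIV_chain2[OF w1_deriv[OF s] DERIV_exp])
  have D: "(H1f has_real_derivative
      e\<mu> * \<mu> * (\<mu> * w x + x * w1 x) + (\<mu> * (w1 x * x) + (x * w1 x + W2 * x * x)) * e\<mu>) (at s)"
    unfolding H1f_def[abs_def] e\<mu>_def x_def
    by (rule DERIV_cong[OF DERIV_mult[OF e DERIV_add[OF DERIV_cmult[OF we] DERIV_mult[OF DERIV_exp w1e]]]])
      (simp add: x_def)
  have Hq: "Hf s powr q = e\<mu> * (x * x * (x powr \<sigma> * w x powr (p / m)))"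
  proof -
    have "\<mu> * q = \<mu> + 2 + \<sigma>" using mu_q by (simp add: algebra_simps)
    then have "exp (\<mu> * q * s) = e\<mu> * (x * x * x powr \<sigma>)"
      by (simp add: e\<mu>_def x_def exp_powr_real algebra_simps flip: exp_add)
    then show ?thesis by (simp add: Hf_powr[OF s] q_def x_def mult_ac)
  qed
  have fw: "f x = w x powr (1 / m - 1) * w x" using powr_add[of "w x" "1 / m - 1" 1] w_pos[OF xJ] by simp
  have G: "\<beta> / m * exp (- \<kappa> * s) * Hf s powr \<rho> = \<beta> / m * x\<^sup>2 * w x powr (1 / m - 1)"
    using G_eq[OF s] by (simp add: x_def)
  have x2W2: "W2 * x * x = - ((real N - 1) * (x * w1 x)) - \<alpha> * x\<^sup>2 * w x powr (1 / m - 1) * w x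
      - \<beta> / m * x\<^sup>2 * w x powr (1 / m - 1) * (x * w1 x) - x * x * (x powr \<sigma> * w x powr (p / m))"
    unfolding W2_def fw using x0 by (simp add: field_simps power2_eq_square)
  \<comment> \<open>\<open>beta_mu\<close> trades \<alpha> for \<beta> \<mu> / m, so that \<alpha> f
    and \<beta> x f' combine into the friction \<open>G * H1\<close>.\<close>
  have "e\<mu> * \<mu> * (\<mu> * w x + x * w1 x) + (\<mu> * (w1 x * x) + (x * w1 x + W2 * x * x)) * e\<mu> =
      - (c + \<beta> / m * x\<^sup>2 * w x powr (1 / m - 1)) * (e\<mu> * (\<mu> * w x + x * w1 x)) + a * (e\<mu> * w x)
      - e\<mu> * (x * x * (x powr \<sigma> * w x powr (p / m)))"
    unfolding x2W2 beta_mu[symmetric] c_def a_def by (simp add: algebra_simps add_divide_distrib)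
  then show "(H1f has_real_derivative
      - (c + \<beta> / m * exp (- \<kappa> * s) * Hf s powr \<rho>) * H1f s + a * Hf s - Hf s powr q) (at s)"
    unfolding G Hq using D by (simp add: H1f_def Hf_def e\<mu>_def x_def)
  show "H1f s < \<mu> * Hf s"
    using w1_neg[OF s] by (simp add: H1f_def Hf_def algebra_simps mult_less_0_iff)
next
  have "((\<lambda>s. exp (\<mu> * s)) \<longlongrightarrow> 0) at_bot"
    using mu_pos by (intro filterlim_compose[OF exp_at_bot] filterlim_tendsto_pos_mult_at_bot[OF tendsto_const])
      (auto simp: filterlim_ident)
  then have "((\<lambda>s. exp (\<mu> * s) * w (exp s)) \<longlongrightarrow> 0 * w0) at_bot"
    by (intro tendsto_mult filterlim_compose[OF w_lim exp_at_right])
  then show "(Hf \<longlongrightarrow> 0) at_bot" by (simp add: Hf_def[abs_def])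
  have "((\<lambda>x. \<mu> + x * x * (w1 x / x) / w x) \<longlongrightarrow> \<mu> + 0 * 0 * - (\<alpha> * f0 / real N) / w0) (at_right 0)"
    using w0 by (intro tendsto_intros w1_lim w_lim) auto
  then have "((\<lambda>x. \<mu> + x * x * (w1 x / x) / w x) \<longlongrightarrow> \<mu>) (at_right 0)" by simp
  from filterlim_compose[OF this exp_at_right]
  have "((\<lambda>s. \<mu> + exp s * exp s * (w1 (exp s) / exp s) / w (exp s)) \<longlongrightarrow> \<mu>) at_bot" .
  moreover have "eventually (\<lambda>s. \<mu> + exp s * exp s * (w1 (exp s) / exp s) / w (exp s) = H1f s / Hf s) at_bot"
    using filterlim_iff[THEN iffD1, OF exp_at_right, rule_format, OF ev_J]
  proof eventually_elim
    case (elim s)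
    then have "w (exp s) > 0" by (rule w_pos)
    then show ?case by (simp add: H1f_def Hf_def field_simps)
  qed
  ultimately show "((\<lambda>s. H1f s / Hf s) \<longlongrightarrow> \<mu>) at_bot" by (rule Lim_transform_eventually)
qed

lemma traj_G: "exp s \<in> J \<Longrightarrow> traj.G s = \<beta> / m * (exp s)\<^sup>2 * w (exp s) powr (1 / m - 1)"
  unfolding traj.G_def by (rule G_eq)

text \<open>\<open>w powr ((m - 1) / m)\<close> is f^(m-1), the quantity that is quadratic in x for
  Barenblatt profiles.\<close>

lemma powr_neg_deriv:
  assumes x: "x \<in> J"
  shows "((\<lambda>x. w x powr ((m - 1) / m)) has_real_derivative (1 - m) / m * (- w1 x) / f x) (at x)"
proof -
  have "w x powr ((m - 1) / m - of_nat 1) = 1 / f x"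
    using m w_pos[OF x] by (simp add: powr_minus_divide[symmetric] diff_divide_distrib)
  then show ?thesis
    by (intro DERIV_cong[OF DERIV_fun_powr[OF w_deriv[OF x] w_pos[OF x]]])
      (use m in \<open>simp add: field_simps\<close>)
qed

text \<open>\<open>T\<close> is x^(N-1) (w1 + (\<alpha> / N) x f). It starts from zero and
  decreases, so - w1 / f \<ge> (\<alpha> / N) x, and integration bounds f^(m-1) from below by its
  value at 0 plus k x^2. Dropping the value at 0 leaves a bound independent of the initial
  value.\<close>

lemma barenblatt_bound:
  assumes N\<beta>: "real N * \<beta> \<le> \<alpha>" and x: "x \<in> J"
  shows "\<alpha> * (1 - m) / (2 * m * real N) * x\<^sup>2 * w x powr (1 / m - 1) \<le> 1"
proof -
  define T where "T = (\<lambda>x. flux x + (\<alpha> / real N - \<beta>) * x ^ N * f x)"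
  have Teq: "T x = x ^ (N - 1) * (w1 x + \<alpha> / real N * x * f x)" for x
    unfolding T_def flux_def power_N by (simp add: algebra_simps)
  have T_neg: "T x < 0" if x: "x \<in> J" for x
  proof (rule tendsto_zero_if_deriv[of T x "\<lambda>x. - (x ^ (N - 1) * src x) +
      ((\<alpha> / real N - \<beta>) * (real N * x ^ (N - 1)) * f x + w x powr (1 / m - 1) * w1 x / m * ((\<alpha> / real N - \<beta>) * x ^ N))"])
    have "((\<lambda>x. flux x + (\<alpha> / real N - \<beta>) * x ^ N * f x) \<longlongrightarrow> 0 + (\<alpha> / real N - \<beta>) * 0 ^ N * f0) (at_right 0)"
      by (intro tendsto_add tendsto_mult tendsto_power tendsto_ident_at tendsto_const flux_lim f_lim)
    then show "(T \<longlongrightarrow> 0) (at_right 0)" using N by (simp add: T_def power_0_left)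
    show "0 < x" using J_pos[OF x] .
    fix t assume t: "0 < t" "t \<le> x"
    then have tJ: "t \<in> J" using J_down[OF x] by blast
    have 1: "((\<lambda>x. (\<alpha> / real N - \<beta>) * x ^ N) has_real_derivative (\<alpha> / real N - \<beta>) * (real N * t ^ (N - 1))) (at t)"
      using DERIV_cmult[OF DERIV_pow[of N t UNIV]] by simp
    show "(T has_real_derivative - (t ^ (N - 1) * src t) +
      ((\<alpha> / real N - \<beta>) * (real N * t ^ (N - 1)) * f t + w t powr (1 / m - 1) * w1 t / m * ((\<alpha> / real N - \<beta>) * t ^ N))) (at t)"
      unfolding T_def by (rule DERIV_add[OF flux_deriv[OF tJ] DERIV_mult[OF 1 f_deriv[OF tJ]]])
    have c0: "\<alpha> / real N - \<beta> \<ge> 0" using N\<beta> N by (simp add: field_simps)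
    \<comment> \<open>The coefficient \<alpha> / N - \<beta> is chosen to cancel the term (\<alpha>
      - N \<beta>) f of \<open>src\<close>; only the source remains.\<close>
    have "- (t ^ (N - 1) * src t) + (\<alpha> / real N - \<beta>) * (real N * t ^ (N - 1)) * f t
        = - (t ^ (N - 1) * (t powr \<sigma> * w t powr (p / m)))"
      unfolding src_def using N by (simp add: field_simps)
    moreover have "t ^ (N - 1) * (t powr \<sigma> * w t powr (p / m)) > 0" using t w_pos[OF tJ] by simp
    moreover have "w t powr (1 / m - 1) * w1 t / m * ((\<alpha> / real N - \<beta>) * t ^ N) \<le> 0"
      using w1_neg[OF tJ] c0 t m by (intro mult_nonpos_nonneg divide_nonpos_pos mult_nonneg_nonpos) auto
    ultimately show "- (t ^ (N - 1) * src t) + ((\<alpha> / real N - \<beta>) * (real N * t ^ (N - 1)) * f t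
        + w t powr (1 / m - 1) * w1 t / m * ((\<alpha> / real N - \<beta>) * t ^ N)) < 0" by linarith
  qed
  define k where "k = \<alpha> * (1 - m) / (2 * m * real N)"
  define P where "P = (\<lambda>x. k * x\<^sup>2 - w x powr ((m - 1) / m))"
  have slope: "\<alpha> / real N * t \<le> - w1 t / f t" if "t \<in> J" for t
  proof -
    have "w1 t + \<alpha> / real N * t * f t < 0"
      using T_neg[OF that] J_pos[OF that] by (simp add: Teq mult_less_0_iff)
    then show ?thesis by (subst pos_le_divide_eq[OF f_pos[OF that]]) simp
  qed
  have x0: "x > 0" using J_pos[OF x] .
  have Pmono: "P x \<le> P y" if "0 < y" "y \<le> x" for y
  proof (rule DERIV_nonpos_imp_nonincreasing[of y x P])
    fix t assume t: "y \<le> t" "t \<le> x"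
    then have tJ: "t \<in> J" using J_down[OF x] that by auto
    have "((\<lambda>x. k * x\<^sup>2) has_real_derivative k * (2 * t)) (at t)" by (auto intro!: derivative_eq_intros)
    from DERIV_diff[OF this powr_neg_deriv[OF tJ]]
    have D: "(P has_real_derivative k * (2 * t) - (1 - m) / m * (- w1 t) / f t) (at t)" by (simp add: P_def)
    have "k * (2 * t) = (1 - m) / m * (\<alpha> / real N * t)" using m N by (simp add: k_def field_simps)
    also have "\<dots> \<le> (1 - m) / m * (- w1 t / f t)" using slope[OF tJ] m by (intro mult_left_mono) auto
    finally have "k * (2 * t) - (1 - m) / m * (- w1 t) / f t \<le> 0" by simp
    then show "\<exists>y. (P has_real_derivative y) (at t) \<and> y \<le> 0" using D by blast
  qed (use that in auto)
  have "(P \<longlongrightarrow> k * 0\<^sup>2 - w0 powr ((m - 1) / m)) (at_right 0)"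
    unfolding P_def using w0 by (intro tendsto_intros w_lim) auto
  moreover have "eventually (\<lambda>y. P x \<le> P y) (at_right 0)"
    using Pmono x0 by (intro eventually_at_rightI[of 0 x]) auto
  ultimately have "P x \<le> k * 0\<^sup>2 - w0 powr ((m - 1) / m)" by (intro tendsto_lowerbound) auto
  also have "\<dots> \<le> 0" by simp
  finally have "k * x\<^sup>2 \<le> w x powr ((m - 1) / m)" by (simp add: P_def)
  then have "k * x\<^sup>2 * w x powr (1 / m - 1) \<le> w x powr ((m - 1) / m) * w x powr (1 / m - 1)"
    by (intro mult_right_mono) auto
  also have "\<dots> = 1" using w_pos[OF x] m by (simp add: field_simps flip: powr_add)
  finally show ?thesis by (simp add: k_def)
qed

text \<open>L'Hopital reduces this to the limit of w1 / x. It holds for every regular start, so the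
  existence statements get the prescribed origin behavior automatically.\<close>

lemma origin_expansion:
  "((\<lambda>x. (w x powr ((m - 1) / m) - w0 powr ((m - 1) / m)) / x\<^sup>2) \<longlongrightarrow> \<alpha> * (1 - m) / (2 * m * real N)) (at_right 0)"
proof (rule lhopital_right_0)
  have "((\<lambda>x. w x powr ((m - 1) / m) - w0 powr ((m - 1) / m)) \<longlongrightarrow>
      w0 powr ((m - 1) / m) - w0 powr ((m - 1) / m)) (at_right 0)"
    using w0 by (intro tendsto_intros w_lim) auto
  then show "((\<lambda>x. w x powr ((m - 1) / m) - w0 powr ((m - 1) / m)) \<longlongrightarrow> 0) (at_right 0)" by simp
  have "((\<lambda>x::real. x\<^sup>2) \<longlongrightarrow> 0\<^sup>2) (at_right 0)" by (intro tendsto_intros)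
  then show "((\<lambda>x::real. x\<^sup>2) \<longlongrightarrow> 0) (at_right 0)" by simp
  show "eventually (\<lambda>x::real. x\<^sup>2 \<noteq> 0) (at_right 0)" by (intro eventually_at_rightI[of 0 1]) auto
  show "eventually (\<lambda>x::real. 2 * x \<noteq> 0) (at_right 0)" by (intro eventually_at_rightI[of 0 1]) auto
  show "eventually (\<lambda>x. DERIV (\<lambda>x. w x powr ((m - 1) / m) - w0 powr ((m - 1) / m)) x :>
      (1 - m) / m * (- w1 x) / f x) (at_right 0)"
    using ev_J
  proof eventually_elim
    case (elim x)
    show ?case using DERIV_diff[OF powr_neg_deriv[OF elim] DERIV_const] by simp
  qed
  show "eventually (\<lambda>x::real. DERIV (\<lambda>x. x\<^sup>2) x :> 2 * x) (at_right 0)"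
    by (rule always_eventually) (auto intro!: derivative_eq_intros)
  have "((\<lambda>x. - ((1 - m) / m) * (w1 x / x) / (2 * f x)) \<longlongrightarrow>
      - ((1 - m) / m) * (- (\<alpha> * f0 / real N)) / (2 * f0)) (at_right 0)"
    using w0 by (intro tendsto_intros w1_lim w_lim) auto
  moreover have "- ((1 - m) / m) * (- (\<alpha> * f0 / real N)) / (2 * f0) = \<alpha> * (1 - m) / (2 * m * real N)"
    using w0 N m by (simp add: field_simps)
  ultimately show "((\<lambda>x. (1 - m) / m * (- w1 x) / f x / (2 * x)) \<longlongrightarrow> \<alpha> * (1 - m) / (2 * m * real N)) (at_right 0)"
    by (simp add: mult.commute mult.left_commute mult.assoc)
qed

end

subsection \<open>Profiles\<close>

lemma decay_at_infinity_iff: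
  assumes "C > 0"
  shows "decay_at_infinity k C f \<longleftrightarrow> ((\<lambda>x. f x * x powr k) \<longlongrightarrow> C) at_top"
proof -
  \<comment> \<open>The quotient in the definition of \<open>asymp_equiv\<close> with its convention
    for 0 / 0, which is never active for x > 0 because C > 0.\<close>
  let ?g = "\<lambda>x. if f x = 0 \<and> C * x powr (- k) = 0 then 1 else f x / (C * x powr (- k))"
  have eq: "eventually (\<lambda>x. ?g x = f x * x powr k / C) at_top"
    using eventually_gt_at_top[of "0 :: real"]
    by eventually_elim (use assms in \<open>auto simp: powr_minus field_simps\<close>)
  have "decay_at_infinity k C f \<longleftrightarrow> ((\<lambda>x. f x * x powr k / C) \<longlongrightarrow> 1) at_top"
    unfolding decay_at_infinity_def asymp_equiv_def by (rule tendsto_cong[OF eq])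
  also have "\<dots> \<longleftrightarrow> ((\<lambda>x. f x * x powr k) \<longlongrightarrow> C) at_top"
  proof
    assume "((\<lambda>x. f x * x powr k / C) \<longlongrightarrow> 1) at_top"
    from tendsto_mult_left[OF this, of C] show "((\<lambda>x. f x * x powr k) \<longlongrightarrow> C) at_top" using assms by simp
  next
    assume "((\<lambda>x. f x * x powr k) \<longlongrightarrow> C) at_top"
    from tendsto_divide[OF this tendsto_const[of C]] show "((\<lambda>x. f x * x powr k / C) \<longlongrightarrow> 1) at_top" using assms by simp
  qed
  finally show ?thesis .
qed

text \<open>\<open>J\<close> is a parameter because this serves both the whole half-line and the
  interval before a hypothetical first zero. Differentiating f = w^(1/m) turns the profile equation
  into one for w.\<close>

lemma (in exponents) profile_radial_on:
  assumes prof: "is_profile N m \<sigma> p f"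
    and J: "\<And>x. x \<in> J \<Longrightarrow> 0 < x" "\<And>x y. x \<in> J \<Longrightarrow> 0 < y \<Longrightarrow> y \<le> x \<Longrightarrow> y \<in> J" "J \<noteq> {}"
    and pos: "\<And>x. x \<in> J \<Longrightarrow> f x > 0"
  shows "radial_solution N m \<sigma> p (f 0 powr m) J (\<lambda>x. f x powr m) (deriv (\<lambda>x. f x powr m))"
proof
  define w where "w = (\<lambda>x. f x powr m)"
  have f0: "f 0 > 0" and fd: "(f has_real_derivative 0) (at 0 within {0..})"
    and nonneg: "\<And>x. x \<ge> 0 \<Longrightarrow> f x \<ge> 0"
    using prof by (auto simp: is_profile_def)
  obtain D where D: "\<And>x. x > 0 \<Longrightarrow> (w has_vector_derivative D x) (at x)"
    using prof by (auto simp: is_profile_def C1_differentiable_on_def w_def)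
  have w_deriv: "(w has_real_derivative deriv w x) (at x)" if "x > 0" for x
    using D[OF that] DERIV_imp_deriv by (metis has_real_derivative_iff_has_vector_derivative)
  fix x assume x: "x \<in> J"
  have x0: "x > 0" by (rule J(1)[OF x])
  have fx: "f x > 0" by (rule pos[OF x])
  show "0 < f x powr m" using fx by simp
  show "((\<lambda>x. f x powr m) has_real_derivative deriv (\<lambda>x. f x powr m) x) (at x)"
    using w_deriv[OF x0] by (simp add: w_def)
  have ode: "deriv w differentiable (at x)"
    "deriv (deriv w) x + (real N - 1) / x * deriv w x + \<alpha> * f x + \<beta> * x * deriv f x + x powr \<sigma> * f x powr p = 0"
    using prof x0 fx by (auto simp: is_profile_def w_def)
  have root: "f y = w y powr (1 / m)" if "y > 0" for y
    using nonneg[of y] that m by (simp add: w_def powr_powr)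
  have wx: "w x > 0" using fx by (simp add: w_def)
  have "((\<lambda>y. w y powr (1 / m)) has_real_derivative 1 / m * w x powr (1 / m - of_nat 1) * deriv w x) (at x)"
    by (rule DERIV_fun_powr[OF w_deriv[OF x0] wx])
  then have "(f has_real_derivative 1 / m * w x powr (1 / m - of_nat 1) * deriv w x) (at x)"
    by (rule has_field_derivative_transform_within_open[of _ _ _ "{0<..}"]) (use x0 root in auto)
  then have "deriv f x = w x powr (1 / m - 1) * deriv w x / m"
    by (simp add: DERIV_imp_deriv)
  moreover have "f x = w x powr (1 / m)" by (rule root[OF x0])
  moreover have "f x powr p = w x powr (p / m)" using m by (simp add: w_def powr_powr)
  ultimately have "deriv (deriv w) x = - ((real N - 1) / x * deriv w x) - \<alpha> * w x powr (1 / m)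
      - \<beta> * x * (w x powr (1 / m - 1) * deriv w x / m) - x powr \<sigma> * w x powr (p / m)"
    using ode(2) by (simp only:)
  moreover have "(deriv w has_real_derivative deriv (deriv w) x) (at x)"
    using ode(1) by (simp add: DERIV_deriv_iff_real_differentiable)
  ultimately have "(deriv w has_real_derivative - ((real N - 1) / x * deriv w x) - \<alpha> * w x powr (1 / m)
      - \<beta> * x * (w x powr (1 / m - 1) * deriv w x / m) - x powr \<sigma> * w x powr (p / m)) (at x)"
    by simp
  then show "(deriv (\<lambda>x. f x powr m) has_real_derivative
      - ((real N - 1) / x * deriv (\<lambda>x. f x powr m) x) - \<alpha> * (f x powr m) powr (1 / m)
      - \<beta> * x * ((f x powr m) powr (1 / m - 1) * deriv (\<lambda>x. f x powr m) x / m)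
      - x powr \<sigma> * (f x powr m) powr (p / m)) (at x)"
    unfolding w_def .
next
  have f0: "f 0 > 0" and fd: "(f has_real_derivative 0) (at 0 within {0..})"
    using prof by (auto simp: is_profile_def)
  have fc: "(f \<longlongrightarrow> f 0) (at_right 0)"
    using DERIV_continuous[OF fd] unfolding continuous_within
    by (rule tendsto_within_subset) auto
  show "((\<lambda>x. f x powr m) \<longlongrightarrow> f 0 powr m) (at_right 0)"
    using f0 by (intro tendsto_powr fc tendsto_const) auto
  have "((\<lambda>y. y powr m) has_real_derivative m * f 0 powr (m - of_nat 1) * 1) (at (f 0))"
    by (rule DERIV_fun_powr[OF DERIV_ident f0])
  then have "((\<lambda>y. y powr m) has_real_derivative m * f 0 powr (m - of_nat 1) * 1) (at (f 0) within f ` {0..})"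
    by (rule has_field_derivative_at_within)
  from DERIV_image_chain[OF this fd]
  have "((\<lambda>x. f x powr m) has_real_derivative 0) (at 0 within {0..})" by (simp add: o_def)
  then have "((\<lambda>x. (f x powr m - f 0 powr m) / x) \<longlongrightarrow> 0) (at 0 within {0..})"
    by (simp add: has_field_derivative_iff)
  then show "((\<lambda>x. (f x powr m - f 0 powr m) / x) \<longlongrightarrow> 0) (at_right 0)"
    by (rule tendsto_within_subset) auto
  show "0 < f 0 powr m" using f0 by simp
  show "\<And>x. x \<in> J \<Longrightarrow> 0 < x" by (rule J(1))
  show "\<And>x y. x \<in> J \<Longrightarrow> 0 < y \<Longrightarrow> y \<le> x \<Longrightarrow> y \<in> J" by (rule J(2))
  show "J \<noteq> {}" by (rule J(3))
qed

text \<open>At a first zero R the nonnegative function w has a minimum, so w'(R) = 0. Being C^1, w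
  has a derivative that tends to zero from the left of R, which \<open>w1_not_tendsto_zero\<close>
  forbids.\<close>

lemma (in exponents) profile_pos:
  assumes prof: "is_profile N m \<sigma> p f" and x: "x \<ge> 0"
  shows "f x > 0"
proof (rule ccontr)
  assume neg: "\<not> f x > 0"
  define w where "w = (\<lambda>x. f x powr m)"
  have f0: "f 0 > 0" and fd: "(f has_real_derivative 0) (at 0 within {0..})"
    and nonneg: "\<And>x. x \<ge> 0 \<Longrightarrow> f x \<ge> 0"
    using prof by (auto simp: is_profile_def)
  obtain D where D: "\<And>x. x > 0 \<Longrightarrow> (w has_vector_derivative D x) (at x)" "continuous_on {0<..} D"
    using prof by (auto simp: is_profile_def C1_differentiable_on_def w_def)
  have wD: "(w has_real_derivative D x) (at x)" if "x > 0" for x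
    using D(1)[OF that] by (metis has_real_derivative_iff_has_vector_derivative)
  then have Dw: "deriv w x = D x" if "x > 0" for x using that DERIV_imp_deriv by blast
  have root: "f y = w y powr (1 / m)" if "y \<ge> 0" for y
    using nonneg[of y] that m by (simp add: w_def powr_powr)
  \<comment> \<open>At a zero of f only f^m is known to be continuous; f inherits this as its 1/m-th
    power.\<close>
  have "continuous (at y within {0..x}) f" if y: "y \<in> {0..x}" for y
  proof (cases "y = 0")
    case True
    show ?thesis using DERIV_continuous[OF fd] unfolding True
      by (rule continuous_within_subset) auto
  next
    case False
    then have y0: "y > 0" using y by simp
    have "isCont (\<lambda>y. w y powr (1 / m)) y"
      using DERIV_isCont[OF wD[OF y0]] unfolding isCont_def
      by (rule tendsto_powr'[OF _ tendsto_const]) (use m in \<open>auto simp: w_def\<close>)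
    moreover have "eventually (\<lambda>y. w y powr (1 / m) = f y) (nhds y)"
      using eventually_nhds_in_open[of "{0<..}" y] y0 by (auto elim!: eventually_mono simp: root)
    ultimately have "isCont f y" using isCont_cong[of "\<lambda>y. w y powr (1 / m)" f y] by simp
    then show ?thesis by (rule continuous_at_imp_continuous_at_within)
  qed
  then have "continuous_on {0..x} (\<lambda>y. - f y)"
    by (intro continuous_on_minus) (simp add: continuous_on_eq_continuous_within)
  from first_crossing[OF this] obtain R where R: "0 < R" "R \<le> x" "f R = 0" "\<And>u. 0 \<le> u \<Longrightarrow> u < R \<Longrightarrow> f u > 0"
    using x f0 neg by auto
  interpret radial_solution N m \<sigma> p "f 0 powr m" "{0<..<R}" w "deriv w"
    unfolding w_def by (rule profile_radial_on[OF prof]) (use R in auto)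
  have "D R = 0"
  proof (rule DERIV_local_min[OF wD[OF R(1)] R(1)])
    show "\<forall>y. \<bar>R - y\<bar> < R \<longrightarrow> w R \<le> w y" using R m by (simp add: w_def)
  qed
  moreover have "isCont D R" using D(2) R(1) by (simp add: continuous_on_eq_continuous_at)
  ultimately have "(D \<longlongrightarrow> 0) (at_left R)"
    unfolding isCont_def by (auto intro: tendsto_within_subset)
  moreover have "eventually (\<lambda>y. D y = deriv w y) (at_left R)"
    using R Dw by (intro eventually_at_leftI[of 0]) auto
  ultimately have "(deriv w \<longlongrightarrow> 0) (at_left R)" by (rule Lim_transform_eventually)
  then show False using w1_not_tendsto_zero[OF refl] by blast
qed

lemma (in exponents) profile_radial:
  assumes "is_profile N m \<sigma> p f"
  shows "radial_solution N m \<sigma> p (f 0 powr m) {0<..} (\<lambda>x. f x powr m) (deriv (\<lambda>x. f x powr m))"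
  by (rule profile_radial_on[OF assms]) (use profile_pos[OF assms] in auto)

section \<open>Solutions positive on the whole half-line\<close>

locale entire_radial_solution = radial_solution N m \<sigma> p w0 "{0<..}" w w1
  for N :: nat and m \<sigma> p w0 :: real and w w1 :: "real \<Rightarrow> real"
begin

sublocale glob: global_trajectory a c q \<kappa> \<rho> \<mu> "\<beta> / m" Hf H1f
  using traj.damped_trajectory_axioms by (simp add: global_trajectory_def)

lemma Hf_ln: "x > 0 \<Longrightarrow> Hf (ln x) powr (1 / m) = f x * x powr \<theta>"
  using Hf_powr[of "ln x" "1 / m"] m by (simp add: \<mu>_def powr_def[of x \<theta>] mult.commute)

lemma no_solution_subcritical:
  assumes "a \<le> 0" shows False
proof -
  have "real N - 2 - \<mu> \<le> 0" using assms mu_pos by (simp add: a_def mult_le_0_iff)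
  then have "c < 0" using mu_pos by (simp add: c_def)
  then show False using glob.not_global_nonpos assms by blast
qed

text \<open>The exact rate comes from c + 2 \<mu> = N - 2, which turns exp ((c + \<mu>) s) H into
  x^(N-2) f^m.\<close>

lemma fast:
  assumes c: "c < 0" and a: "a > 0"
  shows "((\<lambda>x. f x * x powr \<theta>) \<longlongrightarrow> 0) at_top"
    and "\<exists>C>0. ((\<lambda>x. f x * x powr ((real N - 2) / m)) \<longlongrightarrow> C) at_top"
proof -
  have "((\<lambda>s. Hf s powr (1 / m)) \<longlongrightarrow> 0) at_top"
    using m glob.H_pos by (intro tendsto_zero_powrI[OF glob.H_top_of_c_neg[OF c a] tendsto_const])
      (auto intro!: always_eventually less_imp_le)
  from filterlim_compose[OF this ln_at_top]
  have "((\<lambda>x. Hf (ln x) powr (1 / m)) \<longlongrightarrow> 0) at_top" .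
  moreover have "eventually (\<lambda>x. Hf (ln x) powr (1 / m) = f x * x powr \<theta>) at_top"
    using eventually_gt_at_top[of 0] by eventually_elim (rule Hf_ln)
  ultimately show "((\<lambda>x. f x * x powr \<theta>) \<longlongrightarrow> 0) at_top" by (rule Lim_transform_eventually)
  obtain C where C: "C > 0" "((\<lambda>s. exp ((c + \<mu>) * s) * Hf s) \<longlongrightarrow> C) at_top"
    using glob.fast_decay[OF c a] by blast
  have "((\<lambda>s. (exp ((c + \<mu>) * s) * Hf s) powr (1 / m)) \<longlongrightarrow> C powr (1 / m)) at_top"
    using C by (intro tendsto_powr tendsto_const) auto
  from filterlim_compose[OF this ln_at_top]
  have "((\<lambda>x. (exp ((c + \<mu>) * ln x) * Hf (ln x)) powr (1 / m)) \<longlongrightarrow> C powr (1 / m)) at_top" .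
  moreover have "eventually (\<lambda>x. (exp ((c + \<mu>) * ln x) * Hf (ln x)) powr (1 / m) =
      f x * x powr ((real N - 2) / m)) at_top"
    using eventually_gt_at_top[of 0]
  proof eventually_elim
    case (elim x)
    have "exp ((c + \<mu>) * ln x) * Hf (ln x) = x powr (real N - 2) * w x"
      using elim by (simp add: Hf_def c_def powr_def algebra_simps flip: exp_add)
    then show ?case using elim w_pos[of x] by (simp add: powr_mult powr_powr mult.commute)
  qed
  ultimately have "((\<lambda>x. f x * x powr ((real N - 2) / m)) \<longlongrightarrow> C powr (1 / m)) at_top"
    by (rule Lim_transform_eventually)
  then show "\<exists>C>0. ((\<lambda>x. f x * x powr ((real N - 2) / m)) \<longlongrightarrow> C) at_top"
    using C by (intro exI[of _ "C powr (1 / m)"]) simp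
qed

lemma slow:
  assumes c: "c > 0"
  shows "\<exists>C>0. ((\<lambda>x. f x * x powr \<theta>) \<longlongrightarrow> C) at_top"
    and "\<not> ((\<lambda>x. f x * x powr ((real N - 2) / m)) \<longlongrightarrow> C) at_top"
proof -
  have Hs: "glob.Hs > 0" using glob.H_top_of_c_pos(1)[OF c] by (simp add: glob.Hs_def)
  then have "((\<lambda>s. Hf s powr (1 / m)) \<longlongrightarrow> glob.Hs powr (1 / m)) at_top"
    by (intro tendsto_powr[OF glob.H_top_of_c_pos(2)[OF c] tendsto_const]) auto
  from filterlim_compose[OF this ln_at_top]
  have "((\<lambda>x. Hf (ln x) powr (1 / m)) \<longlongrightarrow> glob.Hs powr (1 / m)) at_top" .
  moreover have "eventually (\<lambda>x. Hf (ln x) powr (1 / m) = f x * x powr \<theta>) at_top"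
    using eventually_gt_at_top[of 0] by eventually_elim (rule Hf_ln)
  ultimately have lim: "((\<lambda>x. f x * x powr \<theta>) \<longlongrightarrow> glob.Hs powr (1 / m)) at_top"
    by (rule Lim_transform_eventually)
  then show "\<exists>C>0. ((\<lambda>x. f x * x powr \<theta>) \<longlongrightarrow> C) at_top"
    using Hs by (intro exI[of _ "glob.Hs powr (1 / m)"]) simp
  show "\<not> ((\<lambda>x. f x * x powr ((real N - 2) / m)) \<longlongrightarrow> C) at_top"
  proof
    assume C: "((\<lambda>x. f x * x powr ((real N - 2) / m)) \<longlongrightarrow> C) at_top"
    \<comment> \<open>c > 0 gives \<mu> < N - 2, so decay at rate (N - 2) / m is strictly faster
      than at rate \<theta> and would make the positive limit vanish.\<close>
    have "m * \<theta> < real N - 2" using c mu_pos by (simp add: c_def \<mu>_def)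
    then have neg: "\<theta> - (real N - 2) / m < 0" using m by (simp add: pos_less_divide_eq mult.commute)
    have "((\<lambda>x. f x * x powr ((real N - 2) / m) * x powr (\<theta> - (real N - 2) / m)) \<longlongrightarrow> C * 0) at_top"
      by (intro tendsto_mult C tendsto_neg_powr neg filterlim_ident)
    moreover have "eventually (\<lambda>x. f x * x powr ((real N - 2) / m) * x powr (\<theta> - (real N - 2) / m) = f x * x powr \<theta>) at_top"
      using eventually_gt_at_top[of 0]
      by eventually_elim (simp add: mult.assoc flip: powr_add)
    ultimately have "((\<lambda>x. f x * x powr \<theta>) \<longlongrightarrow> C * 0) at_top" by (rule Lim_transform_eventually)
    then have "C * 0 = glob.Hs powr (1 / m)" using lim tendsto_unique by (metis trivial_limit_at_top_linorder)
    then show False using Hs by simp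
  qed
qed

text \<open>The locale controls \<open>w\<close> on positive arguments only, so the value at 0 is
  set to the limit \<open>w0\<close>; the one-sided derivative at 0 then comes from
  \<open>w_flat\<close>.\<close>

definition prof :: "real \<Rightarrow> real" where "prof x = (if x \<le> 0 then w0 else w x) powr (1 / m)"

lemma prof_eq: "x > 0 \<Longrightarrow> prof x = f x"
  by (simp add: prof_def)

lemma prof_is_profile: "is_profile N m \<sigma> p prof"
  unfolding is_profile_def
proof (intro conjI allI impI)
  have pm: "prof x powr m = w x" if "x > 0" for x
    using that w_pos[of x] m by (simp add: prof_def powr_powr)
  have wd: "((\<lambda>x. prof x powr m) has_real_derivative w1 x) (at x)" if "x > 0" for x
    by (rule has_field_derivative_transform_within_open[OF w_deriv, of _ "{0<..}"])
      (use that pm in auto)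
  have dw: "deriv (\<lambda>x. prof x powr m) x = w1 x" if "x > 0" for x
    using wd[OF that] by (rule DERIV_imp_deriv)
  have w1c: "continuous_on {0<..} w1"
    using w1_deriv by (intro continuous_at_imp_continuous_on) (auto intro!: DERIV_isCont)
  show "prof x \<ge> 0" for x by (simp add: prof_def)
  show "prof 0 > 0" using w0 by (simp add: prof_def)
  show "(\<lambda>x. prof x powr m) C1_differentiable_on {0<..}"
    unfolding C1_differentiable_on_def
    using wd w1c by (intro exI[of _ w1]) (auto simp: has_real_derivative_iff_has_vector_derivative)
  show "(prof has_real_derivative 0) (at 0 within {0..})"
  proof -
    define W where "W = (\<lambda>x. if x \<le> 0 then w0 else w x)"
    have "((\<lambda>x. (W x - W 0) / (x - 0)) \<longlongrightarrow> 0) (at_right 0)"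
      by (rule Lim_transform_eventually[OF w_flat]) (auto simp: W_def intro!: eventually_at_rightI[of 0 1])
    then have "((\<lambda>x. (W x - W 0) / (x - 0)) \<longlongrightarrow> 0) (at 0 within {0..})"
      by (simp add: at_within_Ici_at_right)
    then have Wd: "(W has_real_derivative 0) (at 0 within {0..})" by (simp add: has_field_derivative_iff)
    have "((\<lambda>y. y powr (1 / m)) has_real_derivative 1 / m * W 0 powr (1 / m - of_nat 1) * 1) (at (W 0))"
      by (rule DERIV_fun_powr[OF DERIV_ident]) (use w0 in \<open>simp add: W_def\<close>)
    then have "((\<lambda>y. y powr (1 / m)) has_real_derivative 1 / m * W 0 powr (1 / m - of_nat 1) * 1) (at (W 0) within W ` {0..})"
      by (rule has_field_derivative_at_within)
    from DERIV_image_chain[OF this Wd] show ?thesis by (simp add: o_def prof_def[abs_def] W_def)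
  qed
  fix x :: real assume x: "x > 0"
  have pd: "(prof has_real_derivative w x powr (1 / m - 1) * w1 x / m) (at x)"
    by (rule has_field_derivative_transform_within_open[OF f_deriv, of _ "{0<..}"])
      (use x prof_eq in auto)
  then show "prof differentiable (at x)" by (auto simp: real_differentiable_def)
  have w1d: "(deriv (\<lambda>x. prof x powr m) has_real_derivative
      - ((real N - 1) / x * w1 x) - \<alpha> * w x powr (1 / m)
      - \<beta> * x * (w x powr (1 / m - 1) * w1 x / m) - x powr \<sigma> * w x powr (p / m)) (at x)"
    by (rule has_field_derivative_transform_within_open[OF w1_deriv, of _ "{0<..}"])
      (use x dw in auto)
  then show "deriv (\<lambda>x. prof x powr m) differentiable (at x)" by (auto simp: real_differentiable_def)
  have "prof x powr p = w x powr (p / m)" using x by (simp add: prof_def powr_powr)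
  then show "deriv (deriv (\<lambda>x. prof x powr m)) x + (real N - 1) / x * deriv (\<lambda>x. prof x powr m) x
      + \<alpha> * prof x + \<beta> * x * deriv prof x + x powr \<sigma> * prof x powr p = 0"
    using x by (simp add: DERIV_imp_deriv[OF w1d] DERIV_imp_deriv[OF pd] dw prof_eq)
qed

lemma prof_strict_antimono: "strict_antimono_on {0..} prof"
proof (rule monotone_onI)
  fix x y :: real assume xy: "x \<in> {0..}" "y \<in> {0..}" "x < y"
  have "(if y \<le> 0 then w0 else w y) < (if x \<le> 0 then w0 else w x)"
    using xy w_antimono[of y x] w_less_w0[of y] by auto
  then show "prof x > prof y"
    unfolding prof_def using xy m w_pos[of y] by (intro powr_less_mono2) auto
qed

lemma prof_origin: "origin_behavior N m \<sigma> p (w0 powr ((m - 1) / m)) prof"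
  unfolding origin_behavior_def
proof (rule smalloI_tendsto)
  have "((\<lambda>x. (w x powr ((m - 1) / m) - w0 powr ((m - 1) / m)) / x\<^sup>2 - \<alpha> * (1 - m) / (2 * m * real N)) \<longlongrightarrow>
      \<alpha> * (1 - m) / (2 * m * real N) - \<alpha> * (1 - m) / (2 * m * real N)) (at_right 0)"
    by (intro tendsto_diff origin_expansion tendsto_const)
  moreover have "eventually (\<lambda>x. (w x powr ((m - 1) / m) - w0 powr ((m - 1) / m)) / x\<^sup>2 - \<alpha> * (1 - m) / (2 * m * real N) =
      (prof x powr (m - 1) - (w0 powr ((m - 1) / m) + \<alpha> * (1 - m) / (2 * m * real N) * x\<^sup>2)) / x\<^sup>2) (at_right 0)"
    by (intro eventually_at_rightI[of 0 1]) (auto simp: prof_def powr_powr diff_divide_distrib add_divide_distrib)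
  ultimately show "((\<lambda>x. (prof x powr (m - 1) - (w0 powr ((m - 1) / m) + \<alpha> * (1 - m) / (2 * m * real N) * x\<^sup>2)) / x\<^sup>2)
      \<longlongrightarrow> 0) (at_right 0)"
    using Lim_transform_eventually by fastforce
  show "eventually (\<lambda>x::real. x\<^sup>2 \<noteq> 0) (at_right 0)" by (intro eventually_at_rightI[of 0 1]) auto
qed

lemma prof_decay:
  "C > 0 \<Longrightarrow> ((\<lambda>x. f x * x powr k) \<longlongrightarrow> C) at_top \<Longrightarrow> decay_at_infinity k C prof"
  unfolding decay_at_infinity_iff
  by (erule Lim_transform_eventually) (auto simp: prof_eq intro!: eventually_mono[OF eventually_gt_at_top[of 0]])

end

lemma (in exponents) profile_entire:
  assumes "is_profile N m \<sigma> p f"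
  shows "entire_radial_solution N m \<sigma> p (f 0 powr m) (\<lambda>x. f x powr m) (deriv (\<lambda>x. f x powr m))"
  using profile_radial[OF assms] by (simp add: entire_radial_solution_def)

lemma (in exponents) profile_root:
  assumes "is_profile N m \<sigma> p f"
  shows "((\<lambda>x. (f x powr m) powr (1 / m) * x powr k) \<longlongrightarrow> C) at_top \<longleftrightarrow> ((\<lambda>x. f x * x powr k) \<longlongrightarrow> C) at_top"
  using profile_pos[OF assms] m
  by (intro tendsto_cong eventually_mono[OF eventually_ge_at_top[of 0]]) (auto simp: powr_powr less_imp_le)

lemma (in exponents) no_profile_subcritical:
  assumes "a \<le> 0" shows "\<not> is_profile N m \<sigma> p f"
  using profile_entire entire_radial_solution.no_solution_subcritical assms by blast

lemma (in exponents) no_slow_profile: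
  assumes "c < 0" "a > 0" "C > 0"
  shows "\<not> (is_profile N m \<sigma> p f \<and> decay_at_infinity \<theta> C f)"
proof
  assume prof: "is_profile N m \<sigma> p f \<and> decay_at_infinity \<theta> C f"
  then have p: "is_profile N m \<sigma> p f" and d: "((\<lambda>x. f x * x powr \<theta>) \<longlongrightarrow> C) at_top"
    using decay_at_infinity_iff assms(3) by auto
  have "((\<lambda>x. f x * x powr \<theta>) \<longlongrightarrow> 0) at_top"
    using entire_radial_solution.fast(1)[OF profile_entire[OF p] assms(1,2)] profile_root[OF p] by blast
  then have "C = 0" using d tendsto_unique by (metis trivial_limit_at_top_linorder)
  then show False using assms(3) by simp
qed

lemma (in exponents) no_fast_profile:
  assumes "c > 0" "C > 0"
  shows "\<not> (is_profile N m \<sigma> p f \<and> decay_at_infinity ((real N - 2) / m) C f)"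
proof
  assume prof: "is_profile N m \<sigma> p f \<and> decay_at_infinity ((real N - 2) / m) C f"
  then have p: "is_profile N m \<sigma> p f" and d: "((\<lambda>x. f x * x powr ((real N - 2) / m)) \<longlongrightarrow> C) at_top"
    using decay_at_infinity_iff assms(2) by auto
  show False
    using entire_radial_solution.slow(2)[OF profile_entire[OF p] assms(1)] profile_root[OF p] d by blast
qed

subsection \<open>Volterra equations\<close>

lemma integral_exp_bound:
  fixes l x C :: real
  assumes l: "l > 0" and x: "0 \<le> x" and C: "C \<ge> 0"
  shows "(\<lambda>t. C * exp (l * t)) integrable_on {0..x}" "integral {0..x} (\<lambda>t. C * exp (l * t)) \<le> C / l * exp (l * x)"
proof -
  have "((\<lambda>t. C * exp (l * t)) has_integral C / l * exp (l * x) - C / l * exp (l * 0)) {0..x}"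
  proof (rule fundamental_theorem_of_calculus[OF x])
    fix t
    have "((\<lambda>t. C / l * exp (l * t)) has_real_derivative C * exp (l * t)) (at t)"
      using l by (auto intro!: derivative_eq_intros)
    then show "((\<lambda>t. C / l * exp (l * t)) has_vector_derivative C * exp (l * t)) (at t within {0..x})"
      by (simp add: has_field_derivative_at_within flip: has_real_derivative_iff_has_vector_derivative)
  qed
  note I = this
  show "(\<lambda>t. C * exp (l * t)) integrable_on {0..x}" using I by (rule has_integral_integrable)
  have "C / l \<ge> 0" using l C by simp
  then show "integral {0..x} (\<lambda>t. C * exp (l * t)) \<le> C / l * exp (l * x)"
    unfolding integral_unique[OF I] by simp
qed

text \<open>\<open>K_lip\<close> compares the kernels at t through the functions on the interval up
  to t only. With B = 0 it expresses causality.\<close>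

locale volterra =
  fixes K :: "(real \<Rightarrow> real) \<Rightarrow> real \<Rightarrow> real" and R M :: real
  assumes R: "R \<ge> 0" and M: "M > 0"
    and K_cont: "\<And>u. continuous_on {0..R} u \<Longrightarrow> continuous_on {0..R} (K u)"
    and K_lip: "\<And>u v t B. continuous_on {0..R} u \<Longrightarrow> continuous_on {0..R} v \<Longrightarrow> 0 \<le> t \<Longrightarrow> t \<le> R \<Longrightarrow>
        (\<And>s. 0 \<le> s \<Longrightarrow> s \<le> t \<Longrightarrow> \<bar>u s - v s\<bar> \<le> B) \<Longrightarrow> \<bar>K u t - K v t\<bar> \<le> M * B"
begin

definition solves :: "real \<Rightarrow> (real \<Rightarrow> real) \<Rightarrow> bool" where
  "solves u0 u \<longleftrightarrow> continuous_on {0..R} u \<and> (\<forall>x. 0 \<le> x \<longrightarrow> x \<le> R \<longrightarrow> u x = u0 - integral {0..x} (K u))"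

text \<open>Integrating M d exp (2 M t) gives at most d / 2 times the same weight: the factor 2 in
  the exponent produces the contraction factor one half.\<close>

lemma integral_weighted:
  assumes u: "continuous_on {0..R} u" and v: "continuous_on {0..R} v" and x: "0 \<le> x" "x \<le> R" and d: "d \<ge> 0"
    and bound: "\<And>s. 0 \<le> s \<Longrightarrow> s \<le> R \<Longrightarrow> \<bar>u s - v s\<bar> \<le> d * exp (2 * M * s)"
  shows "\<bar>integral {0..x} (K u) - integral {0..x} (K v)\<bar> \<le> d / 2 * exp (2 * M * x)"
proof -
  have cont: "continuous_on {0..x} (K u)" "continuous_on {0..x} (K v)"
    using K_cont[OF u] K_cont[OF v] x by (auto intro: continuous_on_subset)
  have "\<bar>K u t - K v t\<bar> \<le> M * d * exp (2 * M * t)" if t: "t \<in> {0..x}" for t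
  proof -
    have "\<bar>K u t - K v t\<bar> \<le> M * (d * exp (2 * M * t))"
    proof (rule K_lip[OF u v])
      fix s assume s: "0 \<le> s" "s \<le> t"
      have "d * exp (2 * M * s) \<le> d * exp (2 * M * t)" using s d M by (intro mult_left_mono) auto
      then show "\<bar>u s - v s\<bar> \<le> d * exp (2 * M * t)" using bound[of s] s t x by auto
    qed (use t x in auto)
    then show ?thesis by (simp add: mult.assoc)
  qed
  then have "\<bar>integral {0..x} (\<lambda>t. K u t - K v t)\<bar> \<le> integral {0..x} (\<lambda>t. M * d * exp (2 * M * t))"
    using M x d unfolding real_norm_def[symmetric]
    by (intro integral_norm_bound_integral integral_exp_bound(1) integrable_continuous_real
        continuous_on_diff cont) auto
  also have "\<dots> \<le> M * d / (2 * M) * exp (2 * M * x)"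
    using M x d by (intro integral_exp_bound) auto
  also have "M * d / (2 * M) = d / 2" using M by simp
  finally show ?thesis
    using cont by (simp add: integral_diff integrable_continuous_real)
qed

text \<open>In the norm weighted by \<open>exp (- 2 M x)\<close> the integral operator is a contraction.\<close>

lemma exists_solution: "\<exists>u. solves u0 u"
proof -
  \<comment> \<open>Bounded continuous functions live on the whole line; clamping the argument
    extends functions from the interval.\<close>
  define cl where "cl = (\<lambda>x. max 0 (min x R))"
  have cl: "0 \<le> cl x" "cl x \<le> R" for x using R by (auto simp: cl_def)
  have cl_id: "cl x = x" if "0 \<le> x" "x \<le> R" for x using that by (simp add: cl_def)
  have cl_cont: "continuous_on UNIV cl" unfolding cl_def by (intro continuous_intros)
  \<comment> \<open>The Banach space carries the weighted function and \<open>ex\<close> removes the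
    weight, so that the plain supremum distance is the weighted norm.\<close>
  define ex where "ex = (\<lambda>(g :: real \<Rightarrow>\<^sub>C real) s. exp (2 * M * s) * apply_bcontfun g s)"
  define F where "F = (\<lambda>g x. exp (- 2 * M * x) * (u0 - integral {0..x} (K (ex g))))"
  have ex_cont: "continuous_on S (ex g)" for g S
    unfolding ex_def by (intro continuous_intros continuous_on_apply_bcontfun)
  have F_cont: "continuous_on {0..R} (F g)" for g
    unfolding F_def by (intro continuous_intros indefinite_integral_continuous_1 integrable_continuous_real K_cont ex_cont)
  have F_bcont: "(\<lambda>x. F g (cl x)) \<in> bcontfun" for g
  proof -
    have "continuous_on UNIV (\<lambda>x. F g (cl x))"
      by (rule continuous_on_compose2[OF F_cont cl_cont]) (use cl in auto)
    moreover have "bounded (F g ` {0..R})"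
      by (intro compact_imp_bounded compact_continuous_image F_cont) simp
    then have "bounded (range (\<lambda>x. F g (cl x)))" by (rule bounded_subset) (use cl in auto)
    ultimately show ?thesis by (simp add: bcontfun_def)
  qed
  define T where "T = (\<lambda>g. Bcontfun (\<lambda>x. F g (cl x)))"
  have T: "apply_bcontfun (T g) x = F g (cl x)" for g x
    unfolding T_def by (simp add: Bcontfun_inverse[OF F_bcont])
  have contr: "dist (T g) (T h) \<le> 1 / 2 * dist g h" for g h
  proof (rule dist_bound)
    fix x
    define y where "y = cl x"
    have y: "0 \<le> y" "y \<le> R" using cl by (auto simp: y_def)
    have "\<bar>integral {0..y} (K (ex g)) - integral {0..y} (K (ex h))\<bar> \<le> dist g h / 2 * exp (2 * M * y)"
    proof (rule integral_weighted[OF ex_cont ex_cont y])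
      fix s :: real
      have "\<bar>apply_bcontfun g s - apply_bcontfun h s\<bar> \<le> dist g h"
        using dist_bounded[of g s h] by (simp add: dist_real_def)
      then have "\<bar>apply_bcontfun g s - apply_bcontfun h s\<bar> * exp (2 * M * s) \<le> dist g h * exp (2 * M * s)"
        by (intro mult_right_mono) auto
      moreover have "\<bar>ex g s - ex h s\<bar> = \<bar>apply_bcontfun g s - apply_bcontfun h s\<bar> * exp (2 * M * s)"
        unfolding ex_def right_diff_distrib[symmetric] abs_mult by simp
      ultimately show "\<bar>ex g s - ex h s\<bar> \<le> dist g h * exp (2 * M * s)" by simp
    qed simp
    then have "exp (- 2 * M * y) * \<bar>integral {0..y} (K (ex g)) - integral {0..y} (K (ex h))\<bar>
        \<le> exp (- 2 * M * y) * (dist g h / 2 * exp (2 * M * y))"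
      by (intro mult_left_mono) auto
    also have "\<dots> = 1 / 2 * dist g h" by (simp add: exp_minus)
    also have "exp (- 2 * M * y) * \<bar>integral {0..y} (K (ex g)) - integral {0..y} (K (ex h))\<bar> = \<bar>F g y - F h y\<bar>"
      by (simp add: F_def abs_mult abs_minus_commute flip: right_diff_distrib)
    finally show "dist (apply_bcontfun (T g) x) (apply_bcontfun (T h) x) \<le> 1 / 2 * dist g h"
      by (simp add: T dist_real_def y_def)
  qed
  have "\<exists>!g. T g = g" by (rule banach_fix_type[of "1 / 2"]) (use contr in auto)
  then obtain g where g: "T g = g" by blast
  have "ex g x = u0 - integral {0..x} (K (ex g))" if "0 \<le> x" "x \<le> R" for x
  proof -
    have "apply_bcontfun g x = F g x" using T[of g x] g cl_id[OF that] by simp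
    then show ?thesis by (simp add: ex_def F_def exp_minus)
  qed
  then show ?thesis using ex_cont unfolding solves_def by blast
qed

text \<open>At the maximum of the weighted difference the integral contributes at most half of that
  maximum and is absorbed. Since \<open>v\<close> may solve the equation with an error e, the lemma
  covers uniqueness (e = 0) and perturbed kernels alike.\<close>

lemma comparison:
  assumes u: "solves u0 u" and v: "continuous_on {0..R} v"
    and v_eq: "\<And>x. 0 \<le> x \<Longrightarrow> x \<le> R \<Longrightarrow> \<bar>v x - (v0 - integral {0..x} (K v))\<bar> \<le> e"
    and x: "0 \<le> x" "x \<le> R"
  shows "\<bar>u x - v x\<bar> \<le> 2 * (\<bar>u0 - v0\<bar> + e) * exp (2 * M * x)"
proof -
  define D where "D = (\<lambda>s. exp (- 2 * M * s) * \<bar>u s - v s\<bar>)"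
  have uc: "continuous_on {0..R} u" using u by (simp add: solves_def)
  have Dc: "continuous_on {0..R} D" unfolding D_def by (intro continuous_intros uc v)
  obtain s0 where s0: "s0 \<in> {0..R}" "\<And>s. s \<in> {0..R} \<Longrightarrow> D s \<le> D s0"
    using continuous_attains_sup[OF _ _ Dc] R by auto
  have D_bound: "\<bar>u s - v s\<bar> \<le> D s0 * exp (2 * M * s)" if "0 \<le> s" "s \<le> R" for s
  proof -
    have "D s * exp (2 * M * s) \<le> D s0 * exp (2 * M * s)" using s0(2)[of s] that by (intro mult_right_mono) auto
    moreover have "D s * exp (2 * M * s) = \<bar>u s - v s\<bar>" by (simp add: D_def exp_minus)
    ultimately show ?thesis by simp
  qed
  have s0R: "0 \<le> s0" "s0 \<le> R" using s0(1) by auto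
  have D0: "D s0 \<ge> 0" by (simp add: D_def)
  have e0: "e \<ge> 0" using v_eq[of 0] R by linarith
  have "\<bar>u s0 - v s0\<bar> \<le> \<bar>u0 - v0\<bar> + e + \<bar>integral {0..s0} (K u) - integral {0..s0} (K v)\<bar>"
  proof -
    have "u s0 = u0 - integral {0..s0} (K u)" using u s0R by (simp add: solves_def)
    then show ?thesis using v_eq[OF s0R] by linarith
  qed
  also have "\<dots> \<le> \<bar>u0 - v0\<bar> + e + D s0 / 2 * exp (2 * M * s0)"
    using integral_weighted[OF uc v s0R D0 D_bound] by simp
  finally have "exp (- 2 * M * s0) * \<bar>u s0 - v s0\<bar> \<le>
      exp (- 2 * M * s0) * (\<bar>u0 - v0\<bar> + e + D s0 / 2 * exp (2 * M * s0))"
    by (intro mult_left_mono) auto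
  also have "\<dots> = exp (- 2 * M * s0) * (\<bar>u0 - v0\<bar> + e) + D s0 / 2"
    by (simp add: distrib_left exp_minus)
  finally have "D s0 \<le> exp (- 2 * M * s0) * (\<bar>u0 - v0\<bar> + e) + D s0 / 2"
    unfolding D_def .
  also have "exp (- 2 * M * s0) * (\<bar>u0 - v0\<bar> + e) \<le> 1 * (\<bar>u0 - v0\<bar> + e)"
    using s0R M e0 by (intro mult_right_mono) auto
  finally have "D s0 \<le> 2 * (\<bar>u0 - v0\<bar> + e)" by simp
  then have "D s0 * exp (2 * M * x) \<le> 2 * (\<bar>u0 - v0\<bar> + e) * exp (2 * M * x)"
    by (intro mult_right_mono) auto
  with D_bound[OF x] show ?thesis by (rule order_trans)
qed

end

subsection \<open>The truncated shooting problem\<close>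

text \<open>Truncation makes the nonlinearities globally Lipschitz.  Solutions starting below one decrease
  while they are positive, so only the truncation at zero is felt.\<close>

definition trunc :: "real \<Rightarrow> real" where "trunc y = max 0 (min 1 y)"

lemma trunc_bounds: "0 \<le> trunc y" "trunc y \<le> 1"
  by (auto simp: trunc_def)

lemma trunc_lipschitz: "\<bar>trunc x - trunc y\<bar> \<le> \<bar>x - y\<bar>"
  by (auto simp: trunc_def)

lemma powr_lipschitz:
  fixes x y r :: real
  assumes x: "0 \<le> x" "x \<le> 1" and y: "0 \<le> y" "y \<le> 1" and r: "r \<ge> 1"
  shows "\<bar>x powr r - y powr r\<bar> \<le> r * \<bar>x - y\<bar>"
proof -
  have main: "y powr r - x powr r \<le> r * (y - x)" if xy: "0 \<le> x" "x < y" "y \<le> 1" for x y :: real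
  proof -
    have "continuous_on {x..y} (\<lambda>t. t powr r)"
      using xy r by (intro continuous_on_powr' continuous_intros) auto
    moreover have d: "((\<lambda>t. t powr r) has_real_derivative r * z powr (r - 1)) (at z)" if "x < z" for z
      using DERIV_fun_powr[OF DERIV_ident, of z r] that xy by simp
    ultimately obtain l z where z: "x < z" "z < y" "((\<lambda>t. t powr r) has_real_derivative l) (at z)"
      "y powr r - x powr r = (y - x) * l"
      using MVT[of x y "\<lambda>t. t powr r"] xy by (auto simp: real_differentiable_def)
    have "l = r * z powr (r - 1)" using DERIV_unique[OF z(3) d[OF z(1)]] .
    also have "\<dots> \<le> r * 1" using z xy r powr_le1[of "r - 1" z] by (intro mult_left_mono) auto
    finally have "(y - x) * l \<le> (y - x) * r" using xy by (intro mult_left_mono) auto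
    then show ?thesis using z by (simp add: mult.commute)
  qed
  have mono: "u powr r \<le> v powr r" if "0 \<le> u" "u \<le> v" for u v :: real
    using that r by (intro powr_mono2) auto
  consider "x < y" | "x = y" | "y < x" by linarith
  then show ?thesis
  proof cases
    case 1 then show ?thesis using main[of x y] mono[of x y] x y by (simp add: abs_if)
  next
    case 3 then show ?thesis using main[of y x] mono[of y x] x y by (simp add: abs_if)
  qed simp
qed

text \<open>The derivative in the exponent is x^t ln x, bounded by x |ln x| \<le> 1 for t \<ge> 1.
  This controls the dependence on p uniformly down to x = 0.\<close>

lemma powr_exponent_lipschitz:
  fixes x r s :: real
  assumes x: "0 \<le> x" "x \<le> 1" and r: "r \<ge> 1" "s \<ge> 1"
  shows "\<bar>x powr r - x powr s\<bar> \<le> \<bar>r - s\<bar>"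
proof (cases "x = 0")
  case False
  then have x0: "x > 0" using x by simp
  have "x * \<bar>ln x\<bar> \<le> 1"
  proof -
    have "- ln x \<le> 1 / x - 1" using ln_le_minus_one[of "1 / x"] x0 by (simp add: ln_div)
    then have "x * (- ln x) \<le> x * (1 / x - 1)" using x0 by (intro mult_left_mono) auto
    also have "\<dots> = 1 - x" using x0 by (simp add: field_simps)
    finally show ?thesis using x0 x by (simp add: abs_if)
  qed
  moreover have "x powr t \<le> x" if "t \<ge> 1" for t
    using powr_mono'[of 1 t x] that x0 x by simp
  ultimately have bound: "\<bar>x powr t * ln x\<bar> \<le> 1" if "t \<ge> 1" for t
    using that x0 by (simp add: abs_mult) (meson abs_ge_zero mult_right_mono order_trans)
  have "norm (x powr r - x powr s) \<le> 1 * norm (r - s)"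
  proof (rule field_differentiable_bound[of "{1..}" "\<lambda>t. x powr t" "\<lambda>t. x powr t * ln x"])
    fix t :: real assume "t \<in> {1..}"
    have "((\<lambda>t. exp (t * ln x)) has_real_derivative exp (t * ln x) * ln x) (at t within {1..})"
      by (auto intro!: derivative_eq_intros)
    then show "((\<lambda>t. x powr t) has_real_derivative x powr t * ln x) (at t within {1..})"
      using x0 by (simp add: powr_def)
    show "norm (x powr t * ln x) \<le> 1" using bound \<open>t \<in> {1..}\<close> by simp
  qed (use r in auto)
  then show ?thesis by simp
qed simp

text \<open>p is not fixed here because the shooting problem will be perturbed in all its
  parameters, p included.\<close>

locale shooting_data =
  fixes N :: nat and m \<sigma> :: real
  assumes N: "N \<ge> 1" and m: "0 < m" "m < 1" and \<sigma>: "\<sigma> > 0"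
begin

text \<open>The solution g of g' + (N - 1) g / t = h that is regular at 0, where it
  vanishes.\<close>

definition avg :: "(real \<Rightarrow> real) \<Rightarrow> real \<Rightarrow> real" where
  "avg h t = integral {0..t} (\<lambda>s. s ^ (N - 1) * h s) / t ^ (N - 1)"

lemma avg_0: "avg h 0 = 0"
  by (simp add: avg_def)

lemma avg_bound:
  assumes h: "continuous_on {0..t} h" and t: "t \<ge> 0" and B: "\<And>s. 0 \<le> s \<Longrightarrow> s \<le> t \<Longrightarrow> \<bar>h s\<bar> \<le> B"
  shows "\<bar>avg h t\<bar> \<le> t * B"
proof (cases "t = 0")
  case False
  then have t0: "t > 0" using t by simp
  have "norm (integral {0..t} (\<lambda>s. s ^ (N - 1) * h s)) \<le> t ^ (N - 1) * B * (t - 0)"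
  proof (rule integral_bound[OF t])
    show "continuous_on {0..t} (\<lambda>s. s ^ (N - 1) * h s)" by (intro continuous_intros h)
    fix s assume s: "s \<in> {0..t}"
    have "s ^ (N - 1) * \<bar>h s\<bar> \<le> t ^ (N - 1) * B"
      using s B[of s] t by (intro mult_mono power_mono) auto
    then show "norm (s ^ (N - 1) * h s) \<le> t ^ (N - 1) * B" using s by (simp add: abs_mult)
  qed
  then show ?thesis using t0 by (simp add: avg_def abs_divide pos_divide_le_eq mult_ac)
qed (simp add: avg_0)

lemma avg_diff:
  assumes "continuous_on {0..t} g" "continuous_on {0..t} h"
  shows "avg g t - avg h t = avg (\<lambda>s. g s - h s) t"
proof -
  have "integral {0..t} (\<lambda>s. s ^ (N - 1) * (g s - h s)) =
      integral {0..t} (\<lambda>s. s ^ (N - 1) * g s) - integral {0..t} (\<lambda>s. s ^ (N - 1) * h s)"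
    unfolding right_diff_distrib
    by (intro integral_diff integrable_continuous_real continuous_intros assms)
  then show ?thesis by (simp add: avg_def diff_divide_distrib)
qed

lemma avg_deriv:
  assumes h: "\<And>b. continuous_on {0..b} h" and x: "x > 0"
  shows "(avg h has_real_derivative h x - (real N - 1) / x * avg h x) (at x)"
proof -
  have c: "continuous_on {0..x + 1} (\<lambda>s. s ^ (N - 1) * h s)" by (intro continuous_intros h)
  have "((\<lambda>t. integral {0..t} (\<lambda>s. s ^ (N - 1) * h s)) has_real_derivative x ^ (N - 1) * h x) (at x within {0..x + 1})"
    by (rule integral_has_real_derivative[OF c]) (use x in auto)
  then have 1: "((\<lambda>t. integral {0..t} (\<lambda>s. s ^ (N - 1) * h s)) has_real_derivative x ^ (N - 1) * h x) (at x)"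
    using at_within_Icc_at[of 0 x "x + 1"] x by simp
  obtain n where n: "N = Suc n" using N by (metis Suc_le_D One_nat_def)
  have 2: "((\<lambda>x. x ^ (N - 1)) has_real_derivative (real N - 1) / x * x ^ (N - 1)) (at x)"
    by (rule DERIV_cong[OF DERIV_pow]) (cases n; use x n in simp)
  have ne: "x ^ (N - 1) \<noteq> 0" using x by simp
  have alg: "(P * y * P - i * (k * P)) / (P * P) = y - k * (i / P)" if "P \<noteq> 0" for P y i k :: real
    using that by (simp add: field_simps)
  show ?thesis
    unfolding avg_def[abs_def] by (rule DERIV_cong[OF DERIV_divide[OF 1 2 ne] alg[OF ne]])
qed

lemma avg_cont:
  assumes h: "continuous_on {0..R} h" and R: "R \<ge> 0"
  shows "continuous_on {0..R} (avg h)"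
  unfolding continuous_on_eq_continuous_within
proof
  fix t assume t: "t \<in> {0..R}"
  obtain B where B: "\<And>s. s \<in> {0..R} \<Longrightarrow> \<bar>h s\<bar> \<le> B"
    using compact_imp_bounded[OF compact_continuous_image[OF h compact_Icc]]
    unfolding bounded_iff real_norm_def by blast
  have bnd: "\<bar>avg h s\<bar> \<le> s * B" if "s \<in> {0..R}" for s
    using that B by (intro avg_bound continuous_on_subset[OF h]) auto
  show "continuous (at t within {0..R}) (avg h)"
  proof (cases "t = 0")
    case True
    have "((\<lambda>s. s * B) \<longlongrightarrow> 0 * B) (at 0 within {0..R})" by (intro tendsto_intros)
    then have "(avg h \<longlongrightarrow> 0) (at 0 within {0..R})"
      by (intro Lim_null_comparison[of "avg h" "\<lambda>s. s * B"]) (auto simp: eventually_at_filter bnd)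
    then show ?thesis by (simp add: True continuous_within avg_0)
  next
    case False
    have "continuous_on {0..R} (\<lambda>t. integral {0..t} (\<lambda>s. s ^ (N - 1) * h s))"
      by (intro indefinite_integral_continuous_1 integrable_continuous_real continuous_intros h)
    then have "continuous (at t within {0..R}) (\<lambda>t. integral {0..t} (\<lambda>s. s ^ (N - 1) * h s))"
      using t by (simp add: continuous_on_eq_continuous_within)
    then show ?thesis
      unfolding avg_def[abs_def] using False t by (intro continuous_intros) auto
  qed
qed

text \<open>The radial equation integrated once: \<gamma> stands for \<alpha> - N \<beta>, and a
  solution satisfies u' = - \<open>ker\<close>. The drift enters through u^(1/m) without u', which
  keeps the kernel Lipschitz.\<close>

definition rhs :: "real \<Rightarrow> real \<Rightarrow> (real \<Rightarrow> real) \<Rightarrow> real \<Rightarrow> real" where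
  "rhs \<gamma> p u s = \<gamma> * trunc (u s) powr (1 / m) + s powr \<sigma> * trunc (u s) powr (p / m)"

definition ker :: "real \<Rightarrow> real \<Rightarrow> real \<Rightarrow> (real \<Rightarrow> real) \<Rightarrow> real \<Rightarrow> real" where
  "ker \<beta> \<gamma> p u t = \<beta> * t * trunc (u t) powr (1 / m) + avg (rhs \<gamma> p u) t"

lemma trunc_powr_cont:
  "continuous_on S u \<Longrightarrow> r > 0 \<Longrightarrow> continuous_on S (\<lambda>s. trunc (u s) powr r)"
  unfolding trunc_def by (intro continuous_on_powr' continuous_intros) auto

lemma rhs_cont:
  assumes u: "continuous_on {0..R} u" and p: "p > 1"
  shows "continuous_on {0..R} (rhs \<gamma> p u)"
  unfolding rhs_def
proof (intro continuous_on_add continuous_on_mult continuous_on_const trunc_powr_cont u)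
  show "continuous_on {0..R} (\<lambda>s. s powr \<sigma>)"
    using \<sigma> by (intro continuous_on_powr' continuous_intros) auto
qed (use m p in auto)

lemma ker_cont:
  assumes u: "continuous_on {0..R} u" and p: "p > 1" and R: "R \<ge> 0"
  shows "continuous_on {0..R} (ker \<beta> \<gamma> p u)"
  unfolding ker_def using m
  by (intro continuous_on_add continuous_on_mult continuous_on_const continuous_on_id trunc_powr_cont u
      avg_cont rhs_cont p R) auto

lemma trunc_powr_lipschitz:
  "r \<ge> 1 \<Longrightarrow> \<bar>trunc x powr r - trunc y powr r\<bar> \<le> r * \<bar>x - y\<bar>"
  using powr_lipschitz[of "trunc x" "trunc y" r] trunc_lipschitz[of x y] trunc_bounds
  by (meson dual_order.trans mult_left_mono order.trans zero_le_one)

lemma trunc_powr_le: "r \<ge> 0 \<Longrightarrow> trunc x powr r \<le> 1"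
  using trunc_bounds by (intro powr_le1) auto

lemma m1: "1 / m \<ge> 1" "p > 1 \<Longrightarrow> p / m \<ge> 1"
  using m by auto

lemma ker_lipschitz:
  assumes u: "continuous_on {0..R} u" and v: "continuous_on {0..R} v" and p: "p > 1" and \<beta>: "\<beta> \<ge> 0"
    and t: "0 \<le> t" "t \<le> R" and B: "\<And>s. 0 \<le> s \<Longrightarrow> s \<le> t \<Longrightarrow> \<bar>u s - v s\<bar> \<le> B"
  shows "\<bar>ker \<beta> \<gamma> p u t - ker \<beta> \<gamma> p v t\<bar> \<le> (R * (\<beta> + \<bar>\<gamma>\<bar> + R powr \<sigma> * p) / m + 1) * B"
proof -
  have B0: "B \<ge> 0" using B[of t] t by auto
  have p1: "p \<ge> 0" using p by simp
  have tr: "\<bar>trunc (u s) powr r - trunc (v s) powr r\<bar> \<le> r * B" if "r \<ge> 1" "0 \<le> s" "s \<le> t" for r s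
  proof -
    have "r * \<bar>u s - v s\<bar> \<le> r * B" using B[of s] that by (intro mult_left_mono) auto
    from order_trans[OF trunc_powr_lipschitz[OF that(1)] this] show ?thesis .
  qed
  have cu: "continuous_on {0..t} (rhs \<gamma> p u)" "continuous_on {0..t} (rhs \<gamma> p v)"
    using u v t by (auto intro!: rhs_cont p intro: continuous_on_subset)
  have rd: "\<bar>rhs \<gamma> p u s - rhs \<gamma> p v s\<bar> \<le> (\<bar>\<gamma>\<bar> + R powr \<sigma> * p) / m * B" if s: "0 \<le> s" "s \<le> t" for s
  proof -
    have "\<bar>\<gamma> * (trunc (u s) powr (1 / m) - trunc (v s) powr (1 / m))\<bar> \<le> \<bar>\<gamma>\<bar> * (1 / m * B)"
      unfolding abs_mult using tr[OF m1(1) s] by (intro mult_left_mono) auto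
    moreover have "\<bar>s powr \<sigma> * (trunc (u s) powr (p / m) - trunc (v s) powr (p / m))\<bar> \<le> R powr \<sigma> * (p / m * B)"
      unfolding abs_mult using tr[OF m1(2)[OF p] s] s t \<sigma> p m B0
      by (intro mult_mono) (auto intro!: powr_mono2)
    moreover have "rhs \<gamma> p u s - rhs \<gamma> p v s = \<gamma> * (trunc (u s) powr (1 / m) - trunc (v s) powr (1 / m))
        + s powr \<sigma> * (trunc (u s) powr (p / m) - trunc (v s) powr (p / m))"
      by (simp add: rhs_def algebra_simps)
    moreover have "(\<bar>\<gamma>\<bar> + R powr \<sigma> * p) / m * B = \<bar>\<gamma>\<bar> * (1 / m * B) + R powr \<sigma> * (p / m * B)"
      using m by (simp add: field_simps)
    ultimately show ?thesis by linarith
  qed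
  have 1: "\<bar>avg (rhs \<gamma> p u) t - avg (rhs \<gamma> p v) t\<bar> \<le> t * ((\<bar>\<gamma>\<bar> + R powr \<sigma> * p) / m * B)"
    unfolding avg_diff[OF cu] by (intro avg_bound continuous_on_diff cu t rd)
  have 2: "\<bar>\<beta> * t * (trunc (u t) powr (1 / m) - trunc (v t) powr (1 / m))\<bar> \<le> \<beta> * t * (1 / m * B)"
    unfolding abs_mult using tr[OF m1(1) t(1) order_refl] \<beta> t by (intro mult_mono) auto
  have "\<bar>ker \<beta> \<gamma> p u t - ker \<beta> \<gamma> p v t\<bar> \<le> \<beta> * t * (1 / m * B) + t * ((\<bar>\<gamma>\<bar> + R powr \<sigma> * p) / m * B)"
    using 1 2 unfolding ker_def right_diff_distrib by linarith
  also have "\<dots> = t * ((\<beta> + \<bar>\<gamma>\<bar> + R powr \<sigma> * p) / m * B)" using m by (simp add: field_simps)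
  also have "\<dots> \<le> R * ((\<beta> + \<bar>\<gamma>\<bar> + R powr \<sigma> * p) / m * B)"
    using t B0 \<beta> p1 m by (intro mult_right_mono mult_nonneg_nonneg divide_nonneg_pos add_nonneg_nonneg) auto
  also have "\<dots> \<le> (R * (\<beta> + \<bar>\<gamma>\<bar> + R powr \<sigma> * p) / m + 1) * B"
    using B0 by (simp add: algebra_simps)
  finally show ?thesis .
qed

lemma ker_parameters:
  assumes u: "continuous_on {0..R} u" and p: "p > 1" "p' > 1" and t: "0 \<le> t" "t \<le> R"
  shows "\<bar>ker \<beta> \<gamma> p u t - ker \<beta>' \<gamma>' p' u t\<bar> \<le> R * (\<bar>\<beta> - \<beta>'\<bar> + \<bar>\<gamma> - \<gamma>'\<bar> + R powr \<sigma> * (\<bar>p - p'\<bar> / m))"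
proof -
  have cu: "continuous_on {0..t} (rhs \<gamma> p u)" "continuous_on {0..t} (rhs \<gamma>' p' u)"
    using u t by (auto intro!: rhs_cont p intro: continuous_on_subset)
  have le1: "\<bar>trunc x powr (1 / m)\<bar> \<le> 1" for x using trunc_powr_le[of "1 / m"] m by simp
  have rd: "\<bar>rhs \<gamma> p u s - rhs \<gamma>' p' u s\<bar> \<le> \<bar>\<gamma> - \<gamma>'\<bar> + R powr \<sigma> * (\<bar>p - p'\<bar> / m)" if s: "0 \<le> s" "s \<le> t" for s
  proof -
    have "\<bar>(\<gamma> - \<gamma>') * trunc (u s) powr (1 / m)\<bar> \<le> \<bar>\<gamma> - \<gamma>'\<bar> * 1"
      unfolding abs_mult by (intro mult_left_mono le1) auto
    moreover have "\<bar>trunc (u s) powr (p / m) - trunc (u s) powr (p' / m)\<bar> \<le> \<bar>p / m - p' / m\<bar>"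
      by (intro powr_exponent_lipschitz trunc_bounds m1 p)
    then have "\<bar>trunc (u s) powr (p / m) - trunc (u s) powr (p' / m)\<bar> \<le> \<bar>p - p'\<bar> / m"
      using m by (simp flip: diff_divide_distrib)
    then have "\<bar>s powr \<sigma> * (trunc (u s) powr (p / m) - trunc (u s) powr (p' / m))\<bar> \<le> R powr \<sigma> * (\<bar>p - p'\<bar> / m)"
      unfolding abs_mult using s t \<sigma> by (intro mult_mono) (auto intro!: powr_mono2)
    moreover have "rhs \<gamma> p u s - rhs \<gamma>' p' u s = (\<gamma> - \<gamma>') * trunc (u s) powr (1 / m)
        + s powr \<sigma> * (trunc (u s) powr (p / m) - trunc (u s) powr (p' / m))"
      by (simp add: rhs_def algebra_simps)
    ultimately show ?thesis by (simp only: mult_1_right order_trans[OF abs_triangle_ineq add_mono])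
  qed
  have 1: "\<bar>avg (rhs \<gamma> p u) t - avg (rhs \<gamma>' p' u) t\<bar> \<le> t * (\<bar>\<gamma> - \<gamma>'\<bar> + R powr \<sigma> * (\<bar>p - p'\<bar> / m))"
    unfolding avg_diff[OF cu] by (intro avg_bound continuous_on_diff cu t rd)
  also have "\<dots> \<le> R * (\<bar>\<gamma> - \<gamma>'\<bar> + R powr \<sigma> * (\<bar>p - p'\<bar> / m))"
    using t m by (intro mult_right_mono add_nonneg_nonneg) auto
  finally have 1: "\<bar>avg (rhs \<gamma> p u) t - avg (rhs \<gamma>' p' u) t\<bar> \<le> R * (\<bar>\<gamma> - \<gamma>'\<bar> + R powr \<sigma> * (\<bar>p - p'\<bar> / m))" .
  have 2: "\<bar>(\<beta> - \<beta>') * t * trunc (u t) powr (1 / m)\<bar> \<le> \<bar>\<beta> - \<beta>'\<bar> * R * 1"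
    unfolding abs_mult using t le1 by (intro mult_mono) auto
  have "ker \<beta> \<gamma> p u t - ker \<beta>' \<gamma>' p' u t =
      (\<beta> - \<beta>') * t * trunc (u t) powr (1 / m) + (avg (rhs \<gamma> p u) t - avg (rhs \<gamma>' p' u) t)"
    by (simp add: ker_def algebra_simps)
  then show ?thesis using 1 2 by (simp add: algebra_simps) 
qed

end

section \<open>The shooting map and its dependence on parameters\<close>

context shooting_data begin

text \<open>The summand 1 keeps the Lipschitz constant positive also for R = 0, as
  \<open>volterra\<close> demands.\<close>

definition lip :: "real \<Rightarrow> real \<Rightarrow> real \<Rightarrow> real \<Rightarrow> real" where
  "lip \<beta> \<gamma> p R = R * (\<beta> + \<bar>\<gamma>\<bar> + R powr \<sigma> * p) / m + 1"

lemma lip_pos: "\<beta> \<ge> 0 \<Longrightarrow> p > 1 \<Longrightarrow> R \<ge> 0 \<Longrightarrow> lip \<beta> \<gamma> p R > 0"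
  unfolding lip_def using m by (intro add_nonneg_pos divide_nonneg_pos mult_nonneg_nonneg add_nonneg_nonneg) auto

lemma ker_volterra:
  "\<beta> \<ge> 0 \<Longrightarrow> p > 1 \<Longrightarrow> R \<ge> 0 \<Longrightarrow> volterra (ker \<beta> \<gamma> p) R (lip \<beta> \<gamma> p R)"
  by unfold_locales (use lip_pos ker_cont ker_lipschitz in \<open>auto simp: lip_def\<close>)

text \<open>By uniqueness the solutions on different intervals are compatible.\<close>

definition sol :: "real \<Rightarrow> real \<Rightarrow> real \<Rightarrow> real \<Rightarrow> real \<Rightarrow> real" where
  "sol \<beta> \<gamma> p u0 x = (SOME u. volterra.solves (ker \<beta> \<gamma> p) x u0 u) x"

definition sol1 :: "real \<Rightarrow> real \<Rightarrow> real \<Rightarrow> real \<Rightarrow> real \<Rightarrow> real" where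
  "sol1 \<beta> \<gamma> p u0 x = - ker \<beta> \<gamma> p (sol \<beta> \<gamma> p u0) x"

lemma sol_solves:
  assumes \<beta>: "\<beta> \<ge> 0" and p: "p > 1" and R: "R \<ge> 0"
  shows "volterra.solves (ker \<beta> \<gamma> p) R u0 (sol \<beta> \<gamma> p u0)"
proof -
  interpret V: volterra "ker \<beta> \<gamma> p" R "lip \<beta> \<gamma> p R" by (rule ker_volterra[OF \<beta> p R])
  obtain u where u: "V.solves u0 u" using V.exists_solution by blast
  have uc: "continuous_on {0..R} u" using u by (simp add: V.solves_def)
  have eq: "sol \<beta> \<gamma> p u0 x = u x" if x: "0 \<le> x" "x \<le> R" for x
  proof -
    interpret X: volterra "ker \<beta> \<gamma> p" x "lip \<beta> \<gamma> p x" by (rule ker_volterra[OF \<beta> p x(1)])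
    define v where "v = (SOME u. X.solves u0 u)"
    have v: "X.solves u0 v" unfolding v_def by (rule someI_ex[OF X.exists_solution])
    have "\<bar>v x - u x\<bar> \<le> 2 * (\<bar>u0 - u0\<bar> + 0) * exp (2 * lip \<beta> \<gamma> p x * x)"
    proof (rule X.comparison[OF v])
      show "continuous_on {0..x} u" using uc x by (auto intro: continuous_on_subset)
      show "\<bar>u y - (u0 - integral {0..y} (ker \<beta> \<gamma> p u))\<bar> \<le> 0" if "0 \<le> y" "y \<le> x" for y
        using u that x by (simp add: V.solves_def)
    qed (use x in auto)
    then show ?thesis by (simp add: sol_def v_def)
  qed
  have sc: "continuous_on {0..R} (sol \<beta> \<gamma> p u0)"
    using uc eq by (subst continuous_on_cong[OF refl, of _ _ u]) auto
  \<comment> \<open>The Lipschitz estimate with bound 0: functions equal up to t have equal kernels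
    at t.\<close>
  have ker_eq: "ker \<beta> \<gamma> p (sol \<beta> \<gamma> p u0) t = ker \<beta> \<gamma> p u t" if "0 \<le> t" "t \<le> R" for t
    using V.K_lip[OF sc uc that, of 0] eq that by simp
  have "sol \<beta> \<gamma> p u0 x = u0 - integral {0..x} (ker \<beta> \<gamma> p (sol \<beta> \<gamma> p u0))" if x: "0 \<le> x" "x \<le> R" for x
  proof -
    have "integral {0..x} (ker \<beta> \<gamma> p (sol \<beta> \<gamma> p u0)) = integral {0..x} (ker \<beta> \<gamma> p u)"
      by (intro integral_cong ker_eq) (use x in auto)
    then show ?thesis using eq[OF x] u x by (simp add: V.solves_def)
  qed
  then show ?thesis using sc by (simp add: V.solves_def)
qed

context
  fixes \<beta> \<gamma> p u0 :: real
  assumes \<beta>: "\<beta> \<ge> 0" and p: "p > 1"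
begin

lemma sol_cont: "continuous_on {0..R} (sol \<beta> \<gamma> p u0)"
  using sol_solves[OF \<beta> p, of R \<gamma> u0] volterra.solves_def[OF ker_volterra[OF \<beta> p, of R \<gamma>]]
  by (cases "R \<ge> 0") auto

lemma sol_eq: "x \<ge> 0 \<Longrightarrow> sol \<beta> \<gamma> p u0 x = u0 - integral {0..x} (ker \<beta> \<gamma> p (sol \<beta> \<gamma> p u0))"
  using sol_solves[OF \<beta> p, of x \<gamma> u0] volterra.solves_def[OF ker_volterra[OF \<beta> p, of x \<gamma>]] by auto

lemma sol_0: "sol \<beta> \<gamma> p u0 0 = u0"
  using sol_eq[of 0] by simp

lemma sol_ker_cont: "continuous_on {0..R} (ker \<beta> \<gamma> p (sol \<beta> \<gamma> p u0))"
  using ker_cont[OF sol_cont p] by (cases "R \<ge> 0") auto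

lemma sol1_cont: "continuous_on {0..R} (sol1 \<beta> \<gamma> p u0)"
  unfolding sol1_def[abs_def] by (intro continuous_intros sol_ker_cont)

lemma sol_deriv:
  assumes x: "x > 0"
  shows "(sol \<beta> \<gamma> p u0 has_real_derivative sol1 \<beta> \<gamma> p u0 x) (at x)"
proof -
  have "((\<lambda>x. integral {0..x} (ker \<beta> \<gamma> p (sol \<beta> \<gamma> p u0))) has_real_derivative
      ker \<beta> \<gamma> p (sol \<beta> \<gamma> p u0) x) (at x within {0..x + 1})"
    by (rule integral_has_real_derivative[OF sol_ker_cont]) (use x in auto)
  then have "((\<lambda>x. integral {0..x} (ker \<beta> \<gamma> p (sol \<beta> \<gamma> p u0))) has_real_derivative
      ker \<beta> \<gamma> p (sol \<beta> \<gamma> p u0) x) (at x)"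
    using at_within_Icc_at[of 0 x "x + 1"] x by simp
  from DERIV_diff[OF DERIV_const[of u0] this]
  have "((\<lambda>x. u0 - integral {0..x} (ker \<beta> \<gamma> p (sol \<beta> \<gamma> p u0))) has_real_derivative sol1 \<beta> \<gamma> p u0 x) (at x)"
    by (simp add: sol1_def)
  then show ?thesis
    by (rule has_field_derivative_transform_within_open[of _ _ _ "{0<..}"])
      (use x sol_eq in \<open>auto simp del: sol_def\<close>)
qed

text \<open>Truncated powers are at most one and averaging gains a factor x. This yields the regular
  start, u'(x) = O(x).\<close>

lemma sol1_bound:
  assumes x: "x \<ge> 0"
  shows "\<bar>sol1 \<beta> \<gamma> p u0 x\<bar> \<le> x * (\<beta> + \<bar>\<gamma>\<bar> + x powr \<sigma>)"
proof -
  have le1: "\<bar>trunc y powr r\<bar> \<le> 1" if "r \<ge> 0" for y r using trunc_powr_le[OF that] by simp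
  have r: "1 / m \<ge> 0" "p / m \<ge> 0" using m p by auto
  have "\<bar>avg (rhs \<gamma> p (sol \<beta> \<gamma> p u0)) x\<bar> \<le> x * (\<bar>\<gamma>\<bar> + x powr \<sigma>)"
  proof (rule avg_bound[OF rhs_cont[OF sol_cont p] x])
    fix s assume s: "0 \<le> s" "s \<le> x"
    have "\<bar>\<gamma> * trunc (sol \<beta> \<gamma> p u0 s) powr (1 / m)\<bar> \<le> \<bar>\<gamma>\<bar> * 1"
      unfolding abs_mult by (intro mult_left_mono le1 r) auto
    moreover have "\<bar>s powr \<sigma> * trunc (sol \<beta> \<gamma> p u0 s) powr (p / m)\<bar> \<le> x powr \<sigma> * 1"
      unfolding abs_mult using s \<sigma> by (intro mult_mono le1 r) (auto intro!: powr_mono2)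
    ultimately show "\<bar>rhs \<gamma> p (sol \<beta> \<gamma> p u0) s\<bar> \<le> \<bar>\<gamma>\<bar> + x powr \<sigma>" unfolding rhs_def by linarith
  qed
  moreover have "\<bar>\<beta> * x * trunc (sol \<beta> \<gamma> p u0 x) powr (1 / m)\<bar> \<le> \<beta> * x * 1"
    unfolding abs_mult[of "\<beta> * x"] using \<beta> x by (intro mult_mono le1 r) auto
  ultimately have "\<bar>ker \<beta> \<gamma> p (sol \<beta> \<gamma> p u0) x\<bar> \<le> \<beta> * x + x * (\<bar>\<gamma>\<bar> + x powr \<sigma>)"
    unfolding ker_def by linarith
  then show ?thesis by (simp add: sol1_def algebra_simps)
qed

lemma sol_flat: "((\<lambda>x. (sol \<beta> \<gamma> p u0 x - u0) / x) \<longlongrightarrow> 0) (at_right 0)"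
proof (rule Lim_null_comparison)
  show "((\<lambda>x::real. x * (\<beta> + \<bar>\<gamma>\<bar> + 1)) \<longlongrightarrow> 0) (at_right 0)"
    using tendsto_mult_left_zero[OF tendsto_ident_at] by auto
  show "eventually (\<lambda>x. norm ((sol \<beta> \<gamma> p u0 x - u0) / x) \<le> x * (\<beta> + \<bar>\<gamma>\<bar> + 1)) (at_right 0)"
  proof (rule eventually_at_rightI[of 0 1])
    fix x :: real assume x: "x \<in> {0<..<1}"
    have "norm (integral {0..x} (ker \<beta> \<gamma> p (sol \<beta> \<gamma> p u0))) \<le> (x * (\<beta> + \<bar>\<gamma>\<bar> + 1)) * (x - 0)"
    proof (rule integral_bound[OF _ sol_ker_cont])
      fix t assume t: "t \<in> {0..x}"
      have "\<bar>sol1 \<beta> \<gamma> p u0 t\<bar> \<le> t * (\<beta> + \<bar>\<gamma>\<bar> + t powr \<sigma>)" using t by (intro sol1_bound) auto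
      also have "\<dots> \<le> x * (\<beta> + \<bar>\<gamma>\<bar> + 1)"
        using t x \<beta> \<sigma> by (intro mult_mono add_mono powr_le1 add_nonneg_nonneg) auto
      finally show "norm (ker \<beta> \<gamma> p (sol \<beta> \<gamma> p u0) t) \<le> x * (\<beta> + \<bar>\<gamma>\<bar> + 1)" by (simp add: sol1_def)
    qed (use x in auto)
    moreover have "\<bar>sol \<beta> \<gamma> p u0 x - u0\<bar> = \<bar>integral {0..x} (ker \<beta> \<gamma> p (sol \<beta> \<gamma> p u0))\<bar>"
      using sol_eq[of x] x by simp
    ultimately show "norm ((sol \<beta> \<gamma> p u0 x - u0) / x) \<le> x * (\<beta> + \<bar>\<gamma>\<bar> + 1)"
      using x by (simp add: abs_divide pos_divide_le_eq)
  qed auto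
qed

lemma sol_lim: "(sol \<beta> \<gamma> p u0 \<longlongrightarrow> u0) (at_right 0)"
proof -
  have "(sol \<beta> \<gamma> p u0 \<longlongrightarrow> sol \<beta> \<gamma> p u0 0) (at 0 within {0..1})"
    using sol_cont[of 1] by (simp add: continuous_on_def)
  then show ?thesis by (simp add: at_within_Icc_at_right sol_0)
qed

text \<open>Near a point with value strictly between 0 and 1 the truncation is the identity, so the
  integrated equation can be differentiated back; \<gamma> + N \<beta> will be \<alpha>.\<close>

lemma sol1_deriv:
  assumes x: "x > 0" and pos: "0 < sol \<beta> \<gamma> p u0 x" "sol \<beta> \<gamma> p u0 x < 1"
  shows "(sol1 \<beta> \<gamma> p u0 has_real_derivative
      - ((real N - 1) / x * sol1 \<beta> \<gamma> p u0 x) - (\<gamma> + real N * \<beta>) * sol \<beta> \<gamma> p u0 x powr (1 / m)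
      - \<beta> * x * (sol \<beta> \<gamma> p u0 x powr (1 / m - 1) * sol1 \<beta> \<gamma> p u0 x / m)
      - x powr \<sigma> * sol \<beta> \<gamma> p u0 x powr (p / m)) (at x)"
proof -
  define w where "w = sol \<beta> \<gamma> p u0"
  define w1 where "w1 = sol1 \<beta> \<gamma> p u0"
  have wd: "(w has_real_derivative w1 x) (at x)" unfolding w_def w1_def by (rule sol_deriv[OF x])
  have wx: "0 < w x" "w x < 1" using pos by (auto simp: w_def)
  have ev: "eventually (\<lambda>y. 0 < w y \<and> w y < 1) (nhds x)"
    using DERIV_isCont[OF wd] wx unfolding isCont_def tendsto_at_iff_tendsto_nhds
    by (auto intro!: eventually_conj elim: order_tendstoD)
  have "((\<lambda>y. w y powr (1 / m)) has_real_derivative 1 / m * w x powr (1 / m - of_nat 1) * w1 x) (at x)"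
    by (rule DERIV_fun_powr[OF wd wx(1)])
  then have fd: "((\<lambda>y. trunc (w y) powr (1 / m)) has_real_derivative 1 / m * w x powr (1 / m - of_nat 1) * w1 x) (at x)"
    by (rule DERIV_cong_ev[THEN iffD1, rotated -1])
      (use ev in \<open>auto elim!: eventually_mono simp: trunc_def\<close>)
  have bd: "((\<lambda>y. \<beta> * y) has_real_derivative \<beta>) (at x)" by (auto intro!: derivative_eq_intros)
  have ad: "(avg (rhs \<gamma> p w) has_real_derivative rhs \<gamma> p w x - (real N - 1) / x * avg (rhs \<gamma> p w) x) (at x)"
    unfolding w_def by (rule avg_deriv[OF rhs_cont[OF sol_cont p] x])
  have w1_eq: "w1 = (\<lambda>y. - (\<beta> * y * trunc (w y) powr (1 / m) + avg (rhs \<gamma> p w) y))"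
    by (simp add: w1_def w_def sol1_def[abs_def] ker_def)
  have tr: "trunc (w x) = w x" using wx by (simp add: trunc_def)
  have avg_eq: "avg (rhs \<gamma> p w) x = - w1 x - \<beta> * x * w x powr (1 / m)"
    unfolding w1_eq tr by simp
  define D where "D = - (\<beta> * w x powr (1 / m) + 1 / m * w x powr (1 / m - 1) * w1 x * (\<beta> * x)
      + (rhs \<gamma> p w x - (real N - 1) / x * avg (rhs \<gamma> p w) x))"
  have "((\<lambda>y. - (\<beta> * y * trunc (w y) powr (1 / m) + avg (rhs \<gamma> p w) y)) has_real_derivative D) (at x)"
    by (rule DERIV_cong[OF DERIV_minus[OF DERIV_add[OF DERIV_mult[OF bd fd] ad]]]) (simp add: D_def tr)
  then have "(w1 has_real_derivative D) (at x)" by (subst w1_eq)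
  then show ?thesis
    unfolding w_def[symmetric] w1_def[symmetric]
    by (rule DERIV_cong) (use x in \<open>simp add: D_def avg_eq rhs_def tr field_simps\<close>)
qed

text \<open>The perturbed solution solves the unperturbed equation up to the difference of the
  kernels, so \<open>comparison\<close> applies. The derivatives are close because they are, up to
  sign, the kernels themselves.\<close>

lemma sol_dependence:
  assumes R: "R \<ge> 0" and e: "e > 0"
  shows "\<exists>d>0. \<forall>\<beta>' \<gamma>' p' u0'. \<beta>' \<ge> 0 \<and> p' > 1 \<and> \<bar>\<beta> - \<beta>'\<bar> < d \<and> \<bar>\<gamma> - \<gamma>'\<bar> < d \<and> \<bar>p - p'\<bar> < d \<and> \<bar>u0 - u0'\<bar> < d \<longrightarrow>
    (\<forall>x\<in>{0..R}. \<bar>sol \<beta> \<gamma> p u0 x - sol \<beta>' \<gamma>' p' u0' x\<bar> < e \<and> \<bar>sol1 \<beta> \<gamma> p u0 x - sol1 \<beta>' \<gamma>' p' u0' x\<bar> < e)"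
proof -
  interpret V: volterra "ker \<beta> \<gamma> p" R "lip \<beta> \<gamma> p R" by (rule ker_volterra[OF \<beta> p R])
  define M where "M = lip \<beta> \<gamma> p R"
  define r where "r = R * (2 + R powr \<sigma> / m)"
  define C where "C = 2 * (1 + R * r) * exp (2 * M * R)"
  have M: "M > 0" using V.M by (simp add: M_def)
  have r: "r \<ge> 0" using R m by (auto simp: r_def intro!: mult_nonneg_nonneg add_nonneg_nonneg)
  have C: "C > 0" using R r by (auto simp: C_def intro!: mult_pos_pos add_pos_nonneg)
  \<comment> \<open>The denominator collects the bound C d for the values, (M C + r) d for the
    derivatives, and 1 for strictness.\<close>
  define d where "d = e / (C + M * C + r + 1)"
  have den: "C + M * C + r + 1 > 0" using C M r by (auto intro!: add_pos_nonneg add_nonneg_pos)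
  have d: "d > 0" using e den by (simp add: d_def)
  have d_eq: "(C + M * C + r + 1) * d = e" using den by (simp add: d_def)
  show ?thesis
  proof (intro exI[of _ d] conjI d allI impI ballI)
    fix \<beta>' \<gamma>' p' u0' x
    assume as: "\<beta>' \<ge> 0 \<and> p' > 1 \<and> \<bar>\<beta> - \<beta>'\<bar> < d \<and> \<bar>\<gamma> - \<gamma>'\<bar> < d \<and> \<bar>p - p'\<bar> < d \<and> \<bar>u0 - u0'\<bar> < d"
      and x: "x \<in> {0..R}"
    define v where "v = sol \<beta>' \<gamma>' p' u0'"
    interpret V': volterra "ker \<beta>' \<gamma>' p'" R "lip \<beta>' \<gamma>' p' R" by (rule ker_volterra) (use as R in auto)
    have v: "V'.solves u0' v" unfolding v_def by (rule sol_solves) (use as R in auto)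
    then have vc: "continuous_on {0..R} v" by (simp add: V'.solves_def)
    have u: "V.solves u0 (sol \<beta> \<gamma> p u0)" by (rule sol_solves[OF \<beta> p R])
    have kd: "\<bar>ker \<beta> \<gamma> p v t - ker \<beta>' \<gamma>' p' v t\<bar> \<le> r * d" if t: "0 \<le> t" "t \<le> R" for t
    proof -
      have "\<bar>ker \<beta> \<gamma> p v t - ker \<beta>' \<gamma>' p' v t\<bar> \<le> R * (\<bar>\<beta> - \<beta>'\<bar> + \<bar>\<gamma> - \<gamma>'\<bar> + R powr \<sigma> * (\<bar>p - p'\<bar> / m))"
        by (rule ker_parameters[OF vc p _ t]) (use as in auto)
      also have "\<dots> \<le> R * (d + d + R powr \<sigma> * (d / m))"
        using as R m by (intro mult_left_mono add_mono divide_right_mono) auto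
      also have "\<dots> = r * d" by (simp add: r_def algebra_simps)
      finally show ?thesis .
    qed
    have uv: "\<bar>sol \<beta> \<gamma> p u0 y - v y\<bar> \<le> C * d" if y: "0 \<le> y" "y \<le> R" for y
    proof -
      have "\<bar>sol \<beta> \<gamma> p u0 y - v y\<bar> \<le> 2 * (\<bar>u0 - u0'\<bar> + R * (r * d)) * exp (2 * M * y)"
        unfolding M_def
      proof (rule V.comparison[OF u vc _ y])
        fix z assume z: "0 \<le> z" "z \<le> R"
        have c1: "continuous_on {0..z} (ker \<beta> \<gamma> p v)" "continuous_on {0..z} (ker \<beta>' \<gamma>' p' v)"
          using V.K_cont[OF vc] V'.K_cont[OF vc] z by (auto intro: continuous_on_subset)
        have "v z - (u0' - integral {0..z} (ker \<beta> \<gamma> p v)) = integral {0..z} (\<lambda>t. ker \<beta> \<gamma> p v t - ker \<beta>' \<gamma>' p' v t)"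
          using v z c1 by (simp add: V'.solves_def integral_diff integrable_continuous_real)
        moreover have "norm (integral {0..z} (\<lambda>t. ker \<beta> \<gamma> p v t - ker \<beta>' \<gamma>' p' v t)) \<le> r * d * (z - 0)"
          by (rule integral_bound) (use z kd c1 in \<open>auto intro!: continuous_on_diff\<close>)
        moreover have "z * (r * d) \<le> R * (r * d)" using z r d by (intro mult_right_mono) auto
        moreover have "r * d * (z - 0) = z * (r * d)" by simp
        ultimately show "\<bar>v z - (u0' - integral {0..z} (ker \<beta> \<gamma> p v))\<bar> \<le> R * (r * d)"
          unfolding real_norm_def by linarith
      qed
      also have "\<dots> \<le> 2 * (d + R * (r * d)) * exp (2 * M * R)"
        using as y M R r d by (intro mult_mono add_mono) (auto intro!: add_nonneg_nonneg)
      also have "\<dots> = C * d" by (simp add: C_def algebra_simps)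
      finally show ?thesis .
    qed
    have less: "k * d < e" if "k < C + M * C + r + 1" for k
      using mult_strict_right_mono[OF that d] d_eq by simp
    have "\<bar>sol \<beta> \<gamma> p u0 x - v x\<bar> < e"
      using uv[of x] x less[of C] M C r by (force intro: add_nonneg_pos)
    moreover have "\<bar>sol1 \<beta> \<gamma> p u0 x - sol1 \<beta>' \<gamma>' p' u0' x\<bar> < e"
    proof -
      have "\<bar>ker \<beta> \<gamma> p (sol \<beta> \<gamma> p u0) x - ker \<beta> \<gamma> p v x\<bar> \<le> M * (C * d)"
        unfolding M_def by (rule V.K_lip[OF sol_cont vc]) (use x uv in auto)
      moreover have "\<bar>ker \<beta> \<gamma> p v x - ker \<beta>' \<gamma>' p' v x\<bar> \<le> r * d" using kd x by auto
      ultimately have "\<bar>sol1 \<beta> \<gamma> p u0 x - sol1 \<beta>' \<gamma>' p' u0' x\<bar> \<le> (M * C + r) * d"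
        by (simp add: sol1_def v_def[symmetric] algebra_simps)
      also have "\<dots> < e" using C by (intro less) simp
      finally show ?thesis .
    qed
    ultimately show "\<bar>sol \<beta> \<gamma> p u0 x - sol \<beta>' \<gamma>' p' u0' x\<bar> < e"
      "\<bar>sol1 \<beta> \<gamma> p u0 x - sol1 \<beta>' \<gamma>' p' u0' x\<bar> < e" by (auto simp: v_def)
  qed
qed

end

text \<open>Up to the factor x powr \<mu> this is \<open>H1\<close> at ln x.\<close>

definition slope :: "real \<Rightarrow> real \<Rightarrow> real \<Rightarrow> real \<Rightarrow> real \<Rightarrow> real \<Rightarrow> real" where
  "slope \<mu> \<beta> \<gamma> p u0 x = x * sol1 \<beta> \<gamma> p u0 x + \<mu> * sol \<beta> \<gamma> p u0 x"

text \<open>\<open>H\<close> has a local minimum before any zero. Strict signs at two points and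
  positivity on a compact interval make this stable under perturbation, and the parameters are
  separate arguments for the same reason.\<close>

definition rebounds :: "real \<Rightarrow> real \<Rightarrow> real \<Rightarrow> real \<Rightarrow> real \<Rightarrow> bool" where
  "rebounds \<mu> \<beta> \<gamma> p u0 \<longleftrightarrow> (\<exists>x1 x2. 0 < x1 \<and> x1 < x2 \<and> (\<forall>y. 0 \<le> y \<and> y \<le> x2 \<longrightarrow> sol \<beta> \<gamma> p u0 y > 0)
    \<and> slope \<mu> \<beta> \<gamma> p u0 x1 < 0 \<and> 0 < slope \<mu> \<beta> \<gamma> p u0 x2)"

lemma rebounds_open:
  assumes \<beta>: "\<beta> \<ge> 0" and p: "p > 1" and osc: "rebounds \<mu> \<beta> \<gamma> p u0"
  shows "\<exists>d>0. \<forall>\<mu>' \<beta>' \<gamma>' p' u0'. \<beta>' \<ge> 0 \<and> p' > 1 \<and> \<bar>\<mu> - \<mu>'\<bar> < d \<and> \<bar>\<beta> - \<beta>'\<bar> < d \<and> \<bar>\<gamma> - \<gamma>'\<bar> < d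
    \<and> \<bar>p - p'\<bar> < d \<and> \<bar>u0 - u0'\<bar> < d \<longrightarrow> rebounds \<mu>' \<beta>' \<gamma>' p' u0'"
proof -
  define u where "u = sol \<beta> \<gamma> p u0"
  define u1 where "u1 = sol1 \<beta> \<gamma> p u0"
  obtain x1 x2 where x: "0 < x1" "x1 < x2" "\<And>y. 0 \<le> y \<Longrightarrow> y \<le> x2 \<Longrightarrow> u y > 0"
    "slope \<mu> \<beta> \<gamma> p u0 x1 < 0" "0 < slope \<mu> \<beta> \<gamma> p u0 x2"
    using osc unfolding rebounds_def u_def by blast
  have uc: "continuous_on {0..x2} u" unfolding u_def by (rule sol_cont[OF \<beta> p])
  obtain y0 where y0: "y0 \<in> {0..x2}" "\<And>y. y \<in> {0..x2} \<Longrightarrow> u y0 \<le> u y"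
    using continuous_attains_inf[OF _ _ uc] x by auto
  obtain y1 where y1: "y1 \<in> {0..x2}" "\<And>y. y \<in> {0..x2} \<Longrightarrow> u y \<le> u y1"
    using continuous_attains_sup[OF _ _ uc] x by auto
  define s0 where "s0 = min (- slope \<mu> \<beta> \<gamma> p u0 x1) (slope \<mu> \<beta> \<gamma> p u0 x2)"
  have s0: "s0 > 0" using x by (simp add: s0_def)
  have u0p: "u y0 > 0" "u y1 > 0" using x(3) y0 y1 by auto
  \<comment> \<open>Bounds the coefficients when the difference of two slopes is expanded in the
    differences of u, u' and \<mu>.\<close>
  define Q where "Q = x2 + \<bar>\<mu>\<bar> + 1 + u y1 + u y0"
  have Q: "Q > 0" using x u0p by (simp add: Q_def)
  define e where "e = min (min (u y0) 1) (s0 / (2 * Q))"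
  have e: "e > 0" using u0p s0 Q by (simp add: e_def)
  obtain d where d: "d > 0" "\<And>\<beta>' \<gamma>' p' u0' x. \<beta>' \<ge> 0 \<Longrightarrow> p' > 1 \<Longrightarrow> \<bar>\<beta> - \<beta>'\<bar> < d \<Longrightarrow> \<bar>\<gamma> - \<gamma>'\<bar> < d \<Longrightarrow>
      \<bar>p - p'\<bar> < d \<Longrightarrow> \<bar>u0 - u0'\<bar> < d \<Longrightarrow> x \<in> {0..x2} \<Longrightarrow>
      \<bar>u x - sol \<beta>' \<gamma>' p' u0' x\<bar> < e \<and> \<bar>u1 x - sol1 \<beta>' \<gamma>' p' u0' x\<bar> < e"
    using sol_dependence[OF \<beta> p, of x2 e \<gamma> u0] x e unfolding u_def u1_def by auto
  show ?thesis
  proof (intro exI[of _ "min d e"] conjI allI impI)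
    show "min d e > 0" using d e by simp
    fix \<mu>' \<beta>' \<gamma>' p' u0'
    assume as: "\<beta>' \<ge> 0 \<and> p' > 1 \<and> \<bar>\<mu> - \<mu>'\<bar> < min d e \<and> \<bar>\<beta> - \<beta>'\<bar> < min d e \<and> \<bar>\<gamma> - \<gamma>'\<bar> < min d e
      \<and> \<bar>p - p'\<bar> < min d e \<and> \<bar>u0 - u0'\<bar> < min d e"
    define v where "v = sol \<beta>' \<gamma>' p' u0'"
    define v1 where "v1 = sol1 \<beta>' \<gamma>' p' u0'"
    have close: "\<bar>u y - v y\<bar> < e" "\<bar>u1 y - v1 y\<bar> < e" if "y \<in> {0..x2}" for y
      using d(2)[of \<beta>' p' \<gamma>' u0' y] as that by (auto simp: v_def v1_def)
    have sl: "\<bar>slope \<mu> \<beta> \<gamma> p u0 y - slope \<mu>' \<beta>' \<gamma>' p' u0' y\<bar> < s0" if y: "y \<in> {0..x2}" for y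
    proof -
      have v_le: "\<bar>v y\<bar> \<le> u y1 + 1" using close(1)[OF y] y1(2)[OF y] y0(2)[OF y] u0p e
        by (auto simp: e_def)
      have eq: "slope \<mu> \<beta> \<gamma> p u0 y - slope \<mu>' \<beta>' \<gamma>' p' u0' y = y * (u1 y - v1 y) + \<mu> * (u y - v y) + (\<mu> - \<mu>') * v y"
        by (simp add: slope_def u_def u1_def v_def v1_def algebra_simps)
      have "\<bar>y * (u1 y - v1 y)\<bar> \<le> x2 * e" unfolding abs_mult using y close(2)[OF y] by (intro mult_mono) auto
      moreover have "\<bar>\<mu> * (u y - v y)\<bar> \<le> \<bar>\<mu>\<bar> * e" unfolding abs_mult using close(1)[OF y] by (intro mult_left_mono) auto
      moreover have "\<bar>(\<mu> - \<mu>') * v y\<bar> \<le> e * (u y1 + 1)" unfolding abs_mult using as v_le e by (intro mult_mono) auto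
      moreover have "x2 * e + \<bar>\<mu>\<bar> * e + e * (u y1 + 1) \<le> Q * e" using u0p e by (simp add: Q_def algebra_simps)
      moreover have "Q * e \<le> Q * (s0 / (2 * Q))" using Q by (intro mult_left_mono) (auto simp: e_def)
      moreover have "Q * (s0 / (2 * Q)) = s0 / 2" using Q by simp
      ultimately show ?thesis unfolding eq using s0 by linarith
    qed
    have "v y > 0" if "0 \<le> y" "y \<le> x2" for y
      using close(1)[of y] y0(2)[of y] that by (auto simp: e_def)
    moreover have "slope \<mu>' \<beta>' \<gamma>' p' u0' x1 < 0" using sl[of x1] x by (auto simp: s0_def)
    moreover have "slope \<mu>' \<beta>' \<gamma>' p' u0' x2 > 0" using sl[of x2] x by (auto simp: s0_def)
    ultimately show "rebounds \<mu>' \<beta>' \<gamma>' p' u0'"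
      unfolding rebounds_def v_def using x(1,2) by blast
  qed
qed

end

subsection \<open>Shooting\<close>

context exponents begin

sublocale shooting_data N m \<sigma>
  using N m \<sigma> by unfold_locales

abbreviation "\<gamma> \<equiv> \<alpha> - real N * \<beta>"
abbreviation "W \<equiv> sol \<beta> \<gamma> p"
abbreviation "W1 \<equiv> sol1 \<beta> \<gamma> p"

lemma beta_nonneg: "\<beta> \<ge> 0"
  using beta_pos by simp

text \<open>The interval of positivity that starts at 0, ending at the first zero if there is
  one.\<close>

definition supp :: "real \<Rightarrow> real set" where
  "supp u0 = {x. 0 < x \<and> (\<forall>y. 0 < y \<and> y \<le> x \<longrightarrow> 0 < W u0 y)}"

lemma sol_radial_on:
  assumes u0: "0 < u0" "u0 < 1"
    and J: "\<And>x. x \<in> J \<Longrightarrow> 0 < x" "\<And>x y. x \<in> J \<Longrightarrow> 0 < y \<Longrightarrow> y \<le> x \<Longrightarrow> y \<in> J" "J \<noteq> {}"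
    and W: "\<And>x. x \<in> J \<Longrightarrow> 0 < W u0 x \<and> W u0 x < 1"
  shows "radial_solution N m \<sigma> p u0 J (W u0) (W1 u0)"
proof
  show "\<And>x. x \<in> J \<Longrightarrow> 0 < x" by (rule J(1))
  show "\<And>x y. x \<in> J \<Longrightarrow> 0 < y \<Longrightarrow> y \<le> x \<Longrightarrow> y \<in> J" by (rule J(2))
  show "J \<noteq> {}" by (rule J(3))
  show "0 < W u0 x" if "x \<in> J" for x using W[OF that] by simp
  show "(W u0 has_real_derivative W1 u0 x) (at x)" if "x \<in> J" for x
    by (rule sol_deriv[OF beta_nonneg p(1) J(1)[OF that]])
  show "(W1 u0 has_real_derivative - ((real N - 1) / x * W1 u0 x) - \<alpha> * W u0 x powr (1 / m)
      - \<beta> * x * (W u0 x powr (1 / m - 1) * W1 u0 x / m) - x powr \<sigma> * W u0 x powr (p / m)) (at x)"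
    if "x \<in> J" for x
    using sol1_deriv[OF beta_nonneg p(1) J(1)[OF that], of \<gamma> u0] W[OF that] by simp
  show "(W u0 \<longlongrightarrow> u0) (at_right 0)" by (rule sol_lim[OF beta_nonneg p(1)])
  show "((\<lambda>x. (W u0 x - u0) / x) \<longlongrightarrow> 0) (at_right 0)" by (rule sol_flat[OF beta_nonneg p(1)])
qed (rule u0)

text \<open>The true equation is known to hold only where also W < 1. On that smaller interval the
  solution decreases, so it stays below u0 and cannot reach 1; hence the two intervals
  agree.\<close>

lemma sol_radial:
  assumes u0: "0 < u0" "u0 < 1"
  shows "radial_solution N m \<sigma> p u0 (supp u0) (W u0) (W1 u0)"
proof -
  define J where "J = {x. 0 < x \<and> (\<forall>y. 0 < y \<and> y \<le> x \<longrightarrow> 0 < W u0 y \<and> W u0 y < 1)}"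
  have Jmem: "x \<in> J \<longleftrightarrow> 0 < x \<and> (\<forall>y. 0 < y \<and> y \<le> x \<longrightarrow> 0 < W u0 y \<and> W u0 y < 1)" for x
    by (simp add: J_def)
  have "eventually (\<lambda>x. 0 < W u0 x) (at_right 0)" "eventually (\<lambda>x. W u0 x < 1) (at_right 0)"
    using order_tendstoD[OF sol_lim[OF beta_nonneg p(1), of \<gamma> u0]] u0 by auto
  then have "eventually (\<lambda>x. 0 < W u0 x \<and> W u0 x < 1) (at_right 0)" by (rule eventually_conj)
  then obtain r where r: "r > 0" "\<And>x. 0 < x \<Longrightarrow> x < r \<Longrightarrow> 0 < W u0 x \<and> W u0 x < 1"
    unfolding eventually_at_right_field by blast
  have rJ: "r / 2 \<in> J" using r by (auto simp: Jmem)
  interpret J: radial_solution N m \<sigma> p u0 J "W u0" "W1 u0"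
  proof (rule sol_radial_on[OF u0])
    show "J \<noteq> {}" using rJ by blast
  qed (auto simp: Jmem)
  have "W u0 y < 1" if x: "x \<in> supp u0" and y: "0 < y" "y \<le> x" for x y
  proof (rule ccontr)
    assume "\<not> W u0 y < 1"
    moreover have "continuous_on {0..y} (\<lambda>y. W u0 y - 1)"
      by (intro continuous_intros sol_cont[OF beta_nonneg p(1)])
    ultimately obtain t where t: "0 < t" "t \<le> y" "W u0 t = 1" "\<And>u. 0 \<le> u \<Longrightarrow> u < t \<Longrightarrow> W u0 u < 1"
      using first_crossing[of 0 y "\<lambda>y. W u0 y - 1"] y sol_0[OF beta_nonneg p(1), of \<gamma> u0] u0 by auto
    have "W u0 s < u0" if s: "0 < s" "s < t" for s
    proof (rule J.w_less_w0)
      show "s \<in> J" using s t x y by (auto simp: Jmem supp_def)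
    qed
    then have "eventually (\<lambda>s. W u0 s \<le> u0) (at_left t)"
      using t by (intro eventually_at_leftI[of 0]) (auto intro: less_imp_le)
    moreover have "(W u0 \<longlongrightarrow> W u0 t) (at_left t)"
      using DERIV_isCont[OF sol_deriv[OF beta_nonneg p(1) t(1)]] unfolding isCont_def
      by (rule tendsto_within_subset) auto
    ultimately have "W u0 t \<le> u0" by (intro tendsto_upperbound[of "W u0" _ "at_left t"]) auto
    then show False using t u0 by simp
  qed
  then have "J = supp u0" by (fastforce simp: J_def supp_def)
  then show ?thesis using J.radial_solution_axioms by simp
qed

text \<open>The slope at the first zero is a limit of negative ones, and not zero by
  \<open>w1_not_tendsto_zero\<close>. This transversality is what confines the zeros of nearby
  solutions later.\<close>

lemma crossing:
  assumes u0: "0 < u0" "u0 < 1" and ne: "supp u0 \<noteq> {0<..}"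
  obtains R where "R > 0" "supp u0 = {0<..<R}" "W u0 R = 0" "W1 u0 R < 0"
proof -
  interpret radial_solution N m \<sigma> p u0 "supp u0" "W u0" "W1 u0" by (rule sol_radial[OF u0])
  obtain x where x: "0 < x" "W u0 x \<le> 0" using ne by (force simp: supp_def not_less)
  have "continuous_on {0..x} (\<lambda>y. - W u0 y)"
    by (intro continuous_intros sol_cont[OF beta_nonneg p(1)])
  then obtain R where R: "0 < R" "R \<le> x" "W u0 R = 0" "\<And>u. 0 \<le> u \<Longrightarrow> u < R \<Longrightarrow> W u0 u > 0"
    using first_crossing[of 0 x "\<lambda>y. - W u0 y"] x sol_0[OF beta_nonneg p(1), of \<gamma> u0] u0 by auto
  have supp: "supp u0 = {0<..<R}"
  proof (intro set_eqI iffI)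
    fix y assume "y \<in> supp u0"
    then show "y \<in> {0<..<R}" using R by (force simp: supp_def not_less)
  qed (use R in \<open>auto simp: supp_def\<close>)
  have "isCont (W1 u0) R"
    using continuous_on_interior[OF sol1_cont[OF beta_nonneg p(1), of "R + 1" \<gamma> u0]] R by auto
  then have lim: "(W1 u0 \<longlongrightarrow> W1 u0 R) (at_left R)"
    unfolding isCont_def by (rule tendsto_within_subset) auto
  have "eventually (\<lambda>s. W1 u0 s \<le> 0) (at_left R)"
    using R w1_neg supp by (intro eventually_at_leftI[of 0]) (auto intro: less_imp_le)
  then have "W1 u0 R \<le> 0" by (intro tendsto_upperbound[OF lim]) auto
  moreover have "W1 u0 R \<noteq> 0" using w1_not_tendsto_zero[OF supp] lim by auto
  ultimately show thesis using that R supp by force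
qed

lemma supp_entire:
  assumes "0 < u0" "u0 < 1" "supp u0 = {0<..}"
  shows "entire_radial_solution N m \<sigma> p u0 (W u0) (W1 u0)"
  using sol_radial[OF assms(1,2)] assms(3) by (simp add: entire_radial_solution_def)

text \<open>Nonnegative asymptotic damping keeps the energy negative, while a crossing has nonnegative energy.\<close>

lemma no_crossing:
  assumes u0: "0 < u0" "u0 < 1" and c: "c \<ge> 0"
  shows "supp u0 = {0<..}"
proof (rule ccontr)
  assume "supp u0 \<noteq> {0<..}"
  then obtain R where R: "R > 0" "supp u0 = {0<..<R}" "W u0 R = 0" using crossing[OF u0] by blast
  interpret radial_solution N m \<sigma> p u0 "supp u0" "W u0" "W1 u0" by (rule sol_radial[OF u0])
  have in_I: "exp s \<in> supp u0 \<longleftrightarrow> s < ln R" for s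
    using R by (simp add: ln_less_cancel_iff[symmetric] del: ln_less_cancel_iff)
  define s0 where "s0 = ln R - 1"
  have E0: "traj.E s0 < 0" by (rule traj.E_neg[OF c]) (simp add: in_I s0_def)
  have "eventually (\<lambda>s. traj.Pot (Hf s) \<le> traj.E s0) (at_left (ln R))"
  proof (rule eventually_at_leftI[of s0])
    fix s assume s: "s \<in> {s0<..<ln R}"
    have "traj.E s \<le> traj.E s0" using s c by (intro traj.E_antimono) (auto simp: in_I)
    moreover have "0 \<le> (H1f s)\<^sup>2 / 2" by simp
    ultimately show "traj.Pot (Hf s) \<le> traj.E s0" unfolding traj.E_def[of s] by linarith
  qed (simp add: s0_def)
  moreover have "((\<lambda>s. traj.Pot (Hf s)) \<longlongrightarrow> 0) (at_left (ln R))"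
  proof -
    have "isCont (W u0) (exp (ln R))"
      using R DERIV_isCont[OF sol_deriv[OF beta_nonneg p(1) R(1), of \<gamma> u0]] by simp
    then have "isCont (\<lambda>s. W u0 (exp s)) (ln R)"
      using isCont_o2[of "ln R" exp "W u0"] by simp
    then have "isCont (\<lambda>s. exp (\<mu> * s) * W u0 (exp s)) (ln R)"
      by (intro continuous_intros)
    then have "((\<lambda>s. Hf s) \<longlongrightarrow> 0) (at_left (ln R))"
      unfolding isCont_def Hf_def using R by (auto intro: tendsto_within_subset)
    moreover have "eventually (\<lambda>s. 0 \<le> Hf s) (at_left (ln R))"
      using traj.H_pos in_I by (intro eventually_at_leftI[of s0]) (auto intro: less_imp_le simp: s0_def)
    ultimately have "((\<lambda>s. Hf s powr (q + 1) / (q + 1) - a * (Hf s)\<^sup>2 / 2) \<longlongrightarrow> 0 / (q + 1) - a * 0\<^sup>2 / 2) (at_left (ln R))"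
      using q_gt_1
      by (intro tendsto_diff tendsto_divide tendsto_mult tendsto_const tendsto_power
          tendsto_zero_powrI[of Hf _ "\<lambda>_. q + 1" "q + 1"]) auto
    then show ?thesis by (simp add: traj.Pot_def)
  qed
  ultimately have "0 \<le> traj.E s0" by (intro tendsto_upperbound[of _ 0 "at_left (ln R)"]) auto
  then show False using E0 by simp
qed

lemma slope_H1f:
  assumes u0: "0 < u0" "u0 < 1" and x: "x > 0"
  shows "radial_solution.H1f m \<sigma> p (W u0) (W1 u0) (ln x) = x powr \<mu> * slope \<mu> \<beta> \<gamma> p u0 x"
  using x radial_solution.H1f_def[OF sol_radial[OF u0]] by (simp add: slope_def powr_def algebra_simps)

lemma rebounds_at_critical:
  assumes u0: "0 < u0" "u0 < 1" and c: "c = 0"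
  shows "rebounds \<mu> \<beta> \<gamma> p u0"
proof -
  have supp: "supp u0 = {0<..}" using no_crossing[OF u0] c by simp
  interpret entire_radial_solution N m \<sigma> p u0 "W u0" "W1 u0" by (rule supp_entire[OF u0 supp])
  obtain s1 s2 where s: "s1 < s2" "H1f s1 < 0" "0 < H1f s2" using glob.oscillation[OF c] by blast
  have "slope \<mu> \<beta> \<gamma> p u0 (exp s1) < 0" "0 < slope \<mu> \<beta> \<gamma> p u0 (exp s2)"
    using s slope_H1f[OF u0, of "exp s1"] slope_H1f[OF u0, of "exp s2"]
    by (auto simp: mult_less_0_iff zero_less_mult_iff)
  moreover have "W u0 y > 0" if "0 \<le> y" for y
    using w_pos[of y] that u0 sol_0[OF beta_nonneg p(1), of \<gamma> u0] by (cases "y = 0") auto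
  ultimately show ?thesis unfolding rebounds_def using s(1)
    by (intro exI[of _ "exp s1"] exI[of _ "exp s2"]) auto
qed

text \<open>The closed form of rebounding, in which the power expression is \<open>V\<close> at ln
  x; unlike the strict signs it passes to limits.\<close>

lemma rebounds_turning:
  assumes u0: "0 < u0" "u0 < 1" and osc: "rebounds \<mu> \<beta> \<gamma> p u0"
  obtains x where "x \<in> supp u0" "slope \<mu> \<beta> \<gamma> p u0 x = 0" "x powr (\<sigma> + 2) * W u0 x powr (q - 1) \<le> a"
    "\<And>y. 0 \<le> y \<Longrightarrow> y \<le> x \<Longrightarrow> 0 < W u0 y"
proof -
  interpret radial_solution N m \<sigma> p u0 "supp u0" "W u0" "W1 u0" by (rule sol_radial[OF u0])
  obtain x1 x2 where x: "0 < x1" "x1 < x2" "\<And>y. 0 \<le> y \<Longrightarrow> y \<le> x2 \<Longrightarrow> W u0 y > 0"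
    "slope \<mu> \<beta> \<gamma> p u0 x1 < 0" "0 < slope \<mu> \<beta> \<gamma> p u0 x2"
    using osc unfolding rebounds_def by blast
  have x2s: "x2 \<in> supp u0" using x by (auto simp: supp_def)
  have "H1f (ln x1) < 0" "0 \<le> H1f (ln x2)"
    using x slope_H1f[OF u0, of x1] slope_H1f[OF u0, of x2] by (auto simp: mult_less_0_iff)
  then obtain t where t: "ln x1 < t" "t \<le> ln x2" "H1f t = 0" "traj.V t \<le> a"
    using traj.turning_point[of "ln x1" "ln x2"] x x2s by auto
  define y where "y = exp t"
  have y: "0 < y" "y \<le> x2" "ln y = t" using t x by (auto simp: y_def ln_ge_iff)
  have ys: "y \<in> supp u0" using y x by (auto simp: supp_def)
  have "slope \<mu> \<beta> \<gamma> p u0 y = 0" using t(3) slope_H1f[OF u0 y(1)] y by simp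
  moreover have "y powr (\<sigma> + 2) * W u0 y powr (q - 1) \<le> a"
  proof -
    have "traj.V t = exp (\<mu> * (q - 1) * t) * W u0 y powr (q - 1)"
      using Hf_powr[of t] ys by (simp add: traj.V_def y_def)
    also have "exp (\<mu> * (q - 1) * t) = y powr (\<sigma> + 2)" using y by (simp add: mu_q powr_def)
    finally show ?thesis using t(4) by simp
  qed
  ultimately show thesis using that[of y] ys x(3) y(2) by auto
qed

text \<open>At a turning point V = a is impossible by backward uniqueness. So V < a there,
  \<open>H1' > 0\<close>, and \<open>H1\<close> changes sign strictly.\<close>

lemma turning_rebounds:
  assumes u0: "0 < u0" "u0 < 1" and a: "a > 0" and supp: "supp u0 = {0<..<R}" and x: "x \<in> supp u0"
    and sl: "slope \<mu> \<beta> \<gamma> p u0 x = 0" and V: "x powr (\<sigma> + 2) * W u0 x powr (q - 1) \<le> a"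
  shows "rebounds \<mu> \<beta> \<gamma> p u0"
proof -
  interpret radial_solution N m \<sigma> p u0 "supp u0" "W u0" "W1 u0" by (rule sol_radial[OF u0])
  have x0: "0 < x" "x < R" using x supp by auto
  define s where "s = ln x"
  have ex: "exp s = x" using x0 by (simp add: s_def)
  have sI: "s \<in> {s. exp s \<in> supp u0}" using x ex by simp
  have H1: "H1f s = 0" using slope_H1f[OF u0 x0(1)] sl by (simp add: s_def)
  have "traj.V s = exp (\<mu> * (q - 1) * s) * W u0 x powr (q - 1)"
    using Hf_powr[of s] x by (simp add: traj.V_def ex)
  also have "exp (\<mu> * (q - 1) * s) = x powr (\<sigma> + 2)" using x0 by (simp add: mu_q powr_def s_def)
  finally have "traj.V s \<le> a" using V by simp
  moreover have "traj.V s \<noteq> a"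
    using traj.V_eq_a[OF sI a] traj.not_equilibrium[OF a sI H1] by simp
  ultimately have "traj.V s < a" by simp
  then have "Hf s * (a - traj.V s) > 0" using traj.H_pos[OF sI] by simp
  moreover have d: "(H1f has_real_derivative Hf s * (a - traj.V s)) (at s)"
    using traj.H1_deriv_eq[OF sI] H1 by simp
  ultimately obtain d1 d2 where d: "d1 > 0" "\<And>h. 0 < h \<Longrightarrow> h < d1 \<Longrightarrow> H1f s < H1f (s + h)"
    "d2 > 0" "\<And>h. 0 < h \<Longrightarrow> h < d2 \<Longrightarrow> H1f (s - h) < H1f s"
    using DERIV_pos_inc_right[OF d] DERIV_pos_inc_left[OF d] by blast
  define h where "h = min (d1 / 2) ((ln R - s) / 2)"
  have sR: "s < ln R" using x0 by (simp add: s_def)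
  have "h \<le> d1 / 2" unfolding h_def by (rule min.cobounded1)
  then have h1: "h < d1" using d(1) by linarith
  have "h \<le> (ln R - s) / 2" unfolding h_def by (rule min.cobounded2)
  then have h2: "s + h < ln R" using sR by (simp add: field_simps)
  have h3: "0 < h" using d(1) sR by (simp add: h_def)
  note h = h1 h2 h3
  define k where "k = d2 / 2"
  have k: "0 < k" "k < d2" using d(3) by (auto simp: k_def)
  have p1: "H1f (s + h) > 0" using d(2)[OF h(3,1)] H1 by simp
  have p2: "H1f (s - k) < 0" using d(4)[OF k] H1 by simp
  have R0: "R > 0" using x0 by simp
  have e1: "exp (s + h) < R" using h(2) R0 by (metis exp_less_cancel_iff exp_ln)
  have "slope \<mu> \<beta> \<gamma> p u0 (exp (s - k)) < 0" "0 < slope \<mu> \<beta> \<gamma> p u0 (exp (s + h))"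
    using p1 p2 slope_H1f[OF u0, of "exp (s - k)"] slope_H1f[OF u0, of "exp (s + h)"]
    by (auto simp: mult_less_0_iff zero_less_mult_iff)
  moreover have "W u0 y > 0" if "0 \<le> y" "y \<le> exp (s + h)" for y
  proof (cases "y = 0")
    case False
    then show ?thesis using w_pos[of y] supp that e1 by simp
  qed (use u0 sol_0[OF beta_nonneg p(1), of \<gamma> u0] in simp)
  ultimately show ?thesis unfolding rebounds_def using h(3) k(1)
    by (intro exI[of _ "exp (s - k)"] exI[of _ "exp (s + h)"]) auto
qed

text \<open>A limit of rebounding solutions which does not rebound itself cannot cross: the turning points
  would accumulate at a turning point of the limit.\<close>

lemma limit_of_rebounds:
  assumes u0: "0 < u0" "u0 < 1" and a: "a > 0" and no: "\<not> rebounds \<mu> \<beta> \<gamma> p u0"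
    and lim: "\<And>d. d > 0 \<Longrightarrow> \<exists>v0. 0 < v0 \<and> v0 < 1 \<and> \<bar>u0 - v0\<bar> < d \<and> rebounds \<mu> \<beta> \<gamma> p v0"
  shows "supp u0 = {0<..}"
proof (rule ccontr)
  assume "supp u0 \<noteq> {0<..}"
  then obtain R where R: "R > 0" "supp u0 = {0<..<R}" "W u0 R = 0" "W1 u0 R < 0"
    using crossing[OF u0] by blast
  obtain h where h: "h > 0" "\<And>k. 0 < k \<Longrightarrow> k < h \<Longrightarrow> W u0 (R + k) < W u0 R"
    using DERIV_neg_dec_right[OF sol_deriv[OF beta_nonneg p(1) R(1)] R(4)] by blast
  \<comment> \<open>Just beyond the transversal zero the limit solution is negative, so nearby
    solutions vanish before R' and their turning points stay in a compact interval.\<close>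
  define R' where "R' = R + h / 2"
  have R': "R < R'" "W u0 R' < 0" using h(1) h(2)[of "h / 2"] R(3) by (auto simp: R'_def)
  have beyond: "W u0 y < 0" if "R < y" "y \<le> R'" for y
    using h(2)[of "y - R"] that h(1) R(3) by (auto simp: R'_def)
  have "\<exists>v0 x. 0 < v0 \<and> v0 < 1 \<and> x \<in> {0..R'} \<and> (\<forall>y\<in>{0..R'}. \<bar>W u0 y - W v0 y\<bar> < 1 / real (Suc n)
      \<and> \<bar>W1 u0 y - W1 v0 y\<bar> < 1 / real (Suc n)) \<and> slope \<mu> \<beta> \<gamma> p v0 x = 0 \<and> 0 < W v0 x
      \<and> x powr (\<sigma> + 2) * W v0 x powr (q - 1) \<le> a" for n
  proof -
    define e where "e = min (1 / real (Suc n)) (- W u0 R')"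
    have e: "e > 0" using R' by (simp add: e_def)
    have "R' \<ge> 0" using R R' by simp
    from sol_dependence[OF beta_nonneg p(1) this e, of \<gamma> u0]
    obtain d where d: "d > 0" "\<And>v0. \<bar>u0 - v0\<bar> < d \<Longrightarrow>
        (\<forall>y\<in>{0..R'}. \<bar>W u0 y - W v0 y\<bar> < e \<and> \<bar>W1 u0 y - W1 v0 y\<bar> < e)"
      using beta_nonneg p(1) by (metis abs_zero diff_self)
    obtain v0 where v0: "0 < v0" "v0 < 1" "\<bar>u0 - v0\<bar> < d" "rebounds \<mu> \<beta> \<gamma> p v0"
      using lim[OF d(1)] by blast
    have close: "\<forall>y\<in>{0..R'}. \<bar>W u0 y - W v0 y\<bar> < e \<and> \<bar>W1 u0 y - W1 v0 y\<bar> < e" by (rule d(2)[OF v0(3)])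
    obtain x where x: "x \<in> supp v0" "slope \<mu> \<beta> \<gamma> p v0 x = 0" "x powr (\<sigma> + 2) * W v0 x powr (q - 1) \<le> a"
      "\<And>y. 0 \<le> y \<Longrightarrow> y \<le> x \<Longrightarrow> 0 < W v0 y"
      using rebounds_turning[OF v0(1,2,4)] by blast
    have "W v0 R' < 0" using close R R' by (auto simp: e_def dest!: bspec[of _ _ R'])
    then have "x < R'" using x(4)[of R'] R R' by (force simp: not_less)
    then have "x \<in> {0..R'}" using x(1) by (auto simp: supp_def)
    then show ?thesis using v0 x close x(4)[of x] by (intro exI[of _ v0] exI[of _ x]) (auto simp: e_def)
  qed
  then obtain v x where vx: "\<And>n. x n \<in> {0..R'}"
    "\<And>n y. y \<in> {0..R'} \<Longrightarrow> \<bar>W u0 y - W (v n) y\<bar> < 1 / real (Suc n)"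
    "\<And>n y. y \<in> {0..R'} \<Longrightarrow> \<bar>W1 u0 y - W1 (v n) y\<bar> < 1 / real (Suc n)"
    "\<And>n. slope \<mu> \<beta> \<gamma> p (v n) (x n) = 0" "\<And>n. 0 < W (v n) (x n)"
    "\<And>n. x n powr (\<sigma> + 2) * W (v n) (x n) powr (q - 1) \<le> a" by metis
  have "seq_compact {0..R'}" by (simp add: compact_imp_seq_compact)
  then obtain z r where z: "z \<in> {0..R'}" and r: "strict_mono r" and xz: "(x \<circ> r) \<longlonglongrightarrow> z"
    using vx(1) unfolding seq_compact_def by metis
  have xz': "(\<lambda>n. x (r n)) \<longlonglongrightarrow> z" using xz by (simp add: o_def)
  have inv: "(\<lambda>n. 1 / real (Suc (r n))) \<longlonglongrightarrow> 0"
    using LIMSEQ_subseq_LIMSEQ[OF LIMSEQ_inverse_real_of_nat r] by (simp add: o_def inverse_eq_divide)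
  have comp: "(\<lambda>n. F (x (r n))) \<longlonglongrightarrow> F z" if "continuous_on {0..R'} F" for F :: "real \<Rightarrow> real"
    by (rule continuous_on_tendsto_compose[OF that xz' z]) (use vx(1) in auto)
  have Wlim: "(\<lambda>n. W (v (r n)) (x (r n))) \<longlonglongrightarrow> W u0 z"
  proof -
    have "(\<lambda>n. W u0 (x (r n)) - W (v (r n)) (x (r n))) \<longlonglongrightarrow> 0"
      by (rule Lim_null_comparison[OF _ inv]) (use vx(1,2) in \<open>auto intro!: always_eventually less_imp_le\<close>)
    moreover have "continuous_on {0..R'} (W u0)" by (rule sol_cont[OF beta_nonneg p(1)])
    ultimately show ?thesis using tendsto_diff[OF comp] by fastforce
  qed
  have W1lim: "(\<lambda>n. W1 (v (r n)) (x (r n))) \<longlonglongrightarrow> W1 u0 z"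
  proof -
    have "(\<lambda>n. W1 u0 (x (r n)) - W1 (v (r n)) (x (r n))) \<longlonglongrightarrow> 0"
      by (rule Lim_null_comparison[OF _ inv]) (use vx(1,3) in \<open>auto intro!: always_eventually less_imp_le\<close>)
    moreover have "continuous_on {0..R'} (W1 u0)" by (rule sol1_cont[OF beta_nonneg p(1)])
    ultimately show ?thesis using tendsto_diff[OF comp] by fastforce
  qed
  have "(\<lambda>n. x (r n) * W1 (v (r n)) (x (r n)) + \<mu> * W (v (r n)) (x (r n))) \<longlonglongrightarrow> z * W1 u0 z + \<mu> * W u0 z"
    by (intro tendsto_intros xz' Wlim W1lim)
  moreover have "x (r n) * W1 (v (r n)) (x (r n)) + \<mu> * W (v (r n)) (x (r n)) = 0" for n
    using vx(4)[of "r n"] by (simp add: slope_def)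
  ultimately have sl: "slope \<mu> \<beta> \<gamma> p u0 z = 0"
    by (simp add: slope_def LIMSEQ_const_iff)
  have Wz: "W u0 z \<ge> 0" by (rule LIMSEQ_le_const[OF Wlim]) (use vx(5) in \<open>auto intro: less_imp_le\<close>)
  \<comment> \<open>The slope equals \<mu> u0 > 0 at 0 and R W1(R) < 0 at R, so the accumulation
    point is neither of these.\<close>
  have "z \<noteq> 0" using sl mu_pos u0 sol_0[OF beta_nonneg p(1), of \<gamma> u0] by (auto simp: slope_def)
  moreover have "z \<noteq> R" using sl R by (auto simp: slope_def)
  moreover have "z \<le> R" using Wz beyond[of z] z by force
  ultimately have zs: "z \<in> supp u0" using z R(2) by auto
  have "(\<lambda>n. x (r n) powr (\<sigma> + 2) * W (v (r n)) (x (r n)) powr (q - 1)) \<longlonglongrightarrow> z powr (\<sigma> + 2) * W u0 z powr (q - 1)"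
    using zs z \<open>z \<noteq> 0\<close> q_gt_1 vx(5)
    by (intro tendsto_mult tendsto_powr' xz' Wlim tendsto_const) (auto intro!: always_eventually less_imp_le)
  then have V: "z powr (\<sigma> + 2) * W u0 z powr (q - 1) \<le> a"
    by (rule LIMSEQ_le_const2) (use vx(6) in auto)
  show False using turning_rebounds[OF u0 a R(2) zs sl V] no by blast
qed

text \<open>For small initial value \<open>G \<le> \<beta> / m * min (x\<^sup>2 w0\<^sup>\<rho>) (C x\<^sup>-\<^sup>\<kappa>)\<close> is uniformly small.\<close>

lemma small_not_rebounds:
  assumes c: "c < 0"
  shows "\<exists>u0. 0 < u0 \<and> u0 \<le> 1 / 2 \<and> \<not> rebounds \<mu> \<beta> \<gamma> p u0"
proof -
  \<comment> \<open>This bound for \<open>H\<close> is free of the initial value, so the time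
    \<open>s0\<close> can be fixed before \<open>u0\<close> is chosen.\<close>
  define B where "B = (((q - 1) * \<mu> + \<bar>c\<bar> * \<mu> + \<bar>a\<bar> + 1) * exp \<mu>) powr (1 / (q - 1))"
  have lt: "filterlim (\<lambda>t. - \<kappa> * t) at_bot at_top"
    using filterlim_tendsto_neg_mult_at_bot[of "\<lambda>_. - \<kappa>" "- \<kappa>" at_top "\<lambda>t. t"] kappa_pos
    by (simp add: filterlim_ident)
  have "((\<lambda>s. \<beta> / m * exp (- \<kappa> * s) * B powr \<rho>) \<longlongrightarrow> \<beta> / m * 0 * B powr \<rho>) at_top"
    by (intro tendsto_intros filterlim_compose[OF exp_at_bot lt])
  then have "eventually (\<lambda>s. \<beta> / m * exp (- \<kappa> * s) * B powr \<rho> < - c) at_top"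
    by (rule order_tendstoD(2)) (use c in simp)
  then obtain s0 where s0: "\<And>s. s0 \<le> s \<Longrightarrow> \<beta> / m * exp (- \<kappa> * s) * B powr \<rho> < - c"
    unfolding eventually_at_top_linorder by blast
  have m1: "1 / m - 1 > 0" using m by simp
  have idlim: "((\<lambda>u::real. u) \<longlongrightarrow> 0) (at_right 0)" by (rule tendsto_ident_at)
  have "((\<lambda>u. \<beta> / m * (exp s0)\<^sup>2 * u powr (1 / m - 1)) \<longlongrightarrow> \<beta> / m * (exp s0)\<^sup>2 * 0) (at_right 0)"
    using m1 by (intro tendsto_mult tendsto_const tendsto_zero_powrI[OF idlim tendsto_const])
      (auto intro!: eventually_at_rightI[of 0 1])
  then have "eventually (\<lambda>u. \<beta> / m * (exp s0)\<^sup>2 * u powr (1 / m - 1) < - c) (at_right 0)"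
    by (rule order_tendstoD(2)) (use c in simp)
  then obtain b where b: "b > 0" "\<And>u. 0 < u \<Longrightarrow> u < b \<Longrightarrow> \<beta> / m * (exp s0)\<^sup>2 * u powr (1 / m - 1) < - c"
    unfolding eventually_at_right_field by blast
  define u0 where "u0 = min (b / 2) (1 / 2)"
  have u0: "0 < u0" "u0 < 1" "u0 \<le> 1 / 2" "u0 < b" using b by (auto simp: u0_def)
  interpret radial_solution N m \<sigma> p u0 "supp u0" "W u0" "W1 u0" by (rule sol_radial[OF u0(1,2)])
  have G: "c + traj.G s < 0" if s: "s \<in> {s. exp s \<in> supp u0}" for s
  proof (cases "s0 \<le> s")
    case True
    have "Hf s powr \<rho> \<le> B powr \<rho>"
      using traj.H_le[OF s] traj.H_pos[OF s] rho_pos unfolding B_def by (intro powr_mono2) auto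
    then have "traj.G s \<le> \<beta> / m * exp (- \<kappa> * s) * B powr \<rho>"
      unfolding traj.G_def using beta_pos m by (intro mult_left_mono) auto
    then show ?thesis using s0[OF True] by simp
  next
    case False
    have "traj.G s = \<beta> / m * (exp s)\<^sup>2 * W u0 (exp s) powr (1 / m - 1)" using s by (intro traj_G) simp
    also have "\<dots> \<le> \<beta> / m * (exp s0)\<^sup>2 * u0 powr (1 / m - 1)"
      using False s w_less_w0[of "exp s"] w_pos[of "exp s"] m1 beta_pos m
      by (intro mult_mono powr_mono2 power_mono) auto
    also have "\<dots> < - c" by (rule b(2)) (use u0 in auto)
    finally show ?thesis by simp
  qed
  have "\<not> rebounds \<mu> \<beta> \<gamma> p u0"
  proof
    assume "rebounds \<mu> \<beta> \<gamma> p u0"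
    then obtain x where x: "x \<in> supp u0" "slope \<mu> \<beta> \<gamma> p u0 x = 0" "x powr (\<sigma> + 2) * W u0 x powr (q - 1) \<le> a"
      using rebounds_turning[OF u0(1,2)] by blast
    have x0: "x > 0" using x by (simp add: supp_def)
    have sI: "ln x \<in> {s. exp s \<in> supp u0}" using x x0 by simp
    have "traj.V (ln x) = exp (\<mu> * (q - 1) * ln x) * W u0 x powr (q - 1)"
      using Hf_powr[of "ln x"] x x0 by (simp add: traj.V_def)
    also have "exp (\<mu> * (q - 1) * ln x) = x powr (\<sigma> + 2)" using x0 by (simp add: mu_q powr_def)
    finally have "traj.V (ln x) \<le> a" using x by simp
    moreover have "H1f (ln x) = 0" using slope_H1f[OF u0(1,2) x0] x by simp
    ultimately have "traj.E (ln x) \<le> 0" by (intro traj.E_turning[OF sI])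
    then show False using traj.E_pos[OF G sI] by simp
  qed
  then show ?thesis using u0 by blast
qed

text \<open>Take the supremum of the non-rebounding values up to 1/2. Since rebounding is open, the
  supremum does not rebound; hence it lies below 1/2, and the values just above it rebound, which is
  the situation of \<open>limit_of_rebounds\<close>.\<close>

lemma exists_entire_fast:
  assumes c: "c < 0" and a: "a > 0" and osc: "rebounds \<mu> \<beta> \<gamma> p (1 / 2)"
  shows "\<exists>u0. 0 < u0 \<and> u0 < 1 \<and> supp u0 = {0<..}"
proof -
  define Z where "Z = {u. 0 < u \<and> u \<le> 1 / 2 \<and> \<not> rebounds \<mu> \<beta> \<gamma> p u}"
  obtain u1 where u1: "u1 \<in> Z" using small_not_rebounds[OF c] by (auto simp: Z_def)
  have bdd: "bdd_above Z" by (rule bdd_aboveI[of _ "1 / 2"]) (auto simp: Z_def)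
  define u0 where "u0 = Sup Z"
  have u0: "0 < u0" "u0 \<le> 1 / 2"
    using cSup_upper[OF u1 bdd] u1 cSup_least[of Z "1 / 2"] by (auto simp: u0_def Z_def)
  have op: "\<exists>d>0. \<forall>v. \<bar>u - v\<bar> < d \<longrightarrow> rebounds \<mu> \<beta> \<gamma> p v" if "rebounds \<mu> \<beta> \<gamma> p u" for u
    using rebounds_open[OF beta_nonneg p(1) that] beta_nonneg p(1) by (metis abs_zero diff_self)
  have no: "\<not> rebounds \<mu> \<beta> \<gamma> p u0"
  proof
    assume "rebounds \<mu> \<beta> \<gamma> p u0"
    then obtain d where d: "d > 0" "\<And>v. \<bar>u0 - v\<bar> < d \<Longrightarrow> rebounds \<mu> \<beta> \<gamma> p v" using op by blast
    obtain z where z: "z \<in> Z" "u0 - d < z" using less_cSupE[of "u0 - d" Z] u1 d(1) by (auto simp: u0_def)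
    have "z \<le> u0" using cSup_upper[OF z(1) bdd] by (simp add: u0_def)
    then have "rebounds \<mu> \<beta> \<gamma> p z" using z(2) by (intro d(2)) auto
    then show False using z(1) by (simp add: Z_def)
  qed
  then have lt: "u0 < 1 / 2" using u0 osc by (cases "u0 = 1 / 2") auto
  have above: "rebounds \<mu> \<beta> \<gamma> p v" if "u0 < v" "v \<le> 1 / 2" for v
    using cSup_upper[OF _ bdd, of v] that u0 by (force simp: u0_def Z_def)
  have "supp u0 = {0<..}"
  proof (rule limit_of_rebounds[OF _ _ a no])
    fix d :: real assume d: "d > 0"
    define v where "v = min (u0 + d / 2) (1 / 2)"
    have "v \<le> 1 / 2" unfolding v_def by (rule min.cobounded2)
    moreover have "v \<le> u0 + d / 2" unfolding v_def by (rule min.cobounded1)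
    moreover have "u0 < v" using d lt by (simp add: v_def)
    ultimately have "u0 < v" "v \<le> 1 / 2" "\<bar>u0 - v\<bar> < d" using d by linarith+
    then show "\<exists>v0. 0 < v0 \<and> v0 < 1 \<and> \<bar>u0 - v0\<bar> < d \<and> rebounds \<mu> \<beta> \<gamma> p v0"
      using above u0 by (intro exI[of _ v]) auto
  qed (use u0 in auto)
  then show ?thesis using u0 by (intro exI[of _ u0]) auto
qed

end

subsection \<open>Critical exponents\<close>

context exponents begin

lemma c_sign: "N \<ge> 3 \<Longrightarrow> c * (p - m) = (real N - 2) * (p - p_s N m \<sigma>)"
  using p m by (simp add: c_def \<mu>_def \<theta>_def p_s_def field_simps)

lemma a_sign: "N \<ge> 3 \<Longrightarrow> (real N - 2 - \<mu>) * (p - m) = (real N - 2) * (p - p_c N m \<sigma>)"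
  using p m by (simp add: \<mu>_def \<theta>_def p_c_def field_simps)

lemma c_pos_iff:
  assumes "N \<ge> 3"
  shows "c > 0 \<longleftrightarrow> p > p_s N m \<sigma>" "c < 0 \<longleftrightarrow> p < p_s N m \<sigma>" "c = 0 \<longleftrightarrow> p = p_s N m \<sigma>"
proof -
  have "p - m > 0" "real N - 2 > 0" using p m assms by auto
  then have "sgn c = sgn (p - p_s N m \<sigma>)"
    using arg_cong[OF c_sign[OF assms], of sgn] by (simp add: sgn_mult)
  then show "c > 0 \<longleftrightarrow> p > p_s N m \<sigma>" "c < 0 \<longleftrightarrow> p < p_s N m \<sigma>" "c = 0 \<longleftrightarrow> p = p_s N m \<sigma>"
    by (auto simp: sgn_if split: if_splits)
qed

lemma a_pos_iff:
  assumes "N \<ge> 3"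
  shows "a > 0 \<longleftrightarrow> p > p_c N m \<sigma>"
proof -
  have "p - m > 0" "real N - 2 > 0" using p m assms by auto
  then have "sgn (real N - 2 - \<mu>) = sgn (p - p_c N m \<sigma>)"
    using arg_cong[OF a_sign[OF assms], of sgn] by (simp add: sgn_mult)
  then have "real N - 2 - \<mu> > 0 \<longleftrightarrow> p > p_c N m \<sigma>"
    by (auto simp: sgn_if split: if_splits)
  then show ?thesis using mu_pos by (simp add: a_def zero_less_mult_iff)
qed

text \<open>p < p_L in the form 2 m < \<mu> (1 - m) meets (N - 2) (1 - m) \<le> 2 m, which is m
  \<ge> m_c; together they give N - 2 \<le> \<mu>.\<close>

lemma a_nonpos_large_m:
  assumes "N \<in> {1, 2} \<or> m \<ge> m_c N"
  shows "a \<le> 0"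
proof -
  have "real N - 2 \<le> \<mu>"
  proof (cases "N \<le> 2")
    case True
    then have "real N \<le> 2" by simp
    then show ?thesis using mu_pos by linarith
  next
    case False
    then have "m \<ge> m_c N" using assms by auto
    then have "real N - 2 \<le> m * real N" using N by (simp add: m_c_def field_simps)
    then have "(real N - 2) * (1 - m) \<le> 2 * m" by (simp add: algebra_simps)
    also have "2 * m \<le> \<mu> * (1 - m)"
      using mult_left_mono[of 2 "\<theta> * (1 - m)" m] kappa_pos m by (simp add: \<kappa>_def \<mu>_def mult.assoc)
    finally show ?thesis using m by simp
  qed
  then show ?thesis using mu_pos by (simp add: a_def mult_nonneg_nonpos)
qed

end

text \<open>Multiplied by N - 2, the difference factors as (N - 2 - m (N + 2)) (1 + \<sigma> / 2),
  and m < m_s makes the first factor positive.\<close>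

lemma p_s_less_p_L:
  assumes "N \<ge> 3" "0 < \<sigma>" "m < m_s N"
  shows "p_s N m \<sigma> < p_L m \<sigma>"
proof -
  have n: "real N - 2 > 0" using assms by simp
  have "m * (real N + 2) < real N - 2" using assms by (simp add: m_s_def field_simps)
  then have "0 < (real N - 2 - m * (real N + 2)) * (1 + \<sigma> / 2)" using assms by simp
  also have "\<dots> = (real N - 2) * p_L m \<sigma> - m * (real N + 2 * \<sigma> + 2)"
    by (simp add: p_L_def field_simps)
  finally show ?thesis using n by (simp add: p_s_def pos_divide_less_eq mult.commute)
qed

text \<open>N \<le> \<theta> means N \<beta> \<le> \<alpha>, the case of
  \<open>barenblatt_bound\<close>. The result depends neither on the profile nor on p, so p may
  approach p_c.\<close>

lemma (in entire_radial_solution) G_bound: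
  assumes "real N \<le> \<theta>"
  shows "glob.G s \<le> 2 / (1 - m)"
proof -
  define X where "X = (exp s)\<^sup>2 * w (exp s) powr (1 / m - 1)"
  have X: "X \<ge> 0" by (simp add: X_def)
  have "real N * \<beta> \<le> \<alpha>" using assms beta_pos by (simp add: alpha_eq mult.commute)
  from barenblatt_bound[OF this, of "exp s"] have 1: "\<alpha> * (1 - m) / (2 * m * real N) * X \<le> 1"
    by (simp add: X_def mult.assoc)
  have "\<beta> \<le> \<alpha> / real N" using \<open>real N * \<beta> \<le> \<alpha>\<close> N by (simp add: pos_le_divide_eq mult.commute)
  then have "\<beta> * ((1 - m) / (2 * m)) \<le> \<alpha> / real N * ((1 - m) / (2 * m))" using m by (intro mult_right_mono) auto
  also have "\<dots> = \<alpha> * (1 - m) / (2 * m * real N)" by simp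
  finally have "\<beta> * ((1 - m) / (2 * m)) * X \<le> 1" using 1 X by (meson mult_right_mono order_trans)
  then have "\<beta> / m * X \<le> 2 / (1 - m)" using m by (simp add: field_simps)
  moreover have "glob.G s = \<beta> / m * X"
    using traj_G[of s] by (simp add: glob.G_def traj.G_def X_def mult.assoc)
  ultimately show ?thesis by simp
qed

text \<open>As p decreases to p_c, \<mu> tends to N - 2, so a tends to 0 and c to - (N - 2), while
  \<theta> tends to (N - 2) / m > N because m < m_c. Thus B, \<epsilon> and T can be fixed first,
  and p is taken close to p_c afterwards.\<close>

lemma no_profile_near_critical:
  assumes N: "N \<ge> 3" and m: "0 < m" "m < m_c N" and \<sigma>: "\<sigma> > 0"
  shows "\<exists>p1 > p_c N m \<sigma>. \<forall>p. p_c N m \<sigma> < p \<and> p < p1 \<and> 1 < p \<and> p < p_L m \<sigma> \<longrightarrow> (\<forall>f. \<not> is_profile N m \<sigma> p f)"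
proof -
  note N3 = N
  define pc where "pc = p_c N m \<sigma>"
  define n where "n = real N - 2"
  have n: "n \<ge> 1" using N by (simp add: n_def)
  have mN: "m * real N < n" using m N by (simp add: m_c_def n_def field_simps)
  then have m1: "m < 1" using N by (smt (verit, best) m(1) mult_less_cancel_right1 n_def of_nat_0_le_iff mult_le_cancel_right1)
  have pcm: "pc - m = m * (\<sigma> + 2) / n" using n by (simp add: pc_def p_c_def n_def field_simps)
  have pcm0: "pc - m > 0" unfolding pcm using m \<sigma> n by simp
  define th where "th = (\<lambda>p. (\<sigma> + 2) / (p - m))"
  have th_pc: "th pc = n / m" unfolding th_def pcm using m \<sigma> n by simp
  have lim_id: "((\<lambda>p. p) \<longlongrightarrow> pc) (at_right pc)" by (rule tendsto_ident_at)
  have th_lim: "(th \<longlongrightarrow> n / m) (at_right pc)"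
    unfolding th_pc[symmetric] unfolding th_def using pcm0 by (intro tendsto_intros lim_id) auto
  define ka where "ka = n / m * (1 - m) - 2"
  have ka: "ka > 0"
  proof -
    have "2 * m < n * (1 - m)" using mN by (simp add: n_def algebra_simps)
    then show ?thesis using m by (simp add: ka_def pos_less_divide_eq)
  qed
  define r where "r = (1 - m) / m"
  have r: "r > 0" using m m1 by (simp add: r_def)
  \<comment> \<open>Near p_c, ka / 2 is a lower bound for \<kappa>, so this choice ensures \<rho>
    \<epsilon> \<le> \<kappa> / 2.\<close>
  define \<epsilon> where "\<epsilon> = min 1 (ka / 2 / (2 * r))"
  have eps: "0 < \<epsilon>" "\<epsilon> \<le> 1" using ka r by (auto simp: \<epsilon>_def)
  have reps: "r * \<epsilon> \<le> ka / 2 / 2"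
  proof -
    have "\<epsilon> \<le> ka / 2 / (2 * r)" unfolding \<epsilon>_def by (rule min.cobounded2)
    then have "r * \<epsilon> \<le> r * (ka / 2 / (2 * r))" using r by (intro mult_left_mono) auto
    then show ?thesis using r by simp
  qed
  define B where "B = 2 / (1 - m)"
  have B: "B > 0" using m1 by (simp add: B_def)
  \<comment> \<open>Makes exp (\<kappa> T / 2) at least 2 B + 1; as - c > 1 / 2 near p_c, the
    product with - c exceeds B.\<close>
  define T where "T = ln (2 * B + 1) / (ka / 2 / 2)"
  have T: "T > 0" using B ka by (simp add: T_def)
  have expT: "exp (ka / 2 / 2 * T) = 2 * B + 1" using B ka by (simp add: T_def)
  \<comment> \<open>The left-hand side of the condition \<open>small\<close> in
    \<open>not_global_small\<close>, as a function of p; its factor a tends to zero.\<close>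
  define S where "S = (\<lambda>p. m * th p * (n - m * th p) * (p / m + 5) / 2 *
    exp ((3 + p / m + 2 * \<bar>n - 2 * (m * th p)\<bar> + 2 * B) * T))"
  have "(S \<longlongrightarrow> m * (n / m) * (n - m * (n / m)) * (pc / m + 5) / 2 *
    exp ((3 + pc / m + 2 * \<bar>n - 2 * (m * (n / m))\<bar> + 2 * B) * T)) (at_right pc)"
    unfolding S_def using m by (intro tendsto_intros th_lim lim_id) auto
  then have S_lim: "(S \<longlongrightarrow> 0) (at_right pc)" using m by simp
  have "((\<lambda>p. n - 2 * (m * th p)) \<longlongrightarrow> n - 2 * (m * (n / m))) (at_right pc)"
    by (intro tendsto_intros th_lim)
  then have c_lim: "((\<lambda>p. n - 2 * (m * th p)) \<longlongrightarrow> - n) (at_right pc)" using m by simp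
  have k_lim: "((\<lambda>p. th p * (1 - m) - 2) \<longlongrightarrow> ka) (at_right pc)"
    unfolding ka_def by (intro tendsto_intros th_lim)
  have "real N < n / m" using mN m by (simp add: pos_less_divide_eq mult.commute)
  then have "eventually (\<lambda>p. real N < th p) (at_right pc)" by (rule order_tendstoD(1)[OF th_lim])
  moreover have "eventually (\<lambda>p. n - 2 * (m * th p) < - 1 / 2) (at_right pc)"
    by (rule order_tendstoD(2)[OF c_lim]) (use n in simp)
  moreover have "eventually (\<lambda>p. ka / 2 < th p * (1 - m) - 2) (at_right pc)"
    by (rule order_tendstoD(1)[OF k_lim]) (use ka in simp)
  moreover have "eventually (\<lambda>p. S p < \<epsilon>\<^sup>2) (at_right pc)"
    by (rule order_tendstoD(2)[OF S_lim]) (use eps in simp)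
  ultimately have "eventually (\<lambda>p. real N < th p \<and> n - 2 * (m * th p) < - 1 / 2 \<and>
      ka / 2 < th p * (1 - m) - 2 \<and> S p < \<epsilon>\<^sup>2) (at_right pc)"
    by eventually_elim simp
  then obtain p1 where p1: "p1 > pc" "\<And>p. pc < p \<Longrightarrow> p < p1 \<Longrightarrow> real N < th p \<and> n - 2 * (m * th p) < - 1 / 2 \<and>
      ka / 2 < th p * (1 - m) - 2 \<and> S p < \<epsilon>\<^sup>2"
    unfolding eventually_at_right_field by blast
  have "\<not> is_profile N m \<sigma> p f" if hp: "pc < p" "p < p1" "1 < p" "p < p_L m \<sigma>" for p f
  proof
    assume prof: "is_profile N m \<sigma> p f"
    interpret exponents N m \<sigma> p using N m m1 \<sigma> hp by unfold_locales auto
    interpret entire_radial_solution N m \<sigma> p "f 0 powr m" "\<lambda>x. f x powr m" "deriv (\<lambda>x. f x powr m)"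
      by (rule profile_entire[OF prof])
    have th: "th p = \<theta>" by (simp add: th_def \<theta>_def)
    have cn: "c = n - 2 * (m * th p)" and an: "a = m * th p * (n - m * th p)"
      by (simp_all add: c_def a_def n_def \<mu>_def th)
    have pp: "real N < \<theta>" "c < - 1 / 2" "ka / 2 < \<kappa>" "S p < \<epsilon>\<^sup>2"
      using p1(2)[OF hp(1,2)] unfolding cn \<kappa>_def by (auto simp: th)
    show False
    proof (rule glob.not_global_small[where B = B and \<epsilon> = \<epsilon> and T = T])
      show "c < 0" using pp by simp
      show "0 < a" using a_pos_iff[OF N3] hp(1) by (simp add: pc_def)
      show "glob.G s \<le> B" for s unfolding B_def by (rule G_bound) (use pp in simp)
      show "0 < \<epsilon>" "\<epsilon> \<le> 1" "0 < T" using eps T by auto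
      show "\<rho> * \<epsilon> \<le> \<kappa> / 2" using reps pp(3) unfolding \<rho>_def r_def by linarith
      show "B < - c * exp (\<kappa> / 2 * T)"
      proof -
        have "1 / 2 * (2 * B + 1) \<le> - c * exp (\<kappa> / 2 * T)"
          unfolding expT[symmetric] using pp T by (intro mult_mono) auto
        then show ?thesis by simp
      qed
      show "a * (q + 5) / 2 * exp ((3 + q + 2 * \<bar>c\<bar> + 2 * B) * T) < \<epsilon>\<^sup>2"
        using pp(4) unfolding S_def an cn q_def .
    qed
  qed
  then show ?thesis using p1(1) unfolding pc_def by blast
qed

text \<open>The datum 1/2 rebounds at p_s, rebounding is stable under small changes of \<mu>,
  \<beta>, \<gamma> and p, and the first three depend continuously on p.\<close>

lemma rebounds_near_sobolev:
  assumes N: "N \<ge> 3" and m: "0 < m" "m < 1" and \<sigma>: "\<sigma> > 0" and ps: "1 < p_s N m \<sigma>" "p_s N m \<sigma> < p_L m \<sigma>"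
  shows "\<exists>b < p_s N m \<sigma>. \<forall>p. b < p \<and> p < p_s N m \<sigma> \<and> 1 < p \<longrightarrow>
    shooting_data.rebounds N m \<sigma> (m * ((\<sigma> + 2) / (p - m))) (ss_beta m \<sigma> p)
      (ss_alpha m \<sigma> p - real N * ss_beta m \<sigma> p) p (1 / 2)"
proof -
  define ps where "ps = p_s N m \<sigma>"
  interpret S: exponents N m \<sigma> ps using N m \<sigma> ps by unfold_locales (auto simp: ps_def)
  have "S.c = 0" using S.c_pos_iff(3)[OF N] by (simp add: ps_def)
  then have "S.rebounds S.\<mu> S.\<beta> S.\<gamma> ps (1 / 2)" by (intro S.rebounds_at_critical) auto
  from S.rebounds_open[OF S.beta_nonneg S.p(1) this]
  obtain d where d: "d > 0" "\<And>\<mu>' \<beta>' \<gamma>' p'. \<beta>' \<ge> 0 \<Longrightarrow> p' > 1 \<Longrightarrow> \<bar>S.\<mu> - \<mu>'\<bar> < d \<Longrightarrow> \<bar>S.\<beta> - \<beta>'\<bar> < d \<Longrightarrow>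
      \<bar>S.\<gamma> - \<gamma>'\<bar> < d \<Longrightarrow> \<bar>ps - p'\<bar> < d \<Longrightarrow> S.rebounds \<mu>' \<beta>' \<gamma>' p' (1 / 2)"
    by (metis abs_zero diff_self)
  have near: "eventually (\<lambda>p. \<bar>F ps - F p\<bar> < d) (at_left ps)" if "(F \<longlongrightarrow> F ps) (at_left ps)" for F :: "real \<Rightarrow> real"
    using tendstoD[OF that d(1)] by (simp add: dist_real_def abs_minus_commute)
  have id: "((\<lambda>p. p) \<longlongrightarrow> ps) (at_left ps)" by (rule tendsto_ident_at)
  have L: "L_const m \<sigma> ps \<noteq> 0" using S.L_neg by simp
  have Llim: "((\<lambda>p. L_const m \<sigma> p) \<longlongrightarrow> L_const m \<sigma> ps) (at_left ps)"
    unfolding L_const_def by (intro tendsto_intros id)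
  have blim: "((\<lambda>p. ss_beta m \<sigma> p) \<longlongrightarrow> S.\<beta>) (at_left ps)"
    unfolding ss_beta_def by (intro tendsto_intros id Llim L)
  have alim: "((\<lambda>p. ss_alpha m \<sigma> p) \<longlongrightarrow> S.\<alpha>) (at_left ps)"
    unfolding ss_alpha_def by (intro tendsto_intros id Llim L)
  have glim: "((\<lambda>p. ss_alpha m \<sigma> p - real N * ss_beta m \<sigma> p) \<longlongrightarrow> S.\<gamma>) (at_left ps)"
    by (intro tendsto_intros alim blim)
  have mlim: "((\<lambda>p. m * ((\<sigma> + 2) / (p - m))) \<longlongrightarrow> m * ((\<sigma> + 2) / (ps - m))) (at_left ps)"
    using S.p(1) m by (intro tendsto_intros id) auto
  have "eventually (\<lambda>p. 0 < ss_beta m \<sigma> p) (at_left ps)"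
    by (rule order_tendstoD(1)[OF blim S.beta_pos])
  with near[OF mlim] near[OF blim] near[OF glim] near[OF id]
  have "eventually (\<lambda>p. \<bar>m * ((\<sigma> + 2) / (ps - m)) - m * ((\<sigma> + 2) / (p - m))\<bar> < d \<and> \<bar>S.\<beta> - ss_beta m \<sigma> p\<bar> < d \<and>
      \<bar>S.\<gamma> - (ss_alpha m \<sigma> p - real N * ss_beta m \<sigma> p)\<bar> < d \<and> \<bar>ps - p\<bar> < d \<and> 0 < ss_beta m \<sigma> p) (at_left ps)"
    by eventually_elim simp
  then obtain b where b: "b < ps" "\<And>p. b < p \<Longrightarrow> p < ps \<Longrightarrow>
      \<bar>m * ((\<sigma> + 2) / (ps - m)) - m * ((\<sigma> + 2) / (p - m))\<bar> < d \<and> \<bar>S.\<beta> - ss_beta m \<sigma> p\<bar> < d \<and>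
      \<bar>S.\<gamma> - (ss_alpha m \<sigma> p - real N * ss_beta m \<sigma> p)\<bar> < d \<and> \<bar>ps - p\<bar> < d \<and> 0 < ss_beta m \<sigma> p"
    unfolding eventually_at_left_field by blast
  have "S.rebounds (m * ((\<sigma> + 2) / (p - m))) (ss_beta m \<sigma> p) (ss_alpha m \<sigma> p - real N * ss_beta m \<sigma> p) p (1 / 2)"
    if "b < p" "p < ps" "1 < p" for p
    using b(2)[OF that(1,2)] that(3) by (intro d(2)) (auto simp: S.\<mu>_def S.\<theta>_def)
  then show ?thesis using b(1) unfolding ps_def by blast
qed

section \<open>From profiles to self-similar solutions\<close>

lemma self_similar_solution_profile:
  fixes u :: "'a::euclidean_space \<Rightarrow> real \<Rightarrow> real"
  assumes "self_similar_solution m \<sigma> p T f u"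
  shows "is_profile DIM('a) m \<sigma> p f"
  using assms by (simp add: self_similar_solution_def)

lemma self_similar_solutionI:
  assumes "is_profile DIM('a::euclidean_space) m \<sigma> p f"
  shows "\<exists>u :: 'a \<Rightarrow> real \<Rightarrow> real. self_similar_solution m \<sigma> p 1 f u"
  using assms unfolding self_similar_solution_def
  by (intro exI[of _ "\<lambda>x t. (1 - t) powr ss_alpha m \<sigma> p * f (norm x * (1 - t) powr ss_beta m \<sigma> p)"]) auto

theorem theorem1p2:
  fixes N :: nat and m \<sigma> :: real
  assumes N: "N = DIM('a::euclidean_space)"
    and m: "0 < m" "m < 1"
    and \<sigma>: "\<sigma> > 0"
  shows
    "(N \<ge> 3 \<and> (real N - 2) / (real N + 2 + 2 * \<sigma>) < m \<and> m < m_s N \<longrightarrow>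
       (\<exists>p\<^sub>0. p_c N m \<sigma> < p\<^sub>0 \<and> p\<^sub>0 < p_s N m \<sigma> \<and> 1 < p\<^sub>0 \<and>
          (\<forall>p. p\<^sub>0 < p \<and> p < p_s N m \<sigma> \<longrightarrow>
             (\<exists>T f (u :: 'a \<Rightarrow> real \<Rightarrow> real) C D.
                self_similar_solution m \<sigma> p T f u \<and> strict_antimono_on {0..} f \<and>
                C > 0 \<and> D > 0 \<and> origin_behavior N m \<sigma> p D f \<and>
                decay_at_infinity ((real N - 2) / m) C f) \<and>
             \<not> (\<exists>T f (u :: 'a \<Rightarrow> real \<Rightarrow> real) C D.
                self_similar_solution m \<sigma> p T f u \<and>
                C > 0 \<and> D > 0 \<and> origin_behavior N m \<sigma> p D f \<and>
                decay_at_infinity ((\<sigma> + 2) / (p - m)) C f)) \<and>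
          (\<exists>p\<^sub>1. p_c N m \<sigma> < p\<^sub>1 \<and> p\<^sub>1 \<le> p\<^sub>0 \<and>
             (\<forall>p. 1 < p \<and> p < p\<^sub>1 \<longrightarrow>
                \<not> (\<exists>T f (u :: 'a \<Rightarrow> real \<Rightarrow> real). self_similar_solution m \<sigma> p T f u)))))
   \<and> (N \<ge> 3 \<and> m < m_s N \<longrightarrow>
       (\<forall>p. max (p_s N m \<sigma>) 1 < p \<and> p < p_L m \<sigma> \<longrightarrow>
          (\<exists>T f (u :: 'a \<Rightarrow> real \<Rightarrow> real) C D.
             self_similar_solution m \<sigma> p T f u \<and> strict_antimono_on {0..} f \<and>
             C > 0 \<and> D > 0 \<and> origin_behavior N m \<sigma> p D f \<and>
             decay_at_infinity ((\<sigma> + 2) / (p - m)) C f) \<and>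
          \<not> (\<exists>T f (u :: 'a \<Rightarrow> real \<Rightarrow> real) C.
             self_similar_solution m \<sigma> p T f u \<and>
             C > 0 \<and> decay_at_infinity ((real N - 2) / m) C f)))
   \<and> (N \<in> {1, 2} \<or> m \<ge> m_c N \<longrightarrow>
       (\<forall>p. 1 < p \<and> p < p_L m \<sigma> \<longrightarrow>
          \<not> (\<exists>T f (u :: 'a \<Rightarrow> real \<Rightarrow> real). self_similar_solution m \<sigma> p T f u)))"
proof -
  have N1: "N \<ge> 1" using DIM_positive[where 'a = 'a] unfolding N by linarith
  have ex: "exponents N m \<sigma> p" if "1 < p" "p < p_L m \<sigma>" for p
    using N1 m \<sigma> that by unfold_locales
  have profile: "is_profile N m \<sigma> p f" if "self_similar_solution m \<sigma> p T f u"
    for p T f and u :: "'a \<Rightarrow> real \<Rightarrow> real"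
    using self_similar_solution_profile[OF that] N by simp
  have solution: "\<exists>u :: 'a \<Rightarrow> real \<Rightarrow> real. self_similar_solution m \<sigma> p 1 f u" if "is_profile N m \<sigma> p f" for p f
    using that N by (intro self_similar_solutionI) simp
  have existence: "\<exists>T f (u :: 'a \<Rightarrow> real \<Rightarrow> real) C D.
        self_similar_solution m \<sigma> p T f u \<and> strict_antimono_on {0..} f \<and>
        C > 0 \<and> D > 0 \<and> origin_behavior N m \<sigma> p D f \<and> decay_at_infinity k C f"
    if R: "entire_radial_solution N m \<sigma> p u0 w w1" and C: "C > 0" "((\<lambda>x. w x powr (1 / m) * x powr k) \<longlongrightarrow> C) at_top"
    for p u0 w w1 k C
  proof -
    interpret entire_radial_solution N m \<sigma> p u0 w w1 by (rule R)
    obtain u :: "'a \<Rightarrow> real \<Rightarrow> real" where "self_similar_solution m \<sigma> p 1 prof u"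
      using solution[OF prof_is_profile] by blast
    then show ?thesis using prof_strict_antimono prof_origin prof_decay[OF C] C w0
      by (intro exI[of _ 1] exI[of _ prof] exI[of _ u] exI[of _ C] exI[of _ "u0 powr ((m - 1) / m)"]) auto
  qed
  have part1: "\<exists>p\<^sub>0. p_c N m \<sigma> < p\<^sub>0 \<and> p\<^sub>0 < p_s N m \<sigma> \<and> 1 < p\<^sub>0 \<and>
      (\<forall>p. p\<^sub>0 < p \<and> p < p_s N m \<sigma> \<longrightarrow>
         (\<exists>T f (u :: 'a \<Rightarrow> real \<Rightarrow> real) C D.
            self_similar_solution m \<sigma> p T f u \<and> strict_antimono_on {0..} f \<and>
            C > 0 \<and> D > 0 \<and> origin_behavior N m \<sigma> p D f \<and> decay_at_infinity ((real N - 2) / m) C f) \<and>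
         \<not> (\<exists>T f (u :: 'a \<Rightarrow> real \<Rightarrow> real) C D.
            self_similar_solution m \<sigma> p T f u \<and>
            C > 0 \<and> D > 0 \<and> origin_behavior N m \<sigma> p D f \<and> decay_at_infinity ((\<sigma> + 2) / (p - m)) C f)) \<and>
      (\<exists>p\<^sub>1. p_c N m \<sigma> < p\<^sub>1 \<and> p\<^sub>1 \<le> p\<^sub>0 \<and>
         (\<forall>p. 1 < p \<and> p < p\<^sub>1 \<longrightarrow>
            \<not> (\<exists>T f (u :: 'a \<Rightarrow> real \<Rightarrow> real). self_similar_solution m \<sigma> p T f u)))"
    if N3: "N \<ge> 3" and lower: "(real N - 2) / (real N + 2 + 2 * \<sigma>) < m" and ms: "m < m_s N"
  proof -
    have n: "real N - 2 > 0" using N3 by simp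
    \<comment> \<open>The lower bound on m says exactly that p_s > 1.\<close>
    have ps1: "1 < p_s N m \<sigma>" using lower n \<sigma> by (simp add: p_s_def field_simps)
    have psL: "p_s N m \<sigma> < p_L m \<sigma>" by (rule p_s_less_p_L[OF N3 \<sigma> ms])
    have pcs: "p_c N m \<sigma> < p_s N m \<sigma>"
      unfolding p_c_def p_s_def using n m \<sigma> by (intro divide_strict_right_mono mult_strict_left_mono) auto
    have mc: "m < m_c N"
    proof -
      have "m_s N < m_c N" unfolding m_s_def m_c_def using n N1 by (intro divide_strict_left_mono) auto
      then show ?thesis using ms by simp
    qed
    obtain b where b: "b < p_s N m \<sigma>" "\<And>p. b < p \<Longrightarrow> p < p_s N m \<sigma> \<Longrightarrow> 1 < p \<Longrightarrow>
        shooting_data.rebounds N m \<sigma> (m * ((\<sigma> + 2) / (p - m))) (ss_beta m \<sigma> p)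
          (ss_alpha m \<sigma> p - real N * ss_beta m \<sigma> p) p (1 / 2)"
      using rebounds_near_sobolev[OF N3 m \<sigma> ps1 psL] by blast
    obtain p1' where p1': "p1' > p_c N m \<sigma>" "\<And>p f. p_c N m \<sigma> < p \<Longrightarrow> p < p1' \<Longrightarrow> 1 < p \<Longrightarrow> p < p_L m \<sigma> \<Longrightarrow>
        \<not> is_profile N m \<sigma> p f"
      using no_profile_near_critical[OF N3 m(1) mc \<sigma>] by blast
    \<comment> \<open>The two midpoints keep p0 strictly above p_c and 1 and strictly below
      p_s.\<close>
    define p0 where "p0 = max b (max ((p_c N m \<sigma> + p_s N m \<sigma>) / 2) ((1 + p_s N m \<sigma>) / 2))"
    have p0: "p_c N m \<sigma> < p0" "p0 < p_s N m \<sigma>" "1 < p0" "b \<le> p0"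
      using pcs ps1 b(1) by (auto simp: p0_def max_def)
    define p1 where "p1 = min p0 p1'"
    have p1: "p_c N m \<sigma> < p1" "p1 \<le> p0" "p1 \<le> p1'" using p0 p1' by (auto simp: p1_def)
    have fast: "(\<exists>T f (u :: 'a \<Rightarrow> real \<Rightarrow> real) C D.
            self_similar_solution m \<sigma> p T f u \<and> strict_antimono_on {0..} f \<and>
            C > 0 \<and> D > 0 \<and> origin_behavior N m \<sigma> p D f \<and> decay_at_infinity ((real N - 2) / m) C f) \<and>
         \<not> (\<exists>T f (u :: 'a \<Rightarrow> real \<Rightarrow> real) C D.
            self_similar_solution m \<sigma> p T f u \<and>
            C > 0 \<and> D > 0 \<and> origin_behavior N m \<sigma> p D f \<and> decay_at_infinity ((\<sigma> + 2) / (p - m)) C f)"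
      if hp: "p0 < p" "p < p_s N m \<sigma>" for p
    proof
      interpret exponents N m \<sigma> p using ex hp p0 psL by simp
      have c: "c < 0" using c_pos_iff(2)[OF N3] hp by simp
      have a: "a > 0" using a_pos_iff[OF N3] hp p0 by simp
      have "rebounds \<mu> \<beta> \<gamma> p (1 / 2)"
        using b(2)[of p] hp p0 by (simp add: \<mu>_def \<theta>_def)
      then obtain u0 where u0: "0 < u0" "u0 < 1" "supp u0 = {0<..}"
        using exists_entire_fast[OF c a] by blast
      interpret entire_radial_solution N m \<sigma> p u0 "W u0" "W1 u0" by (rule supp_entire[OF u0])
      obtain C where "C > 0" "((\<lambda>x. W u0 x powr (1 / m) * x powr ((real N - 2) / m)) \<longlongrightarrow> C) at_top"
        using fast(2)[OF c a] by blast
      then show "\<exists>T f (u :: 'a \<Rightarrow> real \<Rightarrow> real) C D.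
            self_similar_solution m \<sigma> p T f u \<and> strict_antimono_on {0..} f \<and>
            C > 0 \<and> D > 0 \<and> origin_behavior N m \<sigma> p D f \<and> decay_at_infinity ((real N - 2) / m) C f"
        by (rule existence[OF supp_entire[OF u0]])
      show "\<not> (\<exists>T f (u :: 'a \<Rightarrow> real \<Rightarrow> real) C D.
            self_similar_solution m \<sigma> p T f u \<and>
            C > 0 \<and> D > 0 \<and> origin_behavior N m \<sigma> p D f \<and> decay_at_infinity ((\<sigma> + 2) / (p - m)) C f)"
        using no_slow_profile[OF c a] profile unfolding \<theta>_def by blast
    qed
    have none: "\<not> (\<exists>T f (u :: 'a \<Rightarrow> real \<Rightarrow> real). self_similar_solution m \<sigma> p T f u)"
      if hp: "1 < p" "p < p1" for p
    proof -
      have pL: "p < p_L m \<sigma>" using hp p1 p0 psL by simp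
      interpret exponents N m \<sigma> p by (rule ex[OF hp(1) pL])
      have "\<not> is_profile N m \<sigma> p f" for f
      \<comment> \<open>Up to p_c nonexistence comes from a \<le> 0, above it from the smallness of
        a.\<close>
      proof (cases "p_c N m \<sigma> < p")
        case True
        then show ?thesis using p1'(2)[of p f] hp p1 pL by simp
      next
        case False
        then show ?thesis using no_profile_subcritical a_pos_iff[OF N3] by simp
      qed
      then show ?thesis using profile by blast
    qed
    show ?thesis using p0 p1 fast none by blast
  qed
  have part2: "(\<exists>T f (u :: 'a \<Rightarrow> real \<Rightarrow> real) C D.
             self_similar_solution m \<sigma> p T f u \<and> strict_antimono_on {0..} f \<and>
             C > 0 \<and> D > 0 \<and> origin_behavior N m \<sigma> p D f \<and> decay_at_infinity ((\<sigma> + 2) / (p - m)) C f) \<and>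
          \<not> (\<exists>T f (u :: 'a \<Rightarrow> real \<Rightarrow> real) C.
             self_similar_solution m \<sigma> p T f u \<and> C > 0 \<and> decay_at_infinity ((real N - 2) / m) C f)"
    if N3: "N \<ge> 3" and hp: "p_s N m \<sigma> < p" "1 < p" "p < p_L m \<sigma>" for p
  proof
    interpret exponents N m \<sigma> p by (rule ex[OF hp(2,3)])
    have c: "c > 0" using c_pos_iff(1)[OF N3] hp by simp
    \<comment> \<open>For c > 0 no solution crosses, so any initial value between 0 and 1 would
      do.\<close>
    have u0: "0 < (1 / 2 :: real)" "(1 / 2 :: real) < 1" by simp_all
    have supp: "supp (1 / 2) = {0<..}" using no_crossing[OF u0] c by simp
    interpret entire_radial_solution N m \<sigma> p "1 / 2" "W (1 / 2)" "W1 (1 / 2)"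
      by (rule supp_entire[OF u0 supp])
    obtain C where "C > 0" "((\<lambda>x. W (1 / 2) x powr (1 / m) * x powr ((\<sigma> + 2) / (p - m))) \<longlongrightarrow> C) at_top"
      using slow(1)[OF c] unfolding \<theta>_def by blast
    then show "\<exists>T f (u :: 'a \<Rightarrow> real \<Rightarrow> real) C D.
             self_similar_solution m \<sigma> p T f u \<and> strict_antimono_on {0..} f \<and>
             C > 0 \<and> D > 0 \<and> origin_behavior N m \<sigma> p D f \<and> decay_at_infinity ((\<sigma> + 2) / (p - m)) C f"
      by (rule existence[OF supp_entire[OF u0 supp]])
    show "\<not> (\<exists>T f (u :: 'a \<Rightarrow> real \<Rightarrow> real) C.
             self_similar_solution m \<sigma> p T f u \<and> C > 0 \<and> decay_at_infinity ((real N - 2) / m) C f)"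
      using no_fast_profile[OF c] profile by blast
  qed
  have part3: "\<not> (\<exists>T f (u :: 'a \<Rightarrow> real \<Rightarrow> real). self_similar_solution m \<sigma> p T f u)"
    if mc: "N \<in> {1, 2} \<or> m \<ge> m_c N" and hp: "1 < p" "p < p_L m \<sigma>" for p
  proof -
    interpret exponents N m \<sigma> p by (rule ex[OF hp])
    show ?thesis
      using no_profile_subcritical[OF a_nonpos_large_m[OF mc]] profile by blast
  qed
  show ?thesis
    using part1 part2 part3 by simp
qed

end
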